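(* Let $\mathfrak{F}$ be an NKC category with fibre functor $F$. If $X$ is an $(\mathfrak{F},F)$-stratified fibre bundle and $V$ is an object of $\mathfrak{F}$, then the function space $X^V$ is an $(\mathfrak{F},F^V)$-stratified fibre bundle.
   Context: Structure category: a small category $\mathfrak{F}$ with a functor $F\colon\mathfrak{F}\to\mathbf{Top}$ (fibre functor) such that $F(V)$ is locally compact, second-countable and Hausdorff for each object $V$; one often writes $V$ for $F(V)$. $(\mathfrak{F},F)$-family: a space $X$ with a map $p_X\colon X\to\bar X$ (projection to the base space) and, for every $b\in\bar X$, an object $X_b$ of $\mathfrak{F}$ and a chosen homeomorphism (chart) $\Phi_b\colon p_X^{-1}(b)\approx F(X_b)$. An $\mathfrak{F}$-map $X\to Y$ is a pair of continuous maps $f\colon X\to Y$, $\bar f\colon\bar X\to\bar Y$ with $p_Yf=\bar fp_X$ such that for every $b\in\bar X$ the composite $\Phi_{\bar f b}\circ f|_{p_X^{-1}(b)}\circ\Phi_b^{-1}\colon F(X_b)\to F(Y_{\bar fb})$ equals $F(\phi)$ for some morphism $\phi\colon X_b\to Y_{\bar f b}$ of $\mathfrak{F}$. These form the category $\mathfrak{F}$-$\mathbf{Top}$. An object $V$ is also regarded as the family $F(V)\to *$. Pull-back: for a family $Y$ and a map $\bar f\colon\bar X\to\bar Y$, $\bar f^*Y=\bar X\times_{\bar Y}Y\to\bar X$ with $(\bar f^*Y)_b=Y_{\bar f b}$ and induced charts. The restriction $Y|U$ for $U\subset\bar Y$ is the pull-back along the inclusion. Bundle: a family $X$ such that each $b\in\bar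 X$ has a neighbourhood $U$ with $X|U$ isomorphic in $\mathfrak{F}$-$\mathbf{Top}$ to a product family $U\times F(V)\to U$ (charts given by projection), for some object $V$. Push-outs: a closed inclusion is an $\mathfrak{F}$-map $i\colon A\to Y$ such that $\bar i$ is the inclusion of a closed subspace and $A=\bar i^*Y$. Push-outs in $\mathfrak{F}$-$\mathbf{Top}$ of $X\leftarrow A\xrightarrow{i}Y$ with $i$ a closed inclusion are formed by the push-outs in $\mathbf{Top}$ of total spaces and of base spaces. $\lim$ of an increasing sequence denotes the colimit. Stratified space: a CW-pair is a pair homeomorphic to (CW-complex, subcomplex); a CW-space is a space homeomorphic to a CW-complex. A stratified space is a space $X$ with a filtration $X_0\subset X_1\subset\dots\subset\lim_{n}X_n=X$, where $X_0$ is a CW-space, and for every $i\ge1$ a given CW-pair $(M_i,A_i)$ and map $h_i\colon A_i\to X_{i-1}$ such that $X_i=X_{i-1}\cup_{h_i}M_i$ is the push-out. The $X_i\smallsetminus X_{i-1}$ are the strata. It is finite if the number of non-empty strata is finite. It is a stratified CW-complex if all attaching maps $h_i$ are cellular; a stratified space that is not finite is always assumed to be a stratified CW-complex. $(\mathfrak{F},F)$-stratified fibre bundle: a stratified space $\bar X$ (with CW-pairs $(\bar M_i,\bar A_i)$, space $\bar X_0$ and attaching maps $\bar h_i$) together with an $(\mathfrak{F},F)$-family $X\to\bar X$ such that, with $X_i=X|\bar X_i$: $X_0\to\bar X_0$ is a bundle; for $i\ge1$ there are a bundle $M_i\to\bar M_i$ with $A_i=M_i|\bar A_i$ and an $\mathfrak{F}$-map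 $h_i\colon A_i\to X_{i-1}$ over $\bar h_i$ such that $X_i=X_{i-1}\cup_{h_i}M_i$ is the push-out of $\mathfrak{F}$-maps; and $X=\lim_{i}X_i$. Function spaces ($F$ faithful): for an object $V$ and a family $Y$, $Y^V$ is the space of all $\mathfrak{F}$-maps $V\to Y$ with the compact-open topology. It has the projection $Y^V\to\bar Y$, $a\mapsto p_Ya(v_0)$ with $v_0\in F(V)$ arbitrary, whose fibre over $b$ is $\hom_{\mathfrak{F}}(V,Y_b)$ (via the chart of $Y$). $F^V\colon\mathfrak{F}\to\mathbf{Top}$ is the functor $W\mapsto W^V=\hom_{\mathfrak{F}}(V,W)$ with the compact-open topology; it need not be faithful. Thus $Y^V\to\bar Y$ is an $(\mathfrak{F},F^V)$-family. NKC: for $K\subset V$ and $U\subset Y$ put $N_{K,U}=\{f\in Y^V: f(K)\subset U\}$. A family $\mathcal{K}$ of compact subsets of $V$ is generating if for every $\mathfrak{F}$-family $Y$ the sets $N_{K,U}$ with $K\in\mathcal{K}$ and $U$ open in $Y$ form a sub-basis of the topology of $Y^V$. A structure category $\mathfrak{F}$ with faithful fibre functor $F$ is NKC if for every object $V$ there is a generating family $\mathcal{K}$ of compact subsets of $V$ such that for all $K\in\mathcal{K}$, all objects $W$ and all compact $C\subset W$ the subspace $N_{K,C}\subset\hom_{\mathfrak{F}}(V,W)=W^V$ is compact. *)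

theory Defs
  imports "HOL-Analysis.Analysis"
begin

section \<open>CW-complexes\<close>

definition disc :: "nat \<Rightarrow> (nat \<Rightarrow> real) topology" where
  "disc n = subtopology (Euclidean_space n) {x. (\<Sum>i<n. (x i)\<^sup>2) \<le> 1}"

definition disc_interior :: "nat \<Rightarrow> (nat \<Rightarrow> real) topology" where
  "disc_interior n = subtopology (Euclidean_space n) {x. (\<Sum>i<n. (x i)\<^sup>2) < 1}"

definition disc_boundary :: "nat \<Rightarrow> (nat \<Rightarrow> real) set" where
  "disc_boundary n = {x \<in> topspace (Euclidean_space n). (\<Sum>i<n. (x i)\<^sup>2) = 1}"

text \<open>A cell structure is given by its open cells: \<open>E n\<close> is the set of open \<open>n\<close>-cells.
  The definition is Whitehead's: characteristic maps, closure finiteness, weak topology.\<close>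

definition CW_complex :: "'a topology \<Rightarrow> (nat \<Rightarrow> 'a set set) \<Rightarrow> bool" where
  "CW_complex X E \<longleftrightarrow>
     Hausdorff_space X \<and>
     (\<Union>n. \<Union>(E n)) = topspace X \<and>
     (\<forall>m n e e'. e \<in> E m \<longrightarrow> e' \<in> E n \<longrightarrow> (m, e) \<noteq> (n, e') \<longrightarrow> e \<inter> e' = {}) \<and>
     (\<forall>n. \<forall>e \<in> E n. \<exists>\<Phi>.
        continuous_map (disc n) X \<Phi> \<and>
        homeomorphic_map (disc_interior n) (subtopology X e) \<Phi> \<and>
        (\<exists>J. finite J \<and> J \<subseteq> (\<Union>k<n. E k) \<and> \<Phi> ` disc_boundary n \<subseteq> \<Union>J)) \<and>
     (\<forall>T. T \<subseteq> topspace X \<longrightarrow>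
        (\<forall>n. \<forall>e \<in> E n. closedin X (T \<inter> X closure_of e)) \<longrightarrow> closedin X T)"

definition subcomplex :: "'a topology \<Rightarrow> (nat \<Rightarrow> 'a set set) \<Rightarrow> 'a set \<Rightarrow> bool" where
  "subcomplex X E A \<longleftrightarrow>
     (\<exists>L. (\<forall>n. L n \<subseteq> E n) \<and> A = (\<Union>n. \<Union>(L n)) \<and> (\<forall>n. \<forall>e \<in> L n. X closure_of e \<subseteq> A))"

definition skeleton :: "(nat \<Rightarrow> 'a set set) \<Rightarrow> nat \<Rightarrow> 'a set" where
  "skeleton E n = (\<Union>k\<le>n. \<Union>(E k))"

definition CW_space :: "'a topology \<Rightarrow> bool" where
  "CW_space X \<longleftrightarrow> (\<exists>(Y :: 'a topology) E. CW_complex Y E \<and> X homeomorphic_space Y)"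

definition CW_pair :: "'a topology \<Rightarrow> 'a set \<Rightarrow> bool" where
  "CW_pair X A \<longleftrightarrow> A \<subseteq> topspace X \<and>
     (\<exists>(Y :: 'a topology) E B f.
        CW_complex Y E \<and> subcomplex Y E B \<and> homeomorphic_map X Y f \<and> f ` A = B)"


section \<open>Push-outs along closed inclusions and sequential colimits in Top\<close>

text \<open>For \<open>A \<subseteq> Y\<close> and \<open>h : A \<rightarrow> X\<close>, the push-out \<open>X \<union>\<^sub>h Y\<close> is the quotient of the disjoint union of
  \<open>X\<close> and \<open>Y\<close> by the relation \<open>a \<sim> h a\<close>.  Each class has a unique representative \<open>Inl x\<close> with \<open>x\<close> in
  \<open>X\<close>, or \<open>Inr y\<close> with \<open>y\<close> in \<open>Y - A\<close>; these representatives are the points used here.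
  The quotient map is \<open>Inl\<close> on \<open>X\<close> and \<open>glue A h\<close> on \<open>Y\<close>.\<close>

definition glue :: "'y set \<Rightarrow> ('y \<Rightarrow> 'x) \<Rightarrow> 'y \<Rightarrow> 'x + 'y" where
  "glue A h y = (if y \<in> A then Inl (h y) else Inr y)"

definition adjunction_space ::
    "'x topology \<Rightarrow> 'y topology \<Rightarrow> 'y set \<Rightarrow> ('y \<Rightarrow> 'x) \<Rightarrow> ('x + 'y) topology" where
  "adjunction_space X Y A h = topology (\<lambda>U.
     U \<subseteq> topspace X <+> (topspace Y - A) \<and>
     openin X {x \<in> topspace X. Inl x \<in> U} \<and>
     openin Y {y \<in> topspace Y. glue A h y \<in> U})"

lemma openin_adjunction_space:
  "openin (adjunction_space X Y A h) U \<longleftrightarrow>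
     U \<subseteq> topspace X <+> (topspace Y - A) \<and>
     openin X {x \<in> topspace X. Inl x \<in> U} \<and>
     openin Y {y \<in> topspace Y. glue A h y \<in> U}"
proof -
  have "istopology (\<lambda>U. U \<subseteq> topspace X <+> (topspace Y - A) \<and>
     openin X {x \<in> topspace X. Inl x \<in> U} \<and> openin Y {y \<in> topspace Y. glue A h y \<in> U})"
    (is "istopology ?P")
    unfolding istopology_def
  proof (intro conjI allI impI)
    fix S T assume S: "?P S" and T: "?P T"
    have "{x \<in> topspace X. Inl x \<in> S \<inter> T}
        = {x \<in> topspace X. Inl x \<in> S} \<inter> {x \<in> topspace X. Inl x \<in> T}"
      and "{y \<in> topspace Y. glue A h y \<in> S \<inter> T}
        = {y \<in> topspace Y. glue A h y \<in> S} \<inter> {y \<in> topspace Y. glue A h y \<in> T}" by auto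
    with S T show "S \<inter> T \<subseteq> topspace X <+> (topspace Y - A)"
      "openin X {x \<in> topspace X. Inl x \<in> S \<inter> T}"
      "openin Y {y \<in> topspace Y. glue A h y \<in> S \<inter> T}" by auto
  next
    fix \<K> assume K: "\<forall>K\<in>\<K>. ?P K"
    have "{x \<in> topspace X. Inl x \<in> \<Union>\<K>} = (\<Union>K\<in>\<K>. {x \<in> topspace X. Inl x \<in> K})"
      and "{y \<in> topspace Y. glue A h y \<in> \<Union>\<K>} = (\<Union>K\<in>\<K>. {y \<in> topspace Y. glue A h y \<in> K})" by auto
    with K show "\<Union>\<K> \<subseteq> topspace X <+> (topspace Y - A)"
      "openin X {x \<in> topspace X. Inl x \<in> \<Union>\<K>}"
      "openin Y {y \<in> topspace Y. glue A h y \<in> \<Union>\<K>}" by auto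
  qed
  then show ?thesis
    by (simp add: adjunction_space_def)
qed

definition is_sequential_colimit :: "'a topology \<Rightarrow> (nat \<Rightarrow> 'a set) \<Rightarrow> bool" where
  "is_sequential_colimit X S \<longleftrightarrow>
     (\<forall>i. S i \<subseteq> S (Suc i)) \<and> (\<Union>i. S i) = topspace X \<and>
     (\<forall>U. U \<subseteq> topspace X \<longrightarrow>
        (openin X U \<longleftrightarrow> (\<forall>i. openin (subtopology X (S i)) (U \<inter> S i))))"


section \<open>Stratified spaces\<close>

text \<open>\<open>filt S i\<close> is the \<open>i\<close>-th filtration subspace \<open>X\<^sub>i\<close>; for \<open>i \<ge> 1\<close>, \<open>(cwM S i, cwA S i)\<close> is the
  given CW-pair, \<open>att S i\<close> is the attaching map \<open>h\<^sub>i\<close>, and \<open>charm S i\<close> (which matters only outside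
  \<open>cwA S i\<close>) is the restriction to \<open>M\<^sub>i - A\<^sub>i\<close> of the structure map \<open>M\<^sub>i \<rightarrow> X\<^sub>i\<close> of the push-out, so
  that \<open>case_sum id (charm S i)\<close> is the identification of \<open>X\<^sub>i\<^sub>-\<^sub>1 \<union> M\<^sub>i\<close> with \<open>X\<^sub>i\<close>.
  The components with index \<open>0\<close> of the last four fields are not used.\<close>

record ('b, 'm) stratification =
  sspace :: "'b topology"
  filt :: "nat \<Rightarrow> 'b set"
  cwM :: "nat \<Rightarrow> 'm topology"
  cwA :: "nat \<Rightarrow> 'm set"
  att :: "nat \<Rightarrow> 'm \<Rightarrow> 'b"
  charm :: "nat \<Rightarrow> 'm \<Rightarrow> 'b"

abbreviation filt_space :: "('b, 'm) stratification \<Rightarrow> nat \<Rightarrow> 'b topology" where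
  "filt_space S i \<equiv> subtopology (sspace S) (filt S i)"

definition stratum :: "('b, 'm) stratification \<Rightarrow> nat \<Rightarrow> 'b set" where
  "stratum S i = (if i = 0 then filt S 0 else filt S i - filt S (i - 1))"

definition finite_stratification :: "('b, 'm) stratification \<Rightarrow> bool" where
  "finite_stratification S \<longleftrightarrow> finite {i. stratum S i \<noteq> {}}"

text \<open>The cells of \<open>X\<^sub>i\<close> obtained from cells \<open>E\<^sub>0\<close> of \<open>X\<^sub>0\<close> and \<open>E j\<close> of \<open>M\<^sub>j\<close>: those of \<open>X\<^sub>i\<^sub>-\<^sub>1\<close> and
  the images of the cells of \<open>M\<^sub>i\<close> outside \<open>A\<^sub>i\<close>.  When all attaching maps are cellular this is
  the CW-structure of \<open>X\<^sub>i\<close> with respect to which the next attaching map has to be cellular.\<close>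

primrec induced_cells ::
    "('b, 'm) stratification \<Rightarrow> (nat \<Rightarrow> 'b set set) \<Rightarrow> (nat \<Rightarrow> nat \<Rightarrow> 'm set set) \<Rightarrow>
     nat \<Rightarrow> nat \<Rightarrow> 'b set set" where
  "induced_cells S E\<^sub>0 E 0 = E\<^sub>0"
| "induced_cells S E\<^sub>0 E (Suc i) = (\<lambda>n. induced_cells S E\<^sub>0 E i n \<union>
     (\<lambda>e. charm S (Suc i) ` e) ` {e \<in> E (Suc i) n. e \<inter> cwA S (Suc i) = {}})"

definition stratified_CW_complex :: "('b, 'm) stratification \<Rightarrow> bool" where
  "stratified_CW_complex S \<longleftrightarrow>
     (\<exists>E\<^sub>0 E. CW_complex (filt_space S 0) E\<^sub>0 \<and>
       (\<forall>i\<ge>1. CW_complex (cwM S i) (E i) \<and> subcomplex (cwM S i) (E i) (cwA S i) \<and>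
          (\<forall>n. att S i ` (cwA S i \<inter> skeleton (E i) n)
               \<subseteq> skeleton (induced_cells S E\<^sub>0 E (i - 1)) n)))"

definition stratified_space :: "('b, 'm) stratification \<Rightarrow> bool" where
  "stratified_space S \<longleftrightarrow>
     is_sequential_colimit (sspace S) (filt S) \<and>
     CW_space (filt_space S 0) \<and>
     (\<forall>i\<ge>1. CW_pair (cwM S i) (cwA S i) \<and>
        continuous_map (subtopology (cwM S i) (cwA S i)) (filt_space S (i - 1)) (att S i) \<and>
        homeomorphic_map
          (adjunction_space (filt_space S (i - 1)) (cwM S i) (cwA S i) (att S i))
          (filt_space S i) (case_sum id (charm S i))) \<and>
     (finite_stratification S \<or> stratified_CW_complex S)"


section \<open>Structure categories\<close>

record ('o, 'm) category =
  Obj :: "'o set"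
  Arr :: "'m set"
  Dom :: "'m \<Rightarrow> 'o"
  Cod :: "'m \<Rightarrow> 'o"
  Ide :: "'o \<Rightarrow> 'm"
  Cmp :: "'m \<Rightarrow> 'm \<Rightarrow> 'm"   \<comment> \<open>\<open>Cmp C g f\<close> is \<open>g\<close> after \<open>f\<close>\<close>

definition hom :: "('o, 'm) category \<Rightarrow> 'o \<Rightarrow> 'o \<Rightarrow> 'm set" where
  "hom C V W = {f \<in> Arr C. Dom C f = V \<and> Cod C f = W}"

definition small_category :: "('o, 'm) category \<Rightarrow> bool" where
  "small_category C \<longleftrightarrow>
     (\<forall>f \<in> Arr C. Dom C f \<in> Obj C \<and> Cod C f \<in> Obj C) \<and>
     (\<forall>V \<in> Obj C. Ide C V \<in> hom C V V) \<and>
     (\<forall>U V W f g. f \<in> hom C U V \<longrightarrow> g \<in> hom C V W \<longrightarrow> Cmp C g f \<in> hom C U W) \<and>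
     (\<forall>V W f. f \<in> hom C V W \<longrightarrow> Cmp C f (Ide C V) = f \<and> Cmp C (Ide C W) f = f) \<and>
     (\<forall>T U V W f g h. f \<in> hom C T U \<longrightarrow> g \<in> hom C U V \<longrightarrow> h \<in> hom C V W \<longrightarrow>
        Cmp C h (Cmp C g f) = Cmp C (Cmp C h g) f)"

text \<open>A functor to Top whose spaces have points of type \<open>'f\<close>; the values of \<open>fmap F \<phi>\<close> matter only
  on the underlying space of the domain.\<close>

record ('o, 'm, 'f) top_functor =
  fobj :: "'o \<Rightarrow> 'f topology"
  fmap :: "'m \<Rightarrow> 'f \<Rightarrow> 'f"

definition functor_to_Top :: "('o, 'm) category \<Rightarrow> ('o, 'm, 'f) top_functor \<Rightarrow> bool" where
  "functor_to_Top C F \<longleftrightarrow>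
     (\<forall>V W f. f \<in> hom C V W \<longrightarrow> continuous_map (fobj F V) (fobj F W) (fmap F f)) \<and>
     (\<forall>V \<in> Obj C. \<forall>x \<in> topspace (fobj F V). fmap F (Ide C V) x = x) \<and>
     (\<forall>U V W f g. f \<in> hom C U V \<longrightarrow> g \<in> hom C V W \<longrightarrow>
        (\<forall>x \<in> topspace (fobj F U). fmap F (Cmp C g f) x = fmap F g (fmap F f x)))"

definition structure_category :: "('o, 'm) category \<Rightarrow> ('o, 'm, 'f) top_functor \<Rightarrow> bool" where
  "structure_category C F \<longleftrightarrow> small_category C \<and> functor_to_Top C F \<and>
     (\<forall>V \<in> Obj C. locally_compact_space (fobj F V) \<and> second_countable (fobj F V) \<and>
        Hausdorff_space (fobj F V))"

definition faithful :: "('o, 'm) category \<Rightarrow> ('o, 'm, 'f) top_functor \<Rightarrow> bool" where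
  "faithful C F \<longleftrightarrow>
     (\<forall>V W f g. f \<in> hom C V W \<longrightarrow> g \<in> hom C V W \<longrightarrow>
        (\<forall>x \<in> topspace (fobj F V). fmap F f x = fmap F g x) \<longrightarrow> f = g)"


section \<open>Families and their maps\<close>

record ('o, 'f, 'x, 'b) family =
  tot :: "'x topology"
  bas :: "'b topology"
  prj :: "'x \<Rightarrow> 'b"
  fib :: "'b \<Rightarrow> 'o"
  chart :: "'b \<Rightarrow> 'x \<Rightarrow> 'f"

definition over :: "('o, 'f, 'x, 'b) family \<Rightarrow> 'b set \<Rightarrow> 'x set" where
  "over X U = {x \<in> topspace (tot X). prj X x \<in> U}"

definition is_family ::
    "('o, 'm) category \<Rightarrow> ('o, 'm, 'f) top_functor \<Rightarrow> ('o, 'f, 'x, 'b) family \<Rightarrow> bool" where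
  "is_family C F X \<longleftrightarrow>
     continuous_map (tot X) (bas X) (prj X) \<and>
     (\<forall>b \<in> topspace (bas X). fib X b \<in> Obj C \<and>
        homeomorphic_map (subtopology (tot X) (over X {b})) (fobj F (fib X b)) (chart X b))"

definition family_map ::
    "('o, 'm) category \<Rightarrow> ('o, 'm, 'f) top_functor \<Rightarrow>
     ('o, 'f, 'x, 'b) family \<Rightarrow> ('o, 'f, 'y, 'c) family \<Rightarrow> ('x \<Rightarrow> 'y) \<Rightarrow> ('b \<Rightarrow> 'c) \<Rightarrow> bool" where
  "family_map C F X Y f fb \<longleftrightarrow>
     continuous_map (tot X) (tot Y) f \<and> continuous_map (bas X) (bas Y) fb \<and>
     (\<forall>x \<in> topspace (tot X). prj Y (f x) = fb (prj X x)) \<and>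
     (\<forall>b \<in> topspace (bas X). \<exists>\<phi> \<in> hom C (fib X b) (fib Y (fb b)).
        \<forall>z \<in> topspace (fobj F (fib X b)).
          chart Y (fb b) (f (inv_into (over X {b}) (chart X b) z)) = fmap F \<phi> z)"

definition family_iso ::
    "('o, 'm) category \<Rightarrow> ('o, 'm, 'f) top_functor \<Rightarrow>
     ('o, 'f, 'x, 'b) family \<Rightarrow> ('o, 'f, 'y, 'c) family \<Rightarrow> ('x \<Rightarrow> 'y) \<Rightarrow> ('b \<Rightarrow> 'c) \<Rightarrow> bool" where
  "family_iso C F X Y f fb \<longleftrightarrow> family_map C F X Y f fb \<and>
     (\<exists>g gb. family_map C F Y X g gb \<and>
        (\<forall>x \<in> topspace (tot X). g (f x) = x) \<and> (\<forall>y \<in> topspace (tot Y). f (g y) = y) \<and>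
        (\<forall>b \<in> topspace (bas X). gb (fb b) = b) \<and> (\<forall>c \<in> topspace (bas Y). fb (gb c) = c))"

definition object_family :: "('o, 'm, 'f) top_functor \<Rightarrow> 'o \<Rightarrow> ('o, 'f, 'f, unit) family" where
  "object_family F V =
     \<lparr>tot = fobj F V, bas = discrete_topology {()}, prj = (\<lambda>_. ()), fib = (\<lambda>_. V), chart = (\<lambda>_. id)\<rparr>"

definition product_family ::
    "('o, 'm, 'f) top_functor \<Rightarrow> 'b topology \<Rightarrow> 'o \<Rightarrow> ('o, 'f, 'b \<times> 'f, 'b) family" where
  "product_family F B V =
     \<lparr>tot = prod_topology B (fobj F V), bas = B, prj = fst, fib = (\<lambda>_. V), chart = (\<lambda>_. snd)\<rparr>"

definition pullback_family ::
    "'c topology \<Rightarrow> ('c \<Rightarrow> 'b) \<Rightarrow> ('o, 'f, 'x, 'b) family \<Rightarrow> ('o, 'f, 'c \<times> 'x, 'c) family" where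
  "pullback_family B g Y =
     \<lparr>tot = subtopology (prod_topology B (tot Y)) {(b, y). g b = prj Y y}, bas = B, prj = fst,
      fib = (\<lambda>b. fib Y (g b)), chart = (\<lambda>b (_, y). chart Y (g b) y)\<rparr>"

text \<open>The restriction to \<open>U\<close>, i.e. the pull-back along the inclusion, is realised on the subspace of
  the total space lying over \<open>U\<close>; the lemma below identifies it with the fibre product.\<close>

definition restr_family :: "('o, 'f, 'x, 'b) family \<Rightarrow> 'b set \<Rightarrow> ('o, 'f, 'x, 'b) family" where
  "restr_family X U =
     X\<lparr>tot := subtopology (tot X) (over X U), bas := subtopology (bas X) U\<rparr>"

lemma restr_family_iso_pullback:
  assumes C: "structure_category C F" and Y: "is_family C F Y"
  shows "family_iso C F (restr_family Y U) (pullback_family (subtopology (bas Y) U) id Y)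
           (\<lambda>y. (prj Y y, y)) id"
proof -
  let ?R = "restr_family Y U" and ?P = "pullback_family (subtopology (bas Y) U) id Y"
  have p: "continuous_map (tot Y) (bas Y) (prj Y)" using Y by (simp add: is_family_def)
  have pm: "\<And>y. y \<in> topspace (tot Y) \<Longrightarrow> prj Y y \<in> topspace (bas Y)"
    using p by (auto simp: continuous_map_def)
  have bij: "bij_betw (chart Y b) (over Y {b}) (topspace (fobj F (fib Y b)))"
    if "b \<in> topspace (bas Y)" for b
  proof -
    have "homeomorphic_map (subtopology (tot Y) (over Y {b})) (fobj F (fib Y b)) (chart Y b)"
      using Y that by (simp add: is_family_def)
    moreover have "topspace (subtopology (tot Y) (over Y {b})) = over Y {b}"
      by (auto simp: over_def)
    ultimately show ?thesis
      by (metis bij_betw_def homeomorphic_imp_injective_map homeomorphic_imp_surjective_map)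
  qed
  have ide: "Ide C (fib Y b) \<in> hom C (fib Y b) (fib Y b)"
      "\<forall>z \<in> topspace (fobj F (fib Y b)). fmap F (Ide C (fib Y b)) z = z"
    if "b \<in> topspace (bas Y)" for b
    using C Y that by (auto simp: structure_category_def small_category_def functor_to_Top_def is_family_def)
  have oR: "over ?R {b} = over Y {b}" if "b \<in> U" for b
    using that by (auto simp: over_def restr_family_def)
  have oP: "over ?P {b} = Pair b ` over Y {b}" if "b \<in> U" for b
    using that pm by (auto simp: over_def pullback_family_def image_iff)
  have invP: "inv_into (over ?P {b}) (chart ?P b) z = (b, inv_into (over Y {b}) (chart Y b) z)"
    if "b \<in> U" "b \<in> topspace (bas Y)" "z \<in> topspace (fobj F (fib Y b))" for b z
  proof (rule inv_into_f_eq)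
    have "inj_on (chart Y b) (over Y {b})" using bij that by (auto simp: bij_betw_def)
    then show "inj_on (chart ?P b) (over ?P {b})"
      unfolding oP[OF that(1)] by (auto simp: inj_on_def pullback_family_def)
    have "z \<in> chart Y b ` over Y {b}" using bij that by (auto simp: bij_betw_def)
    then show "(b, inv_into (over Y {b}) (chart Y b) z) \<in> over ?P {b}"
      and "chart ?P b (b, inv_into (over Y {b}) (chart Y b) z) = z"
      unfolding oP[OF that(1)] by (auto simp: pullback_family_def f_inv_into_f inv_into_into)
  qed
  have "family_map C F ?R ?P (\<lambda>y. (prj Y y, y)) id"
    unfolding family_map_def
  proof (intro conjI ballI)
    show "continuous_map (tot ?R) (tot ?P) (\<lambda>y. (prj Y y, y))"
      using p by (auto simp: restr_family_def pullback_family_def continuous_map_in_subtopology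
          continuous_map_pairwise o_def over_def intro!: continuous_map_from_subtopology)
    show "continuous_map (bas ?R) (bas ?P) id"
      by (simp add: restr_family_def pullback_family_def)
  next
    fix b assume "b \<in> topspace (bas ?R)"
    then have b: "b \<in> U" "b \<in> topspace (bas Y)" by (auto simp: restr_family_def)
    have "chart Y b (inv_into (over Y {b}) (chart Y b) z) = z"
      if "z \<in> topspace (fobj F (fib Y b))" for z
      using bij[OF b(2)] that by (simp add: bij_betw_def f_inv_into_f)
    then show "\<exists>\<phi>\<in>hom C (fib ?R b) (fib ?P (id b)). \<forall>z\<in>topspace (fobj F (fib ?R b)).
          chart ?P (id b) (prj Y (inv_into (over ?R {b}) (chart ?R b) z),
            inv_into (over ?R {b}) (chart ?R b) z) = fmap F \<phi> z"
      using ide[OF b(2)] oR[OF b(1)]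
      by (intro bexI[of _ "Ide C (fib Y b)"]) (auto simp: restr_family_def pullback_family_def)
  qed (auto simp: restr_family_def pullback_family_def)
  moreover have "family_map C F ?P ?R snd id"
    unfolding family_map_def
  proof (intro conjI ballI)
    show "continuous_map (tot ?P) (tot ?R) snd"
      by (auto simp: restr_family_def pullback_family_def continuous_map_in_subtopology over_def
          intro!: continuous_map_from_subtopology continuous_map_snd)
    show "continuous_map (bas ?P) (bas ?R) id"
      by (simp add: restr_family_def pullback_family_def)
  next
    fix b assume "b \<in> topspace (bas ?P)"
    then have b: "b \<in> U" "b \<in> topspace (bas Y)" by (auto simp: pullback_family_def)
    have "chart Y b (inv_into (over Y {b}) (chart Y b) z) = z"
      if "z \<in> topspace (fobj F (fib Y b))" for z
      using bij[OF b(2)] that by (simp add: bij_betw_def f_inv_into_f)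
    then show "\<exists>\<phi>\<in>hom C (fib ?P b) (fib ?R (id b)). \<forall>z\<in>topspace (fobj F (fib ?P b)).
          chart ?R (id b) (snd (inv_into (over ?P {b}) (chart ?P b) z)) = fmap F \<phi> z"
      using ide[OF b(2)] invP[OF b]
      by (intro bexI[of _ "Ide C (fib Y b)"]) (auto simp: restr_family_def pullback_family_def)
  qed (auto simp: restr_family_def pullback_family_def)
  ultimately show ?thesis
    unfolding family_iso_def
    by (intro conjI exI[of _ snd] exI[of _ id]) (auto simp: restr_family_def pullback_family_def)
qed

definition is_bundle ::
    "('o, 'm) category \<Rightarrow> ('o, 'm, 'f) top_functor \<Rightarrow> ('o, 'f, 'x, 'b) family \<Rightarrow> bool" where
  "is_bundle C F X \<longleftrightarrow> is_family C F X \<and>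
     (\<forall>b \<in> topspace (bas X). \<exists>U. U \<subseteq> topspace (bas X) \<and> b \<in> bas X interior_of U \<and>
        (\<exists>V \<in> Obj C. \<exists>f fb.
           family_iso C F (restr_family X U) (product_family F (subtopology (bas X) U) V) f fb))"

text \<open>The push-out of \<open>X \<leftarrow> Y|A \<rightarrow> Y\<close> for a closed subspace \<open>A\<close> of the base of \<open>Y\<close> and a family map
  \<open>(h, hb) : Y|A \<rightarrow> X\<close>: the push-outs in Top of total and base spaces, with the charts of \<open>X\<close>
  over the base of \<open>X\<close> and those of \<open>Y\<close> over the rest.\<close>

definition pushout_family ::
    "('o, 'f, 'x, 'b) family \<Rightarrow> ('o, 'f, 'y, 'c) family \<Rightarrow> 'c set \<Rightarrow> ('y \<Rightarrow> 'x) \<Rightarrow> ('c \<Rightarrow> 'b) \<Rightarrow>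
     ('o, 'f, 'x + 'y, 'b + 'c) family" where
  "pushout_family X Y A h hb =
     \<lparr>tot = adjunction_space (tot X) (tot Y) (over Y A) h,
      bas = adjunction_space (bas X) (bas Y) A hb,
      prj = map_sum (prj X) (prj Y),
      fib = case_sum (fib X) (fib Y),
      chart = case_sum (\<lambda>b z. chart X b (projl z)) (\<lambda>c z. chart Y c (projr z))\<rparr>"


section \<open>Stratified fibre bundles\<close>

text \<open>The type argument is the type of the points of the total spaces of the bundles \<open>M\<^sub>i\<close>, whose
  existence is asserted.  The identification of \<open>X\<^sub>i\<^sub>-\<^sub>1 \<union> M\<^sub>i\<close> with \<open>X\<^sub>i\<close> is the identity on
  \<open>X\<^sub>i\<^sub>-\<^sub>1\<close> and lies over the given identification of the base spaces.\<close>

definition stratified_fibre_bundle ::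
    "'e itself \<Rightarrow> ('o, 'm) category \<Rightarrow> ('o, 'm, 'f) top_functor \<Rightarrow>
     ('b, 'c) stratification \<Rightarrow> ('o, 'f, 'x, 'b) family \<Rightarrow> bool" where
  "stratified_fibre_bundle _ C F S X \<longleftrightarrow>
     structure_category C F \<and> stratified_space S \<and> is_family C F X \<and> bas X = sspace S \<and>
     is_bundle C F (restr_family X (filt S 0)) \<and>
     (\<forall>i\<ge>1. \<exists>(M :: ('o, 'f, 'e, 'c) family) h k.
        is_bundle C F M \<and> bas M = cwM S i \<and>
        family_map C F (restr_family M (cwA S i)) (restr_family X (filt S (i - 1))) h (att S i) \<and>
        family_iso C F
          (pushout_family (restr_family X (filt S (i - 1))) M (cwA S i) h (att S i))
          (restr_family X (filt S i)) (case_sum id k) (case_sum id (charm S i))) \<and>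
     is_sequential_colimit (tot X) (\<lambda>i. over X (filt S i))"


section \<open>Function spaces and NKC categories\<close>

text \<open>Maps out of \<open>F(V)\<close> are represented by their extensions by \<open>undefined\<close>.  For \<open>F(V)\<close> non-empty
  the base component of a family map \<open>V \<rightarrow> Y\<close> is determined by the map on total spaces, so only the
  latter is recorded.\<close>

definition maps_from ::
    "('o, 'm) category \<Rightarrow> ('o, 'm, 'f) top_functor \<Rightarrow> 'o \<Rightarrow> ('o, 'f, 'x, 'b) family \<Rightarrow>
     ('f \<Rightarrow> 'x) set" where
  "maps_from C F V Y =
     {a \<in> extensional (topspace (fobj F V)). \<exists>ab. family_map C F (object_family F V) Y a ab}"

definition NKU ::
    "('o, 'm) category \<Rightarrow> ('o, 'm, 'f) top_functor \<Rightarrow> 'o \<Rightarrow> ('o, 'f, 'x, 'b) family \<Rightarrow>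
     'f set \<Rightarrow> 'x set \<Rightarrow> ('f \<Rightarrow> 'x) set" where
  "NKU C F V Y K U = {a \<in> maps_from C F V Y. a ` K \<subseteq> U}"

text \<open>The topology on the maps \<open>V \<rightarrow> Y\<close> with sub-basis the sets \<open>NKU C F V Y K U\<close>, where \<open>K\<close> is in
  \<open>\<K>\<close> and \<open>U\<close> is open in \<open>Y\<close>.\<close>

definition topology_from ::
    "('o, 'm) category \<Rightarrow> ('o, 'm, 'f) top_functor \<Rightarrow> 'o \<Rightarrow> ('o, 'f, 'x, 'b) family \<Rightarrow>
     'f set set \<Rightarrow> ('f \<Rightarrow> 'x) topology" where
  "topology_from C F V Y \<K> =
     topology (arbitrary union_of
       (finite intersection_of
          (\<lambda>N. \<exists>K \<in> \<K>. \<exists>U. openin (tot Y) U \<and> N = NKU C F V Y K U)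
        relative_to maps_from C F V Y))"

definition function_space ::
    "('o, 'm) category \<Rightarrow> ('o, 'm, 'f) top_functor \<Rightarrow> 'o \<Rightarrow> ('o, 'f, 'x, 'b) family \<Rightarrow>
     ('f \<Rightarrow> 'x) topology" where
  "function_space C F V Y = topology_from C F V Y {K. compactin (fobj F V) K}"

text \<open>The functor \<open>F\<^sup>V\<close>: the points of \<open>W\<^sup>V\<close> are the morphisms \<open>V \<rightarrow> W\<close>, topologised through the
  identification of \<open>\<phi>\<close> with the family map \<open>F(\<phi>) : V \<rightarrow> W\<close>.\<close>

definition hom_functor ::
    "('o, 'm) category \<Rightarrow> ('o, 'm, 'f) top_functor \<Rightarrow> 'o \<Rightarrow> ('o, 'm, 'm) top_functor" where
  "hom_functor C F V =
     \<lparr>fobj = (\<lambda>W. pullback_topology (hom C V W) (\<lambda>\<phi>. restrict (fmap F \<phi>) (topspace (fobj F V)))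
                   (function_space C F V (object_family F W))),
      fmap = (\<lambda>\<psi> \<phi>. Cmp C \<psi> \<phi>)\<rparr>"

definition function_family ::
    "('o, 'm) category \<Rightarrow> ('o, 'm, 'f) top_functor \<Rightarrow> 'o \<Rightarrow> ('o, 'f, 'x, 'b) family \<Rightarrow>
     ('o, 'm, 'f \<Rightarrow> 'x, 'b) family" where
  "function_family C F V Y =
     \<lparr>tot = function_space C F V Y,
      bas = bas Y,
      prj = (\<lambda>a. prj Y (a (SOME v. v \<in> topspace (fobj F V)))),
      fib = fib Y,
      chart = (\<lambda>b a. THE \<phi>. \<phi> \<in> hom C V (fib Y b) \<and>
                 (\<forall>v \<in> topspace (fobj F V). fmap F \<phi> v = chart Y b (a v)))\<rparr>"

text \<open>"For every family \<open>Y\<close>" ranges over all families whose total and base spaces have points in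
  the type \<open>'a\<close> in which the values of \<open>F\<close> live: \<open>'a\<close> serves as the universe of points of
  the category Top.\<close>

definition generating ::
    "('o, 'm) category \<Rightarrow> ('o, 'm, 'a) top_functor \<Rightarrow> 'o \<Rightarrow> 'a set set \<Rightarrow> bool" where
  "generating C F V \<K> \<longleftrightarrow> (\<forall>K \<in> \<K>. compactin (fobj F V) K) \<and>
     (\<forall>Y :: ('o, 'a, 'a, 'a) family. is_family C F Y \<longrightarrow>
        function_space C F V Y = topology_from C F V Y \<K>)"

definition NKC :: "('o, 'm) category \<Rightarrow> ('o, 'm, 'a) top_functor \<Rightarrow> bool" where
  "NKC C F \<longleftrightarrow> structure_category C F \<and> faithful C F \<and>
     (\<forall>V \<in> Obj C. \<exists>\<K>. generating C F V \<K> \<and>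
        (\<forall>K \<in> \<K>. \<forall>W \<in> Obj C. \<forall>D. compactin (fobj F W) D \<longrightarrow>
           compactin (fobj (hom_functor C F V) W) {\<phi> \<in> hom C V W. fmap F \<phi> ` K \<subseteq> D}))"

end

theory Submission
  imports Defs
begin

text \<open>
  The point is that \<open>X\<^sub>i\<^sup>V\<close> carries the push-out topology.  Let \<open>W\<close> be open in that topology and let
  a finite intersection of sets \<open>N\<^sub>K\<^sub>,\<^sub>U\<close> of \<open>X\<^sub>i\<^sub>-\<^sub>1\<^sup>V\<close> be contained in \<open>W\<close>.  The sets \<open>U\<close>, pulled back to
  \<open>A\<^sub>i\<close>, have to be extended to open sets of \<open>M\<^sub>i\<close> such that the corresponding intersection stays inside
  \<open>W\<close>.  This is done one cell at a time.  Over a closed cell the bundle is locally compact and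
  second countable, so that \<open>U\<close> over the boundary of the cell is an increasing union of compact sets
  \<open>D\<close>; since \<open>N\<^sub>K\<^sub>,\<^sub>D\<close> is compact by the NKC property, each \<open>D\<close> can be thickened within \<open>W\<close>.
  Iterating the extension over all \<open>i\<close> shows that \<open>X\<^sup>V\<close> is the colimit of the \<open>X\<^sub>i\<^sup>V\<close>.
\<close>

section \<open>General topology\<close>

text \<open>A map out of \<open>F(V)\<close> lies over a single point of the base. Hence it runs
  entirely over a given closed subset of the base or entirely off it, and conditions imposed over
  different cells, or over \<open>A_i\<close> and over the rest of \<open>M_i\<close>, never
  interfere. Compactness enters through one set only: if a nonempty \<open>K\<close> of the
  generating family is sent into a compact set of a bundle, the map is confined to a compact set of
  maps. The remaining conditions of a basic neighbourhood then cut out closed subsets of it, which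
  is why the index \<open>0\<close> is singled out everywhere. The obstacle is that the maps sending
  \<open>K\<close> into an open \<open>U\<close> do not form a compact set, so \<open>U\<close>
  cannot be thickened inside \<open>W\<close> in one step. It has to be exhausted by a sequence,
  each compact set being thickened before the next is added; such a sequence need not exist over a
  large complex, which forces the passage to single cells. A compact set over one further base point
  is carried along in the extension, so that one statement yields neighbourhoods both of maps into
  \<open>X_{i-1}\<close> and of maps that come from \<open>M_i\<close>.\<close>

lemma second_countable_prod_topology:
  assumes "second_countable X" "second_countable Y"
  shows "second_countable (prod_topology X Y)"
proof -
  obtain A where A: "countable A" "\<And>V. V \<in> A \<Longrightarrow> openin X V"
      "\<And>U x. openin X U \<Longrightarrow> x \<in> U \<Longrightarrow> \<exists>V\<in>A. x \<in> V \<and> V \<subseteq> U"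
    using assms(1) unfolding second_countable_def by metis
  obtain B where B: "countable B" "\<And>V. V \<in> B \<Longrightarrow> openin Y V"
      "\<And>U x. openin Y U \<Longrightarrow> x \<in> U \<Longrightarrow> \<exists>V\<in>B. x \<in> V \<and> V \<subseteq> U"
    using assms(2) unfolding second_countable_def by metis
  show ?thesis
    unfolding second_countable_def
  proof (intro exI[of _ "(\<lambda>(U, V). U \<times> V) ` (A \<times> B)"] conjI ballI allI impI)
    show "countable ((\<lambda>(U, V). U \<times> V) ` (A \<times> B))" using A(1) B(1) by simp
  next
    fix V assume "V \<in> (\<lambda>(U, V). U \<times> V) ` (A \<times> B)"
    then show "openin (prod_topology X Y) V" using A(2) B(2) by (auto simp: openin_prod_Times_iff)
  next
    fix U x assume Ux: "openin (prod_topology X Y) U \<and> x \<in> U"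
    obtain a b where x: "x = (a, b)" by fastforce
    obtain P Q where "openin X P" "openin Y Q" "a \<in> P" "b \<in> Q" "P \<times> Q \<subseteq> U"
      using Ux unfolding x openin_prod_topology_alt by metis
    moreover obtain P' Q' where "P' \<in> A" "Q' \<in> B" "a \<in> P'" "P' \<subseteq> P" "b \<in> Q'" "Q' \<subseteq> Q"
      using A(3) B(3) calculation by metis
    ultimately show "\<exists>V\<in>(\<lambda>(U, V). U \<times> V) ` (A \<times> B). x \<in> V \<and> V \<subseteq> U"
      unfolding x by (intro bexI[of _ "P' \<times> Q'"]) auto
  qed
qed

text \<open>Compactness turns a cover of \<open>K\<close> by base sets inside \<open>U\<close> into
  a finite one, and there are only countably many finite unions. Absorbing compact sets instead of
  points is what closed images and compact-open topologies require of a base.\<close>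

lemma countable_base_finite_unions:
  assumes "second_countable X"
  obtains \<B> where "countable \<B>" "\<And>V. V \<in> \<B> \<Longrightarrow> openin X V"
    "\<And>K U. compactin X K \<Longrightarrow> openin X U \<Longrightarrow> K \<subseteq> U \<Longrightarrow> \<exists>V\<in>\<B>. K \<subseteq> V \<and> V \<subseteq> U"
proof -
  obtain A where A: "countable A" "\<And>V. V \<in> A \<Longrightarrow> openin X V"
      "\<And>U x. openin X U \<Longrightarrow> x \<in> U \<Longrightarrow> \<exists>V\<in>A. x \<in> V \<and> V \<subseteq> U"
    using assms(1) unfolding second_countable_def by metis
  let ?B = "Union ` {\<F>. \<F> \<subseteq> A \<and> finite \<F>}"
  have "countable {\<F>. \<F> \<subseteq> A \<and> finite \<F>}"
    using countable_Collect_finite_subset[OF A(1)] by (simp add: conj_commute)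
  then have "countable ?B" by simp
  moreover have "\<And>V. V \<in> ?B \<Longrightarrow> openin X V" using A(2) by auto
  moreover have "\<exists>V\<in>?B. K \<subseteq> V \<and> V \<subseteq> U" if "compactin X K" "openin X U" "K \<subseteq> U" for K U
  proof -
    have "K \<subseteq> \<Union>{V \<in> A. V \<subseteq> U}" using A(3) that by (smt (verit) Union_iff mem_Collect_eq subset_iff)
    then have "\<exists>\<F>. finite \<F> \<and> \<F> \<subseteq> {V \<in> A. V \<subseteq> U} \<and> K \<subseteq> \<Union>\<F>"
      using A(2) by (intro compactinD[OF that(1)]) auto
    then obtain \<F> where "finite \<F>" "\<F> \<subseteq> {V \<in> A. V \<subseteq> U}" "K \<subseteq> \<Union>\<F>"
      by blast
    then show ?thesis by (intro bexI[of _ "\<Union>\<F>"]) auto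
  qed
  ultimately show thesis by (rule that)
qed

text \<open>The map is closed, so the points whose whole fibre lies in an open \<open>V\<close> form
  the open set \<open>?g V\<close>. The fibres are compact, hence \<open>V\<close> may be taken from
  a countable base that absorbs compact sets. Closed cells inherit second countability from the disc
  in this way.\<close>

lemma second_countable_compact_Hausdorff_image:
  assumes "compact_space X" "second_countable X" "Hausdorff_space Y"
    and f: "continuous_map X Y f" "f ` topspace X = topspace Y"
  shows "second_countable Y"
proof -
  obtain \<B> where B: "countable \<B>" "\<And>V. V \<in> \<B> \<Longrightarrow> openin X V"
    "\<And>K U. compactin X K \<Longrightarrow> openin X U \<Longrightarrow> K \<subseteq> U \<Longrightarrow> \<exists>V\<in>\<B>. K \<subseteq> V \<and> V \<subseteq> U"
    using countable_base_finite_unions[OF assms(2)] by metis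
  let ?g = "\<lambda>V. topspace Y - f ` (topspace X - V)"
  have cl: "closed_map X Y f"
    using assms continuous_imp_closed_map by blast
  show ?thesis
    unfolding second_countable_def
  proof (intro exI[of _ "?g ` \<B>"] conjI ballI allI impI)
    show "countable (?g ` \<B>)" using B(1) by simp
  next
    fix W assume "W \<in> ?g ` \<B>"
    then show "openin Y W"
      using cl B(2) by (auto simp: closed_map_def closedin_def)
  next
    fix U y assume Uy: "openin Y U \<and> y \<in> U"
    let ?K = "{x \<in> topspace X. f x \<in> {y}}"
    have "closedin Y {y}"
      using Uy assms(3) openin_subset by (force intro: closedin_Hausdorff_singleton)
    then have "closedin X ?K"
      by (rule closedin_continuous_map_preimage[OF f(1)])
    then have "compactin X ?K" by (rule closedin_compact_space[OF assms(1)])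
    moreover have "openin X {x \<in> topspace X. f x \<in> U}"
      using f(1) Uy openin_continuous_map_preimage by blast
    ultimately obtain V where V: "V \<in> \<B>" "?K \<subseteq> V" "V \<subseteq> {x \<in> topspace X. f x \<in> U}"
      using B(3)[of ?K "{x \<in> topspace X. f x \<in> U}"] Uy by auto
    have "y \<in> topspace Y" using Uy openin_subset by blast
    moreover have "?g V \<subseteq> U"
    proof
      fix z assume z: "z \<in> ?g V"
      then obtain x where "x \<in> topspace X" "z = f x" using f(2) by blast
      then show "z \<in> U" using z V(3) by blast
    qed
    ultimately have "y \<in> ?g V \<and> ?g V \<subseteq> U" using V f(2) by auto
    then show "\<exists>V\<in>?g ` \<B>. y \<in> V \<and> V \<subseteq> U" using V(1) by blast
  qed
qed

lemma open_sigma_compact: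
  assumes "locally_compact_space X" "Hausdorff_space X" "second_countable X" "openin X U"
  obtains D :: "nat \<Rightarrow> 'a set" where "\<And>m. compactin X (D m)" "U = (\<Union>m. D m)"
proof -
  have nb: "\<exists>V K. openin X V \<and> compactin X K \<and> x \<in> V \<and> V \<subseteq> K \<and> K \<subseteq> U" if "x \<in> U" for x
    using locally_compact_space_neighbourhood_base[of X] assms that
    unfolding neighbourhood_base_of by metis
  obtain A where A: "countable A" "\<And>V. V \<in> A \<Longrightarrow> openin X V"
      "\<And>U x. openin X U \<Longrightarrow> x \<in> U \<Longrightarrow> \<exists>V\<in>A. x \<in> V \<and> V \<subseteq> U"
    using assms(3) unfolding second_countable_def by metis
  \<comment> \<open>The empty set keeps \<open>\<A>\<close> nonempty, so that
    \<open>from_nat_into\<close> enumerates it even when \<open>U\<close> is empty.\<close>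
  define \<A> where "\<A> = insert {} {V \<in> A. \<exists>K. compactin X K \<and> V \<subseteq> K \<and> K \<subseteq> U}"
  have "\<exists>k. \<forall>V\<in>\<A>. compactin X (k V) \<and> V \<subseteq> k V \<and> k V \<subseteq> U"
    by (intro bchoice) (auto simp: \<A>_def)
  then obtain k where k: "\<And>V. V \<in> \<A> \<Longrightarrow> compactin X (k V) \<and> V \<subseteq> k V \<and> k V \<subseteq> U"
    by blast
  have cntA: "countable \<A>" using A(1) by (simp add: \<A>_def)
  have "\<A> \<noteq> {}" by (simp add: \<A>_def)
  define e where "e = from_nat_into \<A>"
  have e: "range e = \<A>" unfolding e_def by (rule range_from_nat_into) fact+
  have in_A: "e m \<in> \<A>" for m using e by blast
  have "U \<subseteq> (\<Union>m. k (e m))"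
  proof
    fix x assume "x \<in> U"
    then obtain V K where VK: "openin X V" "compactin X K" "x \<in> V" "V \<subseteq> K" "K \<subseteq> U"
      using nb by metis
    then obtain V' where V': "V' \<in> A" "x \<in> V'" "V' \<subseteq> V" using A(3) by metis
    then have "V' \<in> \<A>" using VK unfolding \<A>_def by blast
    then obtain m where "e m = V'" using e by (metis rangeE)
    then show "x \<in> (\<Union>m. k (e m))" using k[OF in_A[of m]] V' by blast
  qed
  moreover have "(\<Union>m. k (e m)) \<subseteq> U" using k[OF in_A] by blast
  ultimately have "U = (\<Union>m. k (e m))" by (rule subset_antisym)
  with k[OF in_A] show thesis by (intro that[of "\<lambda>m. k (e m)"]) auto
qed

section \<open>Extending open sets that carry compact sets\<close>

text \<open>A finite intersection of sets \<open>N_{K,U}\<close> inside \<open>H\<close>. The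
  \<open>U j\<close> are arbitrary, since the same formula serves for basic open sets and for the
  compact sets that approximate them.\<close>

definition carried :: "('v \<Rightarrow> 'y) set \<Rightarrow> nat \<Rightarrow> (nat \<Rightarrow> 'v set) \<Rightarrow> (nat \<Rightarrow> 'y set) \<Rightarrow> ('v \<Rightarrow> 'y) set"
  where "carried H n K U = {a \<in> H. \<forall>j<n. a ` K j \<subseteq> U j}"

text \<open>The open subspace \<open>U\<close> is itself locally compact and Hausdorff, so the
  compact neighbourhood is found there.\<close>

lemma compact_neighbourhood_within:
  assumes "locally_compact_space X" "Hausdorff_space X" "compactin X K" "openin X U" "K \<subseteq> U"
  obtains V L where "openin X V" "compactin X L" "K \<subseteq> V" "V \<subseteq> L" "L \<subseteq> U"
proof -
  have "locally_compact_space (subtopology X U)" "Hausdorff_space (subtopology X U)"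
    using assms locally_compact_space_open_subset Hausdorff_space_subtopology by blast+
  moreover have "compactin (subtopology X U) K" using assms by (simp add: compactin_subtopology)
  ultimately obtain V L where "openin (subtopology X U) V" "compactin (subtopology X U) L"
      "K \<subseteq> V" "V \<subseteq> L"
    using locally_compact_space_compact_closed_compact[of "subtopology X U"] by blast
  then show thesis
    using that assms(4) by (meson compactin_subtopology openin_trans_full)
qed

text \<open>Given compact neighbourhoods \<open>L0\<close> of the \<open>E j\<close> inside the
  \<open>G j\<close>, the maps carried by \<open>L0\<close> but outside \<open>W\<close> form a
  compact set \<open>?C\<close>. Each of them sends some point of some \<open>K j0\<close> outside
  \<open>E j0\<close>, and a smaller neighbourhood of \<open>E j0\<close> that misses this value
  excludes the map. Finitely many such choices exclude all of \<open>?C\<close>; their intersection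
  is the thickening.\<close>

lemma carried_compact_neighbourhood:
  fixes n :: nat and E G :: "nat \<Rightarrow> 'y set" and H :: "('v \<Rightarrow> 'y) topology"
  assumes Y: "locally_compact_space Y" "Hausdorff_space Y"
    and cpt: "\<And>E. \<forall>j<n. compactin Y (E j) \<Longrightarrow> compactin H (carried (topspace H) n K E)"
    and clo: "\<And>E. \<forall>j<n. compactin Y (E j) \<Longrightarrow> closedin H (carried (topspace H) n K E)"
    and W: "openin H W"
    and E: "\<forall>j<n. compactin Y (E j) \<and> openin Y (G j) \<and> E j \<subseteq> G j"
    and EW: "carried (topspace H) n K E \<subseteq> W"
  obtains P L where "\<forall>j<n. openin Y (P j) \<and> compactin Y (L j) \<and> E j \<subseteq> P j \<and> P j \<subseteq> L j \<and> L j \<subseteq> G j"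
    "carried (topspace H) n K L \<subseteq> W"
proof -
  \<comment> \<open>The bound by \<open>G\<close> is left out here; after intersecting, it comes
    from \<open>L0\<close> alone.\<close>
  define nbd where
    "nbd x \<longleftrightarrow> (\<forall>j<n. openin Y (fst x j) \<and> compactin Y (snd x j) \<and> E j \<subseteq> fst x j \<and> fst x j \<subseteq> snd x j)"
    for x
  have "\<forall>j. \<exists>P L. j < n \<longrightarrow> openin Y P \<and> compactin Y L \<and> E j \<subseteq> P \<and> P \<subseteq> L \<and> L \<subseteq> G j"
    using compact_neighbourhood_within[OF Y] E by metis
  then obtain P0 L0 where PL0: "\<And>j. j < n \<Longrightarrow> openin Y (P0 j) \<and> compactin Y (L0 j) \<and> E j \<subseteq> P0 j \<and> P0 j \<subseteq> L0 j \<and> L0 j \<subseteq> G j"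
    by metis
  let ?C = "carried (topspace H) n K L0 - W"
  let ?N = "\<lambda>L. topspace H - carried (topspace H) n K L"
  have C: "compactin H ?C"
  proof -
    have "?C = carried (topspace H) n K L0 \<inter> (topspace H - W)" by (auto simp: carried_def)
    then show ?thesis using W cpt PL0
      by (metis (no_types, lifting) compact_Int_closedin openin_closedin_eq)
  qed
  have "?C \<subseteq> (\<Union>x\<in>{x. nbd x}. ?N (snd x))"
  proof
    fix a assume a: "a \<in> ?C"
    then have "a \<notin> carried (topspace H) n K E" "a \<in> topspace H"
      using EW by (blast, simp add: carried_def)
    then obtain j0 v where j0: "j0 < n" "v \<in> K j0" "a v \<notin> E j0" by (auto simp: carried_def)
    have av: "a v \<in> topspace Y" 
      using a j0(1,2) PL0[OF j0(1)] compactin_subset_topspace[of Y "L0 j0"] unfolding carried_def by blast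
    have "openin Y (topspace Y - {a v})"
      using av Y(2) by (simp add: closedin_Hausdorff_singleton openin_diff)
    moreover have "E j0 \<subseteq> topspace Y - {a v}" using j0 E compactin_subset_topspace by blast
    ultimately obtain P L where PL: "openin Y P" "compactin Y L" "E j0 \<subseteq> P" "P \<subseteq> L" "L \<subseteq> topspace Y - {a v}"
      using compact_neighbourhood_within[OF Y] E j0(1) by metis
    \<comment> \<open>Only the coordinate \<open>j0\<close> changes: missing the single value
      \<open>a v\<close> already excludes \<open>a\<close>.\<close>
    have "nbd (P0(j0 := P), L0(j0 := L))" using PL PL0 by (auto simp: nbd_def)
    moreover have "a \<in> ?N (L0(j0 := L))"
    proof -
      have "\<not> a ` K j0 \<subseteq> (L0(j0 := L)) j0" using j0(2) PL(5) by auto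
      then show ?thesis using j0(1) \<open>a \<in> topspace H\<close> unfolding carried_def by blast
    qed
    ultimately show "a \<in> (\<Union>x\<in>{x. nbd x}. ?N (snd x))" by (intro UN_I) auto
  qed
  moreover have op: "openin H (?N (snd x))" if "nbd x" for x
    using that clo by (auto simp: nbd_def)
  ultimately have "\<exists>\<F>. finite \<F> \<and> \<F> \<subseteq> (\<lambda>x. ?N (snd x)) ` {x. nbd x} \<and> ?C \<subseteq> \<Union>\<F>"
    by (intro compactinD[OF C]) auto
  then obtain \<F> where F: "finite \<F>" "\<F> \<subseteq> (\<lambda>x. ?N (snd x)) ` {x. nbd x}" "?C \<subseteq> \<Union>\<F>"
    by blast
  obtain X where X: "finite X" "X \<subseteq> {x. nbd x}" "\<F> = (\<lambda>x. ?N (snd x)) ` X"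
    using finite_subset_image[OF F(1,2)] by blast
  \<comment> \<open>The pair \<open>(P0, L0)\<close> takes part in the intersection, which is
    therefore never empty and keeps \<open>L\<close> inside \<open>L0\<close>, hence inside
    \<open>G\<close>.\<close>
  define P where "P j = \<Inter>((\<lambda>x. fst x j) ` insert (P0, L0) X)" for j
  define L where "L j = \<Inter>((\<lambda>x. snd x j) ` insert (P0, L0) X)" for j
  have "nbd (P0, L0)" using PL0 by (simp add: nbd_def)
  then have nb: "nbd x" if "x \<in> insert (P0, L0) X" for x using that X(2) by blast
  have "openin Y (P j) \<and> compactin Y (L j) \<and> E j \<subseteq> P j \<and> P j \<subseteq> L j \<and> L j \<subseteq> G j" if "j < n" for j
  proof (intro conjI)
    have *: "openin Y (fst x j)" "closedin Y (snd x j)" and **: "E j \<subseteq> fst x j" "fst x j \<subseteq> snd x j"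
      if "x \<in> insert (P0, L0) X" for x
      using nb[OF that] \<open>j < n\<close> compactin_imp_closedin[OF Y(2)] unfolding nbd_def by blast+
    show "openin Y (P j)" unfolding P_def
      by (rule openin_Inter) (simp add: X(1), blast, use *(1) in blast)
    have "closedin Y (L j)" unfolding L_def
      by (rule closedin_Inter) (blast, use *(2) in blast)
    moreover have "L j \<subseteq> L0 j" by (simp add: L_def)
    ultimately show "compactin Y (L j)" using PL0[OF that] closed_compactin by blast
    show "E j \<subseteq> P j" unfolding P_def using **(1) by blast
    show "P j \<subseteq> L j" unfolding P_def L_def using **(2) by (intro INF_mono) blast
    show "L j \<subseteq> G j" using \<open>L j \<subseteq> L0 j\<close> PL0[OF that] by blast
  qed
  moreover have "carried (topspace H) n K L \<subseteq> W"
  proof (rule ccontr)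
    assume "\<not> ?thesis"
    then obtain a where a: "a \<in> carried (topspace H) n K L" "a \<notin> W" by blast
    have in_x: "a \<in> carried (topspace H) n K (snd x)" if "x \<in> insert (P0, L0) X" for x
    proof -
      have "L j \<subseteq> snd x j" for j using that unfolding L_def by blast
      then show ?thesis using a(1) unfolding carried_def by blast
    qed
    then have "a \<in> ?C" using a(2) by force
    then obtain x where "x \<in> X" "a \<in> ?N (snd x)" using F(3) unfolding X(3) by blast
    then show False using in_x[of x] by blast
  qed
  ultimately show thesis using that by blast
qed

text \<open>A chain of compact sets \<open>E m\<close> is built, each step adding
  \<open>D j m\<close> and thickening, with an open set \<open>Q m\<close> between consecutive
  members. The union \<open>P\<close> is open, its trace on \<open>A\<close> is \<open>U\<close>,
  and a map carried by \<open>P\<close> is already carried by one \<open>E m\<close>, because its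
  images are compact. It is therefore enough that the maps carried by each single \<open>E m\<close>
  lie in \<open>W\<close>.\<close>

lemma extend_carrying_open_sets:
  fixes n :: nat and U B :: "nat \<Rightarrow> 'y set" and H :: "('v \<Rightarrow> 'y) topology"
  assumes Y: "locally_compact_space Y" "Hausdorff_space Y"
    and cpt: "\<And>E. \<forall>j<n. compactin Y (E j) \<Longrightarrow> compactin H (carried (topspace H) n K E)"
    and clo: "\<And>E. \<forall>j<n. compactin Y (E j) \<Longrightarrow> closedin H (carried (topspace H) n K E)"
    and img: "\<And>a j. a \<in> topspace H \<Longrightarrow> j < n \<Longrightarrow> a ` K j \<subseteq> topspace Y \<Longrightarrow> compactin Y (a ` K j)"
    and dich: "\<And>a. a \<in> topspace H \<Longrightarrow> (\<forall>j<n. a ` K j \<subseteq> A) \<or> (\<forall>j<n. a ` K j \<inter> A = {})"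
    and A: "closedin Y A"
    and W: "openin H W"
    and U: "\<forall>j<n. openin (subtopology Y A) (U j)"
    and UD: "\<forall>j<n. \<exists>D::nat \<Rightarrow> _. (\<forall>m. compactin Y (D m)) \<and> U j = (\<Union>m. D m)"
    and B: "\<forall>j<n. compactin Y (B j) \<and> B j \<inter> A \<subseteq> U j"
    and UW: "carried (topspace H) n K U \<subseteq> W"
    and BW: "carried (topspace H) n K B \<subseteq> W"
  obtains P where "\<forall>j<n. openin Y (P j) \<and> P j \<inter> A = U j \<and> B j \<subseteq> P j"
    "carried (topspace H) n K P \<subseteq> W"
proof -
  obtain D :: "nat \<Rightarrow> nat \<Rightarrow> 'y set" where D: "\<And>j m. j < n \<Longrightarrow> compactin Y (D j m)" "\<And>j. j < n \<Longrightarrow> U j = (\<Union>m. D j m)"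
    using UD by metis
  have UA: "U j \<subseteq> A" if "j < n" for j using U that openin_subset by fastforce
  \<comment> \<open>The invariant of the chain. It bounds the trace on \<open>A\<close> from above
    only; equality with \<open>U j\<close> is reached in the limit through the sets
    \<open>D j m\<close>.\<close>
  define ok where "ok E \<longleftrightarrow> (\<forall>j<n. compactin Y (E j) \<and> E j \<inter> A \<subseteq> U j) \<and> carried (topspace H) n K E \<subseteq> W" for E
  define step where "step m x y \<longleftrightarrow>
      (\<forall>j<n. openin Y (snd y j) \<and> fst x j \<union> D j m \<subseteq> snd y j \<and> snd y j \<subseteq> fst y j)"
    for m :: nat and x y :: "(nat \<Rightarrow> 'y set) \<times> (nat \<Rightarrow> 'y set)"
  have step: "\<exists>y. ok (fst y) \<and> step m x y" if x: "ok (fst x)" for x m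
  proof -
    obtain E Q where xE: "x = (E, Q)" by fastforce
    have okE: "ok E" using x xE by simp
    define E' where "E' j = E j \<union> D j m" for j
    \<comment> \<open>The largest subset of \<open>Y\<close> whose trace on \<open>A\<close> is
      \<open>U j\<close>: a thickening inside \<open>G j\<close> preserves the invariant.\<close>
    define G where "G j = topspace Y - (A - U j)" for j
    \<comment> \<open>Since \<open>D j m \<subseteq> A\<close>, a map carried by \<open>E'\<close> is carried by \<open>U\<close> or already by \<open>E\<close>.\<close>
    have sub: "carried (topspace H) n K E' \<subseteq> W"
    proof
      fix a assume a: "a \<in> carried (topspace H) n K E'"
      then have aH: "a \<in> topspace H" by (simp add: carried_def)
      from dich[OF aH] show "a \<in> W"
      proof
        assume *: "\<forall>j<n. a ` K j \<subseteq> A"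
        have "a ` K j \<subseteq> U j" if "j < n" for j
        proof -
          have "E' j \<inter> A \<subseteq> U j" using okE D(2) that unfolding ok_def E'_def by blast
          then show ?thesis using a * that unfolding carried_def by blast
        qed
        then show ?thesis using UW aH by (auto simp: carried_def)
      next
        assume *: "\<forall>j<n. a ` K j \<inter> A = {}"
        have "a ` K j \<subseteq> E j" if "j < n" for j
        proof -
          have "D j m \<subseteq> A" using UA D(2) that by blast
          moreover have "a ` K j \<subseteq> E' j" using a that by (simp add: carried_def)
          ultimately show ?thesis using * that unfolding E'_def by blast
        qed
        then have "a \<in> carried (topspace H) n K E" using aH by (auto simp: carried_def)
        then show ?thesis using okE by (auto simp: ok_def)
      qed
    qed
    have "\<forall>j<n. compactin Y (E' j) \<and> openin Y (G j) \<and> E' j \<subseteq> G j"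
    proof (intro allI impI conjI)
      fix j assume j: "j < n"
      show "compactin Y (E' j)" unfolding E'_def using okE D(1) j by (simp add: ok_def compactin_Un)
      obtain T where T: "openin Y T" "U j = T \<inter> A" using U j by (auto simp: openin_subtopology)
      have "G j = T \<union> (topspace Y - A)"
        using T openin_subset[OF T(1)] by (auto simp: G_def)
      then show "openin Y (G j)" using T A by (simp add: openin_Un openin_diff)
      show "E' j \<subseteq> G j"
        using okE D j compactin_subset_topspace[OF D(1)[OF j, of m]] compactin_subset_topspace[of Y "E j"]
        unfolding ok_def E'_def G_def by blast
    qed
    then obtain P L where PL: "\<forall>j<n. openin Y (P j) \<and> compactin Y (L j) \<and> E' j \<subseteq> P j \<and> P j \<subseteq> L j \<and> L j \<subseteq> G j"
        "carried (topspace H) n K L \<subseteq> W"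
      using carried_compact_neighbourhood[OF Y cpt clo W _ sub, of G] by metis
    then have "ok L" unfolding ok_def G_def by blast
    moreover have "step m x (L, P)" using PL(1) unfolding xE step_def E'_def by simp
    ultimately show ?thesis by (metis fst_conv)
  qed
  \<comment> \<open>The chain starts at \<open>B\<close>. The second component of the initial pair
    is a placeholder, as open sets are read off from the first step on.\<close>
  have "ok (fst (B, B))" using B BW by (simp add: ok_def)
  then have "\<exists>f. \<forall>m. (ok (fst (f m)) \<and> (m = 0 \<longrightarrow> f m = (B, B))) \<and> step m (f m) (f (Suc m))"
    using step by (intro dependent_nat_choice) auto
  then obtain f where f: "\<And>m. ok (fst (f m))" "\<And>m. step m (f m) (f (Suc m))" "f 0 = (B, B)"
    by blast
  define E where "E m = fst (f m)" for m
  define Q where "Q m = snd (f (Suc m))" for m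
  have EQ: "openin Y (Q m j) \<and> E m j \<subseteq> Q m j \<and> D j m \<subseteq> Q m j \<and> Q m j \<subseteq> E (Suc m) j" if "j < n" for m j
    using f(2)[of m] that by (auto simp: step_def E_def Q_def split: prod.splits)
  have okE: "ok (E m)" for m using f(1) by (simp add: E_def)
  have E_mono: "E m j \<subseteq> E m' j" if "j < n" "m \<le> m'" for m m' j
    using that(2) by (induction rule: dec_induct) (use EQ[OF that(1)] in blast)+
  define P where "P j = (\<Union>m. Q m j)" for j
  have PE: "P j = (\<Union>m. E m j)" if "j < n" for j
    using EQ[OF that] unfolding P_def by blast
  have "\<forall>j<n. openin Y (P j) \<and> P j \<inter> A = U j \<and> B j \<subseteq> P j"
  proof (intro allI impI conjI)
    fix j assume j: "j < n"
    show "openin Y (P j)" using EQ[OF j] unfolding P_def by blast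
    have "U j \<subseteq> P j" unfolding D(2)[OF j] P_def using EQ[OF j] by (intro UN_mono) auto
    moreover have "P j \<inter> A \<subseteq> U j" using okE j unfolding PE[OF j] ok_def by blast
    ultimately show "P j \<inter> A = U j" using UA[OF j] by blast
    have "E 0 j = B j" using f(3) by (simp add: E_def)
    then show "B j \<subseteq> P j" using PE[OF j] by blast
  qed
  moreover have "carried (topspace H) n K P \<subseteq> W"
  proof
    fix a assume a: "a \<in> carried (topspace H) n K P"
    then have aH: "a \<in> topspace H" by (simp add: carried_def)
    have "\<exists>m. a ` K j \<subseteq> E m j" if j: "j < n" for j
    proof -
      have sub: "a ` K j \<subseteq> \<Union>(range (\<lambda>m. Q m j))" using a j by (auto simp: carried_def P_def)
      have "P j \<subseteq> topspace Y" using EQ[OF j] openin_subset unfolding P_def by blast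
      then have "compactin Y (a ` K j)" using a j aH by (intro img) (auto simp: carried_def)
      then have "\<exists>\<F>. finite \<F> \<and> \<F> \<subseteq> range (\<lambda>m. Q m j) \<and> a ` K j \<subseteq> \<Union>\<F>"
        using EQ[OF j] sub by (intro compactinD) auto
      then obtain \<F> where F: "finite \<F>" "\<F> \<subseteq> range (\<lambda>m. Q m j)" "a ` K j \<subseteq> \<Union>\<F>"
        by blast
      then obtain M where M: "finite M" "\<F> = (\<lambda>m. Q m j) ` M"
        using finite_subset_image[OF F(1,2)] by blast
      have "Q m j \<subseteq> E (Suc (Max M)) j" if "m \<in> M" for m
        using EQ[OF j, of m] E_mono[OF j, of "Suc m" "Suc (Max M)"] M(1) that by fastforce
      then have "a ` K j \<subseteq> E (Suc (Max M)) j" using F(3) unfolding M(2) by blast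
      then show ?thesis by blast
    qed
    then obtain mm where mm: "\<And>j. j < n \<Longrightarrow> a ` K j \<subseteq> E (mm j) j" by metis
    \<comment> \<open>One stage for all \<open>n\<close> conditions at once, since the chain
      increases; the inserted \<open>0\<close> covers \<open>n = 0\<close>.\<close>
    let ?m = "Max (insert 0 (mm ` {..<n}))"
    have "a ` K j \<subseteq> E ?m j" if "j < n" for j
      using mm[OF that] E_mono[OF that, of "mm j" ?m] that by fastforce
    then have "a \<in> carried (topspace H) n K (E ?m)" using aH by (simp add: carried_def)
    then show "a \<in> W" using okE[of ?m] by (auto simp: ok_def)
  qed
  ultimately show thesis using that by blast
qed

section \<open>Relative CW-complexes\<close>

lemma second_countable_euclidean: "second_countable (euclidean :: 'a::second_countable_topology topology)"
proof -
  obtain B :: "'a set set" where B: "countable B" "topological_basis B"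
    using ex_countable_basis by blast
  show ?thesis
    unfolding second_countable_def
  proof (intro exI[of _ B] conjI ballI allI impI)
    fix U and x :: 'a assume "openin euclidean U \<and> x \<in> U"
    then have "open U" "x \<in> U" by auto
    then obtain V where "V \<in> B" "x \<in> V" "V \<subseteq> U" by (rule topological_basisE[OF B(2)])
    then show "\<exists>V\<in>B. x \<in> V \<and> V \<subseteq> U" by blast
  qed (use B topological_basis_open in auto)
qed

lemma Euclidean_space_euclidean: "Euclidean_space n = top_of_set {x. \<forall>i\<ge>n. x i = 0}"
  by (simp add: Euclidean_space_def euclidean_product_topology)

lemma disc_euclidean: "disc n = top_of_set {x. (\<forall>i\<ge>n. x i = 0) \<and> (\<Sum>i<n. (x i)\<^sup>2) \<le> 1}"
  by (simp add: disc_def Euclidean_space_euclidean subtopology_subtopology Collect_conj_eq)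

lemma second_countable_disc: "second_countable (disc n)"
  by (simp add: disc_euclidean second_countable_subtopology second_countable_euclidean)

lemma disc_coordinate_le_1:
  fixes x :: "nat \<Rightarrow> real"
  assumes "\<forall>i\<ge>n. x i = 0" "(\<Sum>i<n. (x i)\<^sup>2) \<le> 1"
  shows "x i \<in> {-1..1}"
proof (cases "i < n")
  case True
  then have "(x i)\<^sup>2 \<le> (\<Sum>i<n. (x i)\<^sup>2)"
    by (intro member_le_sum) auto
  then have "(x i)\<^sup>2 \<le> 1" using assms by linarith
  then show ?thesis by (simp add: abs_square_le_1 abs_le_iff)
qed (use assms in auto)

lemma continuous_coordinate: "continuous_on UNIV (\<lambda>x :: nat \<Rightarrow> real. x i)"
  by (simp add: continuous_on_product_coordinates)

text \<open>The disc is realised among real sequences with the product topology. It is closed there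
  and contained in the cube of sequences with entries in \<open>{-1..1}\<close>, which is compact by
  Tychonoff.\<close>

lemma compact_disc: "compact {x :: nat \<Rightarrow> real. (\<forall>i\<ge>n. x i = 0) \<and> (\<Sum>i<n. (x i)\<^sup>2) \<le> 1}" (is "compact ?D")
proof -
  have "compactin (product_topology (\<lambda>i. euclidean) UNIV) (Pi\<^sub>E UNIV (\<lambda>i::nat. {-1..1::real}))"
    by (subst compactin_PiE) auto
  then have "compact (Pi\<^sub>E UNIV (\<lambda>i::nat. {-1..1::real}))" by (simp add: euclidean_product_topology)
  moreover have "closed ?D"
    by (intro closed_Collect_conj closed_Collect_all closed_Collect_imp closed_Collect_eq closed_Collect_le 
        continuous_on_sum continuous_on_power continuous_coordinate continuous_on_const) auto
  ultimately have "compact (Pi\<^sub>E UNIV (\<lambda>i::nat. {-1..1::real}) \<inter> ?D)" by (rule compact_Int_closed)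
  moreover have "?D \<subseteq> Pi\<^sub>E UNIV (\<lambda>i::nat. {-1..1::real})"
    using disc_coordinate_le_1 by (fastforce simp: PiE_def)
  ultimately show ?thesis by (simp add: inf.absorb2)
qed

lemma compact_space_disc: "compact_space (disc n)"
  by (simp add: disc_euclidean compact_space_subtopology compact_disc)

lemma disc_boundary_closedin_disc: "closedin (disc n) (disc_boundary n)"
proof -
  have "closed {x :: nat \<Rightarrow> real. (\<Sum>i<n. (x i)\<^sup>2) = 1}"
    by (intro closed_Collect_eq continuous_on_sum continuous_on_power continuous_coordinate continuous_on_const)
  moreover have "disc_boundary n = {x. (\<Sum>i<n. (x i)\<^sup>2) = 1} \<inter> topspace (disc n)"
    by (auto simp: disc_boundary_def disc_euclidean Euclidean_space_euclidean)
  ultimately show ?thesis by (auto simp: disc_euclidean closedin_closed)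
qed

lemma topspace_disc: "topspace (disc n) = topspace (disc_interior n) \<union> disc_boundary n"
  by (auto simp: disc_def disc_interior_def disc_boundary_def)

section \<open>Cells of a CW-complex\<close>

lemma CW_complexD:
  assumes X: "CW_complex X E"
  shows "Hausdorff_space X"
    and "(\<Union>n. \<Union>(E n)) = topspace X"
    and "\<And>m n e e'. e \<in> E m \<Longrightarrow> e' \<in> E n \<Longrightarrow> (m, e) \<noteq> (n, e') \<Longrightarrow> e \<inter> e' = {}"
    and "\<And>n e. e \<in> E n \<Longrightarrow> \<exists>\<Phi>. continuous_map (disc n) X \<Phi> \<and>
        homeomorphic_map (disc_interior n) (subtopology X e) \<Phi> \<and>
        (\<exists>J. finite J \<and> J \<subseteq> (\<Union>k<n. E k) \<and> \<Phi> ` disc_boundary n \<subseteq> \<Union>J)"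
    and "\<And>T. T \<subseteq> topspace X \<Longrightarrow> (\<And>n e. e \<in> E n \<Longrightarrow> closedin X (T \<inter> X closure_of e)) \<Longrightarrow> closedin X T"
proof -
  note X' = X[unfolded CW_complex_def]
  show "Hausdorff_space X" by (rule conjunct1[OF X'])
  show "(\<Union>n. \<Union>(E n)) = topspace X" by (rule conjunct1[OF conjunct2[OF X']])
  note 3 = conjunct2[OF conjunct2[OF X']]
  show "e \<inter> e' = {}" if "e \<in> E m" "e' \<in> E n" "(m, e) \<noteq> (n, e')" for m n e e'
    using conjunct1[OF 3] that by metis
  show "\<exists>\<Phi>. continuous_map (disc n) X \<Phi> \<and>
        homeomorphic_map (disc_interior n) (subtopology X e) \<Phi> \<and>
        (\<exists>J. finite J \<and> J \<subseteq> (\<Union>k<n. E k) \<and> \<Phi> ` disc_boundary n \<subseteq> \<Union>J)" if "e \<in> E n" for n e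
    using bspec[OF spec[OF conjunct1[OF conjunct2[OF 3]]] that] .
  show "closedin X T" if "T \<subseteq> topspace X" "\<And>n e. e \<in> E n \<Longrightarrow> closedin X (T \<inter> X closure_of e)" for T
    using conjunct2[OF conjunct2[OF 3]] that by metis
qed

text \<open>Everything is read off from the characteristic map. The closure of \<open>e\<close> lies
  in the compact image of the disc, and what it has beyond \<open>e\<close> lies in the image of the
  boundary. That image is covered by cells of lower dimension and so avoids \<open>e\<close>, which
  makes the frontier closed.\<close>

lemma CW_complex_cell:
  assumes X: "CW_complex X E" and e: "e \<in> E n"
  shows "e \<subseteq> topspace X" "compactin X (X closure_of e)"
    "second_countable (subtopology X (X closure_of e))"
    "closedin X (X closure_of e - e)"
    "\<exists>J. finite J \<and> J \<subseteq> (\<Union>k<n. E k) \<and> X closure_of e - e \<subseteq> \<Union>J"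
proof -
  have H: "Hausdorff_space X" by (rule CW_complexD(1)[OF X])
  show eX: "e \<subseteq> topspace X" using CW_complexD(2)[OF X] e by blast
  obtain \<Phi> J where \<Phi>: "continuous_map (disc n) X \<Phi>"
      "homeomorphic_map (disc_interior n) (subtopology X e) \<Phi>"
      and J: "finite J" "J \<subseteq> (\<Union>k<n. E k)" "\<Phi> ` disc_boundary n \<subseteq> \<Union>J"
    using CW_complexD(4)[OF X e] by blast
  let ?c = "\<Phi> ` topspace (disc n)" and ?b = "\<Phi> ` disc_boundary n"
  have int: "\<Phi> ` topspace (disc_interior n) = e"
    using homeomorphic_imp_surjective_map[OF \<Phi>(2)] eX by auto
  have c: "compactin X ?c"
    using image_compactin[OF _ \<Phi>(1)] compact_space_disc by (auto simp: compact_space_def)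
  have b: "closedin X ?b"
    using image_compactin[OF _ \<Phi>(1)] closedin_compact_space[OF compact_space_disc disc_boundary_closedin_disc]
      compactin_imp_closedin[OF H] by blast
  have "closedin X ?c" using c compactin_imp_closedin[OF H] by blast
  then have cl: "X closure_of e \<subseteq> ?c"
    using int by (intro closure_of_minimal) (auto simp: topspace_disc)
  then show "compactin X (X closure_of e)" using closed_compactin[OF c] by auto
  \<comment> \<open>The cells of \<open>J\<close> have dimension below \<open>n\<close>, so the
    index pairs differ and disjointness of cells applies.\<close>
  have dj: "e \<inter> \<Union>J = {}"
  proof -
    have "e \<inter> e' = {}" if "e' \<in> J" for e'
    proof -
      obtain k where "k < n" "e' \<in> E k" using J(2) \<open>e' \<in> J\<close> by blast
      then have "(n, e) \<noteq> (k, e')" by auto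
      then show ?thesis using CW_complexD(3)[OF X e \<open>e' \<in> E k\<close>] by blast
    qed
    then show ?thesis by blast
  qed
  have sub: "X closure_of e - e \<subseteq> ?b" using cl int by (auto simp: topspace_disc image_Un)
  then show "\<exists>J. finite J \<and> J \<subseteq> (\<Union>k<n. E k) \<and> X closure_of e - e \<subseteq> \<Union>J"
    using J(1,2) subset_trans[OF sub J(3)] by (intro exI[of _ J] conjI)
  have "X closure_of e - e = X closure_of e \<inter> ?b" using sub dj J(3) by blast
  then show "closedin X (X closure_of e - e)" using b by (simp add: closedin_Int)
  have "second_countable (subtopology X ?c)"
  proof (rule second_countable_compact_Hausdorff_image)
    show "continuous_map (disc n) (subtopology X ?c) \<Phi>"
      using \<Phi>(1) by (auto simp: continuous_map_in_subtopology)
    show "\<Phi> ` topspace (disc n) = topspace (subtopology X ?c)"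
      using compactin_subset_topspace[OF c] by auto
  qed (use H in \<open>auto simp: compact_space_disc second_countable_disc Hausdorff_space_subtopology\<close>)
  then have "second_countable (subtopology (subtopology X ?c) (X closure_of e))"
    by (rule second_countable_subtopology)
  then show "second_countable (subtopology X (X closure_of e))"
    using cl by (simp add: subtopology_subtopology inf.absorb2)
qed

section \<open>CW-pairs as relative CW-complexes\<close>

text \<open>\<open>E n\<close> consists of the pairs of an open \<open>n\<close>-cell outside \<open>A\<close> and its closure.\<close>

definition relative_CW :: "'a topology \<Rightarrow> 'a set \<Rightarrow> (nat \<Rightarrow> ('a set \<times> 'a set) set) \<Rightarrow> bool" where
  "relative_CW X A E \<longleftrightarrow>
     Hausdorff_space X \<and> closedin X A \<and>
     topspace X = A \<union> (\<Union>n. \<Union>(fst ` E n)) \<and>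
     (\<forall>m n x y. x \<in> E m \<longrightarrow> y \<in> E n \<longrightarrow> (m, x) \<noteq> (n, y) \<longrightarrow> fst x \<inter> fst y = {}) \<and>
     (\<forall>n. \<forall>(e, c) \<in> E n. e \<subseteq> c \<and> e \<inter> A = {} \<and> compactin X c \<and>
        second_countable (subtopology X c) \<and> closedin X (c - e) \<and>
        (\<exists>J. finite J \<and> J \<subseteq> (\<Union>k<n. E k) \<and> c - e \<subseteq> A \<union> \<Union>(fst ` J))) \<and>
     (\<forall>T. T \<subseteq> topspace X \<longrightarrow> closedin X (T \<inter> A) \<longrightarrow>
        (\<forall>n. \<forall>(e, c) \<in> E n. closedin X (T \<inter> c)) \<longrightarrow> closedin X T)"

lemma relative_CWD:
  assumes X: "relative_CW X A E"
  shows "Hausdorff_space X" and "closedin X A"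
    and "topspace X = A \<union> (\<Union>n. \<Union>(fst ` E n))"
    and "\<And>m n x y. x \<in> E m \<Longrightarrow> y \<in> E n \<Longrightarrow> (m, x) \<noteq> (n, y) \<Longrightarrow> fst x \<inter> fst y = {}"
    and "\<And>n e c. (e, c) \<in> E n \<Longrightarrow> e \<subseteq> c"
    and "\<And>n e c. (e, c) \<in> E n \<Longrightarrow> e \<inter> A = {}"
    and "\<And>n e c. (e, c) \<in> E n \<Longrightarrow> compactin X c"
    and "\<And>n e c. (e, c) \<in> E n \<Longrightarrow> second_countable (subtopology X c)"
    and "\<And>n e c. (e, c) \<in> E n \<Longrightarrow> closedin X (c - e)"
    and "\<And>n e c. (e, c) \<in> E n \<Longrightarrow> \<exists>J. finite J \<and> J \<subseteq> (\<Union>k<n. E k) \<and> c - e \<subseteq> A \<union> \<Union>(fst ` J)"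
    and "\<And>T. T \<subseteq> topspace X \<Longrightarrow> closedin X (T \<inter> A) \<Longrightarrow>
        (\<And>n e c. (e, c) \<in> E n \<Longrightarrow> closedin X (T \<inter> c)) \<Longrightarrow> closedin X T"
proof -
  note X' = X[unfolded relative_CW_def]
  show "Hausdorff_space X" by (rule conjunct1[OF X'])
  note 2 = conjunct2[OF X']
  show "closedin X A" by (rule conjunct1[OF 2])
  note 3 = conjunct2[OF 2]
  show "topspace X = A \<union> (\<Union>n. \<Union>(fst ` E n))" by (rule conjunct1[OF 3])
  note 4 = conjunct2[OF 3]
  show "fst x \<inter> fst y = {}" if "x \<in> E m" "y \<in> E n" "(m, x) \<noteq> (n, y)" for m n x y
    using conjunct1[OF 4] that by metis
  note 5 = conjunct2[OF 4]
  fix n e c assume ec: "(e, c) \<in> E n"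
  note c = bspec[OF spec[OF conjunct1[OF 5]] ec, unfolded prod.case]
  from c show "e \<subseteq> c" "e \<inter> A = {}" "compactin X c" "second_countable (subtopology X c)" "closedin X (c - e)"
    "\<exists>J. finite J \<and> J \<subseteq> (\<Union>k<n. E k) \<and> c - e \<subseteq> A \<union> \<Union>(fst ` J)"
    by auto
next
  fix T assume T: "T \<subseteq> topspace X" "closedin X (T \<inter> A)"
    "\<And>n e c. (e, c) \<in> E n \<Longrightarrow> closedin X (T \<inter> c)"
  have "\<forall>n. \<forall>(e, c)\<in>E n. closedin X (T \<inter> c)" using T(3) by blast
  with T(1,2) X show "closedin X T" by (simp add: relative_CW_def)
qed

text \<open>A cell that meets \<open>A\<close> is a cell of \<open>A\<close>, since cells are
  disjoint. \<open>A\<close> is closed because a closed cell is covered by finitely many cells, so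
  that it meets \<open>A\<close> in a finite union of closed sets. The cells of \<open>A\<close> can
  then be forgotten: on their closures, closedness of a set follows from closedness of its trace on
  \<open>A\<close>.\<close>

lemma subcomplex_relative_CW:
  assumes X: "CW_complex X E" and A: "subcomplex X E A"
  shows "relative_CW X A (\<lambda>n. (\<lambda>e. (e, X closure_of e)) ` {e \<in> E n. e \<inter> A = {}})"
proof -
  from A obtain L
    where L': "(\<forall>n. L n \<subseteq> E n) \<and> A = (\<Union>n. \<Union>(L n)) \<and> (\<forall>n. \<forall>e \<in> L n. X closure_of e \<subseteq> A)"
    unfolding subcomplex_def by (rule exE)
  have L: "\<And>n. L n \<subseteq> E n" "A = (\<Union>n. \<Union>(L n))" "\<And>n e. e \<in> L n \<Longrightarrow> X closure_of e \<subseteq> A"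
    using conjunct1[OF L'] conjunct1[OF conjunct2[OF L']] conjunct2[OF conjunct2[OF L']] by simp_all
  note dj = CW_complexD(3)[OF X] and un = CW_complexD(2)[OF X] and weak = CW_complexD(5)[OF X]
  have dich: "(\<exists>m. e \<in> L m) \<or> e \<inter> A = {}" if e: "e \<in> E n" for e n
  proof (rule disjCI)
    assume "e \<inter> A \<noteq> {}"
    then obtain m e' where "e' \<in> L m" "e \<inter> e' \<noteq> {}" unfolding L(2) by blast
    then show "\<exists>m. e \<in> L m" using dj[OF e, of e' m] L(1) by blast
  qed
  have clA: "closedin X A"
  proof (rule weak)
    show "A \<subseteq> topspace X" using un L(1,2) by blast
    fix n e assume e: "e \<in> E n"
    obtain J where J: "finite J" "J \<subseteq> (\<Union>k<n. E k)" "X closure_of e - e \<subseteq> \<Union>J"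
      using CW_complex_cell(5)[OF X e] by blast
    \<comment> \<open>The cells of \<open>A\<close> among \<open>e\<close> and the finitely many
      cells that cover its frontier; their closures lie in \<open>A\<close>.\<close>
    let ?J = "{e' \<in> insert e J. \<exists>m. e' \<in> L m}"
    have "A \<inter> X closure_of e = (\<Union>e'\<in>?J. X closure_of e' \<inter> X closure_of e)"
    proof
      show "A \<inter> X closure_of e \<subseteq> (\<Union>e'\<in>?J. X closure_of e' \<inter> X closure_of e)"
      proof
        fix x assume x: "x \<in> A \<inter> X closure_of e"
        then obtain e' where e': "e' \<in> insert e J" "x \<in> e'" using J(3) by blast
        then obtain k where k: "e' \<in> E k" using e J(2) by blast
        then obtain m where "e' \<in> L m" using dich[OF k] x e' by blast
        moreover have "e' \<subseteq> X closure_of e'"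
          using CW_complex_cell(1)[OF X k] by (simp add: closure_of_subset)
        ultimately show "x \<in> (\<Union>e'\<in>?J. X closure_of e' \<inter> X closure_of e)" using e' x by blast
      qed
    qed (use L(3) in blast)
    moreover have "closedin X (\<Union>e'\<in>?J. X closure_of e' \<inter> X closure_of e)"
      using J(1) by (intro closedin_Union) auto
    ultimately show "closedin X (A \<inter> X closure_of e)" by simp
  qed
  have cells: "e \<subseteq> X closure_of e \<and> e \<inter> A = {} \<and> compactin X (X closure_of e) \<and>
        second_countable (subtopology X (X closure_of e)) \<and> closedin X (X closure_of e - e) \<and>
        (\<exists>J. finite J \<and> J \<subseteq> (\<Union>k<n. (\<lambda>e. (e, X closure_of e)) ` {e \<in> E k. e \<inter> A = {}}) \<and>
           X closure_of e - e \<subseteq> A \<union> \<Union>(fst ` J))"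
    if e: "e \<in> E n" "e \<inter> A = {}" for n e
  proof (intro conjI)
    obtain J where J: "finite J" "J \<subseteq> (\<Union>k<n. E k)" "X closure_of e - e \<subseteq> \<Union>J"
      using CW_complex_cell(5)[OF X e(1)] by blast
    let ?J = "(\<lambda>e. (e, X closure_of e)) ` {e \<in> J. e \<inter> A = {}}"
    have "x \<in> A \<union> \<Union>(fst ` ?J)" if x: "x \<in> X closure_of e - e" for x
    proof -
      obtain e' where e': "e' \<in> J" "x \<in> e'" using subsetD[OF J(3) x] by (rule UnionE)
      then obtain k where k: "e' \<in> E k" using J(2) by blast
      show ?thesis
      proof (cases "e' \<inter> A = {}")
        case False
        then obtain m where "e' \<in> L m" using dich[OF k] by blast
        then show ?thesis using e' L(2) by blast
      qed (use e' in force)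
    qed
    then have "X closure_of e - e \<subseteq> A \<union> \<Union>(fst ` ?J)" by (rule subsetI)
    then show "\<exists>J. finite J \<and> J \<subseteq> (\<Union>k<n. (\<lambda>e. (e, X closure_of e)) ` {e \<in> E k. e \<inter> A = {}}) \<and>
           X closure_of e - e \<subseteq> A \<union> \<Union>(fst ` J)"
    proof (intro exI[of _ ?J] conjI)
      show "finite ?J" using J(1) by simp
      show "?J \<subseteq> (\<Union>k<n. (\<lambda>e. (e, X closure_of e)) ` {e \<in> E k. e \<inter> A = {}})"
        unfolding image_UN[symmetric] using J(2) by (intro image_mono) blast
    qed blast
    show "e \<subseteq> X closure_of e" using CW_complex_cell(1)[OF X e(1)] by (simp add: closure_of_subset)
  qed (use e CW_complex_cell[OF X e(1)] in auto)
  show ?thesis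
    unfolding relative_CW_def
  proof (intro conjI allI impI)
    show "Hausdorff_space X" by (rule CW_complexD(1)[OF X])
    show "closedin X A" by (rule clA)
    show "topspace X = A \<union> (\<Union>n. \<Union>(fst ` (\<lambda>e. (e, X closure_of e)) ` {e \<in> E n. e \<inter> A = {}}))"
      (is "_ = A \<union> ?U")
    proof
      show "topspace X \<subseteq> A \<union> ?U"
      proof
        fix x assume "x \<in> topspace X"
        then obtain n e where e: "e \<in> E n" "x \<in> e" using un by blast
        show "x \<in> A \<union> ?U"
        proof (cases "e \<inter> A = {}")
          case False
          then show ?thesis using dich[OF e(1)] e(2) L(2) by blast
        qed (use e in \<open>auto simp: image_image\<close>)
      qed
      show "A \<union> ?U \<subseteq> topspace X" using un clA closedin_subset by fastforce
    qed
  next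
    fix m n x y
    assume xy: "x \<in> (\<lambda>e. (e, X closure_of e)) ` {e \<in> E m. e \<inter> A = {}}"
      "y \<in> (\<lambda>e. (e, X closure_of e)) ` {e \<in> E n. e \<inter> A = {}}" "(m, x) \<noteq> (n, y)"
    then have "fst x \<in> E m" "fst y \<in> E n" "(m, fst x) \<noteq> (n, fst y)" by auto
    then show "fst x \<inter> fst y = {}" by (rule dj)
  next
    fix n
    show "\<forall>(e, c)\<in>(\<lambda>e. (e, X closure_of e)) ` {e \<in> E n. e \<inter> A = {}}. e \<subseteq> c \<and> e \<inter> A = {} \<and> compactin X c \<and>
        second_countable (subtopology X c) \<and> closedin X (c - e) \<and>
        (\<exists>J. finite J \<and> J \<subseteq> (\<Union>k<n. (\<lambda>e. (e, X closure_of e)) ` {e \<in> E k. e \<inter> A = {}}) \<and> c - e \<subseteq> A \<union> \<Union>(fst ` J))"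
      using cells by blast
  next
    fix T assume T: "T \<subseteq> topspace X" "closedin X (T \<inter> A)"
      "\<forall>n. \<forall>(e, c)\<in>(\<lambda>e. (e, X closure_of e)) ` {e \<in> E n. e \<inter> A = {}}. closedin X (T \<inter> c)"
    show "closedin X T"
    proof (rule weak[OF T(1)])
      fix n e assume e: "e \<in> E n"
      show "closedin X (T \<inter> X closure_of e)"
      proof (cases "e \<inter> A = {}")
        case True
        then have "(e, X closure_of e) \<in> (\<lambda>e. (e, X closure_of e)) ` {e \<in> E n. e \<inter> A = {}}" using e by simp
        with spec[OF T(3), of n] have "case (e, X closure_of e) of (e, c) \<Rightarrow> closedin X (T \<inter> c)" by (rule bspec)
        then show ?thesis by simp
      next
        case False
        then obtain m where "e \<in> L m" using dich[OF e] by blast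
        then have "T \<inter> X closure_of e = (T \<inter> A) \<inter> X closure_of e" using L(3) by blast
        then show ?thesis using T(2) by (metis closedin_Int closedin_closure_of)
      qed
    qed
  qed
qed

text \<open>A CW-pair is only homeomorphic to a complex with a subcomplex. Transporting the cells
  lets the later arguments take place in the base of the bundle itself.\<close>

lemma homeomorphic_relative_CW:
  assumes X: "relative_CW X A E" and g: "homeomorphic_map X Y g"
  shows "relative_CW Y (g ` A) (\<lambda>n. map_prod ((`) g) ((`) g) ` E n)"
proof -
  have inj: "inj_on g (topspace X)" and sur: "g ` topspace X = topspace Y"
    using g homeomorphic_imp_injective_map homeomorphic_imp_surjective_map by blast+
  have AX: "A \<subseteq> topspace X" using relative_CWD(3)[OF X] by blast
  have eX: "fst x \<subseteq> topspace X" if "x \<in> E n" for x n using relative_CWD(3)[OF X] that by blast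
  have cX: "snd x \<subseteq> topspace X" if "x \<in> E n" for x n
  proof -
    obtain e c where x: "x = (e, c)" by fastforce
    have "compactin X c" using relative_CWD(7)[OF X] that unfolding x by blast
    then show ?thesis using x compactin_subset_topspace by auto
  qed
  have cl: "closedin X T \<longleftrightarrow> closedin Y (g ` T)" if "T \<subseteq> topspace X" for T
    using homeomorphic_map_closedness[OF g that] by simp
  show ?thesis
    unfolding relative_CW_def
  proof (intro conjI allI impI)
    show "Hausdorff_space Y"
      using relative_CWD(1)[OF X] homeomorphic_Hausdorff_space
        homeomorphic_map_imp_homeomorphic_space[OF g] by blast
    show "closedin Y (g ` A)" using relative_CWD(2)[OF X] AX cl by blast
    note relative_CWD(3)[OF X]
    then have "topspace Y = g ` (A \<union> (\<Union>n. \<Union>(fst ` E n)))" using sur by simp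
    then show "topspace Y = g ` A \<union> (\<Union>n. \<Union>(fst ` map_prod ((`) g) ((`) g) ` E n))"
      by (auto simp: image_Un image_UN image_image)
  next
    fix m n x y assume xy: "x \<in> map_prod ((`) g) ((`) g) ` E m" "y \<in> map_prod ((`) g) ((`) g) ` E n" "(m, x) \<noteq> (n, y)"
    obtain x' where x': "x = map_prod ((`) g) ((`) g) x'" "x' \<in> E m" using xy(1) by (rule imageE)
    obtain y' where y': "y = map_prod ((`) g) ((`) g) y'" "y' \<in> E n" using xy(2) by (rule imageE)
    have "(m, x') \<noteq> (n, y')" using xy(3) x'(1) y'(1) by auto
    then have "fst x' \<inter> fst y' = {}" by (rule relative_CWD(4)[OF X x'(2) y'(2)])
    then have "g ` fst x' \<inter> g ` fst y' = {}"
      using inj_on_image_Int[OF inj eX[OF x'(2)] eX[OF y'(2)]] by simp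
    then show "fst x \<inter> fst y = {}" using x' y' by simp
  next
    fix n
    show "\<forall>(e, c)\<in>map_prod ((`) g) ((`) g) ` E n. e \<subseteq> c \<and> e \<inter> g ` A = {} \<and> compactin Y c \<and>
        second_countable (subtopology Y c) \<and> closedin Y (c - e) \<and>
        (\<exists>J. finite J \<and> J \<subseteq> (\<Union>k<n. map_prod ((`) g) ((`) g) ` E k) \<and> c - e \<subseteq> g ` A \<union> \<Union>(fst ` J))"
    proof (rule ballI)
      fix y assume "y \<in> map_prod ((`) g) ((`) g) ` E n"
      then obtain x where "y = map_prod ((`) g) ((`) g) x" "x \<in> E n" by (rule imageE)
      moreover obtain e c where "x = (e, c)" by fastforce
      ultimately have y: "y = (g ` e, g ` c)" and ec: "(e, c) \<in> E n" by auto
      note h = relative_CWD(5-9)[OF X ec]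
      obtain J where J: "finite J" "J \<subseteq> (\<Union>k<n. E k)" "c - e \<subseteq> A \<union> \<Union>(fst ` J)"
        using relative_CWD(10)[OF X ec] by blast
      have ecX: "e \<subseteq> topspace X" "c \<subseteq> topspace X" using eX[OF ec] cX[OF ec] by auto
      have diff: "g ` c - g ` e = g ` (c - e)" using inj_on_image_set_diff[OF inj] ecX by blast
      show "case y of (e, c) \<Rightarrow> e \<subseteq> c \<and> e \<inter> g ` A = {} \<and> compactin Y c \<and>
        second_countable (subtopology Y c) \<and> closedin Y (c - e) \<and>
        (\<exists>J. finite J \<and> J \<subseteq> (\<Union>k<n. map_prod ((`) g) ((`) g) ` E k) \<and> c - e \<subseteq> g ` A \<union> \<Union>(fst ` J))"
        unfolding y prod.case
      proof (intro conjI)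
        show "g ` e \<subseteq> g ` c" using h(1) by blast
        show "g ` e \<inter> g ` A = {}" using inj_on_image_Int[OF inj ecX(1) AX] h(2) by simp
        show "compactin Y (g ` c)" using h(3) homeomorphic_imp_continuous_map[OF g] image_compactin by blast
        have "homeomorphic_map (subtopology X c) (subtopology Y (g ` c)) g"
          using g ecX(2) sur by (intro homeomorphic_map_subtopologies) (auto simp: inf.absorb2)
        then show "second_countable (subtopology Y (g ` c))"
          using h(4) by (metis homeomorphic_imp_open_map homeomorphic_imp_surjective_map homeomorphic_imp_continuous_map second_countable_open_map_image)
        show "closedin Y (g ` c - g ` e)" unfolding diff using h(5) cl ecX by blast
        have "g ` c - g ` e \<subseteq> g ` A \<union> \<Union>(fst ` map_prod ((`) g) ((`) g) ` J)"
          unfolding diff using J(3) by (fastforce simp: image_image)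
        moreover have "map_prod ((`) g) ((`) g) ` J \<subseteq> (\<Union>k<n. map_prod ((`) g) ((`) g) ` E k)"
          using J(2) by blast
        ultimately show "\<exists>J. finite J \<and> J \<subseteq> (\<Union>k<n. map_prod ((`) g) ((`) g) ` E k) \<and> g ` c - g ` e \<subseteq> g ` A \<union> \<Union>(fst ` J)"
          using J(1) by (intro exI[of _ "map_prod ((`) g) ((`) g) ` J"]) blast
      qed
    qed
  next
    fix T assume T: "T \<subseteq> topspace Y" "closedin Y (T \<inter> g ` A)"
       "\<forall>n. \<forall>(e, c)\<in>map_prod ((`) g) ((`) g) ` E n. closedin Y (T \<inter> c)"
    obtain T' where T': "T' \<subseteq> topspace X" "T = g ` T'" using T(1) sur by (metis subset_imageE)
    have int: "T \<inter> g ` Q = g ` (T' \<inter> Q)" if "Q \<subseteq> topspace X" for Q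
      unfolding T'(2) using inj_on_image_Int[OF inj T'(1) that] by simp
    have "closedin X T'"
    proof -
      have "closedin X (T' \<inter> A)" using T(2) int[OF AX] cl T'(1) by (metis inf.coboundedI1)
      moreover have "closedin X (T' \<inter> c)" if "(e, c) \<in> E n" for n e c
      proof -
        have "(g ` e, g ` c) \<in> map_prod ((`) g) ((`) g) ` E n" using that by force
        with spec[OF T(3), of n] have "case (g ` e, g ` c) of (e, c) \<Rightarrow> closedin Y (T \<inter> c)" by (rule bspec)
        then have "closedin Y (T \<inter> g ` c)" by simp
        then show ?thesis using int[of c] cX[OF that] cl T'(1) by (metis inf.coboundedI1 snd_conv)
      qed
      ultimately show ?thesis by (rule relative_CWD(11)[OF X T'(1)])
    qed
    then show "closedin Y T" using cl T' by blast
  qed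
qed

lemma CW_pair_relative_CW:
  assumes "CW_pair X A"
  obtains E where "relative_CW X A E"
proof -
  obtain Y :: "'a topology" and E B f where Y: "CW_complex Y E" "subcomplex Y E B" "homeomorphic_map X Y f" "f ` A = B"
    and A: "A \<subseteq> topspace X"
    using assms unfolding CW_pair_def by blast
  obtain g where g: "homeomorphic_maps X Y f g" using Y(3) homeomorphic_map_maps by blast
  have "(\<lambda>x. g (f x)) ` A = (\<lambda>x. x) ` A"
    using A g by (intro image_cong) (auto simp: homeomorphic_maps_def)
  then have "g ` B = A" unfolding Y(4)[symmetric] by (simp add: image_image)
  have "homeomorphic_map Y X g" using g homeomorphic_maps_map homeomorphic_maps_sym by blast
  from homeomorphic_relative_CW[OF subcomplex_relative_CW[OF Y(1,2)] this, unfolded \<open>g ` B = A\<close>]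
  show thesis by (rule that)
qed

section \<open>Families and function spaces\<close>

text \<open>The set-theoretic part of \<open>is_family\<close>. It is what the fibrewise condition
  of \<open>family_map\<close> depends on, and for push-out families it is what gets
  established.\<close>

definition charted :: "('o, 'm, 'f) top_functor \<Rightarrow> ('o, 'f, 'x, 'b) family \<Rightarrow> bool" where
  "charted F X \<longleftrightarrow> (\<forall>b \<in> topspace (bas X).
     bij_betw (chart X b) (over X {b}) (topspace (fobj F (fib X b))))"

lemma chartedD:
  assumes "charted F X" "b \<in> topspace (bas X)"
  shows "inj_on (chart X b) (over X {b})"
    and "x \<in> over X {b} \<Longrightarrow> chart X b x \<in> topspace (fobj F (fib X b))"
    and "x \<in> over X {b} \<Longrightarrow> inv_into (over X {b}) (chart X b) (chart X b x) = x"
    and "z \<in> topspace (fobj F (fib X b)) \<Longrightarrow> inv_into (over X {b}) (chart X b) z \<in> over X {b}"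
    and "z \<in> topspace (fobj F (fib X b)) \<Longrightarrow> chart X b (inv_into (over X {b}) (chart X b) z) = z"
proof -
  have bij: "bij_betw (chart X b) (over X {b}) (topspace (fobj F (fib X b)))"
    using assms by (simp add: charted_def)
  then show "inj_on (chart X b) (over X {b})" by (simp add: bij_betw_def)
  show "x \<in> over X {b} \<Longrightarrow> chart X b x \<in> topspace (fobj F (fib X b))"
    using bij by (auto simp: bij_betw_def)
  show "x \<in> over X {b} \<Longrightarrow> inv_into (over X {b}) (chart X b) (chart X b x) = x"
    using bij by (simp add: bij_betw_def)
  show "z \<in> topspace (fobj F (fib X b)) \<Longrightarrow> inv_into (over X {b}) (chart X b) z \<in> over X {b}"
    using bij by (auto simp: bij_betw_def intro: inv_into_into)
  show "z \<in> topspace (fobj F (fib X b)) \<Longrightarrow> chart X b (inv_into (over X {b}) (chart X b) z) = z"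
    using bij by (auto simp: bij_betw_def intro: f_inv_into_f)
qed

lemma over_subset_topspace: "over X U \<subseteq> topspace (tot X)"
  by (auto simp: over_def)

lemma is_familyD:
  assumes "is_family C F X"
  shows "continuous_map (tot X) (bas X) (prj X)"
    and "charted F X"
    and "\<And>b. b \<in> topspace (bas X) \<Longrightarrow> fib X b \<in> Obj C"
    and "\<And>b. b \<in> topspace (bas X) \<Longrightarrow>
      homeomorphic_map (subtopology (tot X) (over X {b})) (fobj F (fib X b)) (chart X b)"
    and "\<And>x. x \<in> topspace (tot X) \<Longrightarrow> prj X x \<in> topspace (bas X)"
proof -
  show 1: "continuous_map (tot X) (bas X) (prj X)"
    using assms by (simp add: is_family_def)
  show "\<And>b. b \<in> topspace (bas X) \<Longrightarrow> fib X b \<in> Obj C"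
    and 2: "\<And>b. b \<in> topspace (bas X) \<Longrightarrow>
      homeomorphic_map (subtopology (tot X) (over X {b})) (fobj F (fib X b)) (chart X b)"
    using assms by (auto simp: is_family_def)
  show "x \<in> topspace (tot X) \<Longrightarrow> prj X x \<in> topspace (bas X)" for x
    using 1 by (auto simp: continuous_map_def)
  show "charted F X"
    unfolding charted_def bij_betw_def
  proof (intro ballI conjI)
    fix b assume b: "b \<in> topspace (bas X)"
    have "topspace (subtopology (tot X) (over X {b})) = over X {b}"
      using over_subset_topspace[of X "{b}"] by auto
    then show "inj_on (chart X b) (over X {b})" "chart X b ` over X {b} = topspace (fobj F (fib X b))"
      using homeomorphic_imp_injective_map[OF 2[OF b]] homeomorphic_imp_surjective_map[OF 2[OF b]] by auto
  qed
qed

lemma openin_over: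
  assumes "is_family C F X" "openin (bas X) U"
  shows "openin (tot X) (over X U)"
  unfolding over_def using is_familyD(1)[OF assms(1)] assms(2) by (rule openin_continuous_map_preimage)

lemma closedin_over:
  assumes "is_family C F X" "closedin (bas X) U"
  shows "closedin (tot X) (over X U)"
  unfolding over_def using is_familyD(1)[OF assms(1)] assms(2) by (rule closedin_continuous_map_preimage)

text \<open>With bijective charts the fibrewise condition can be stated at the points of the fibre,
  which removes \<open>inv_into\<close>. Family maps are verified and used in this form
  below.\<close>

lemma charted_family_map_iff:
  assumes "charted F X"
  shows "family_map C F X Y f fb \<longleftrightarrow>
     continuous_map (tot X) (tot Y) f \<and> continuous_map (bas X) (bas Y) fb \<and>
     (\<forall>x \<in> topspace (tot X). prj Y (f x) = fb (prj X x)) \<and>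
     (\<forall>b \<in> topspace (bas X). \<exists>\<phi> \<in> hom C (fib X b) (fib Y (fb b)).
        \<forall>x \<in> over X {b}. chart Y (fb b) (f x) = fmap F \<phi> (chart X b x))"
proof -
  have "(\<forall>z \<in> topspace (fobj F (fib X b)).
          chart Y (fb b) (f (inv_into (over X {b}) (chart X b) z)) = fmap F \<phi> z) \<longleftrightarrow>
       (\<forall>x \<in> over X {b}. chart Y (fb b) (f x) = fmap F \<phi> (chart X b x))"
    if b: "b \<in> topspace (bas X)" for b \<phi>
  proof
    assume L: "\<forall>z \<in> topspace (fobj F (fib X b)).
          chart Y (fb b) (f (inv_into (over X {b}) (chart X b) z)) = fmap F \<phi> z"
    show "\<forall>x \<in> over X {b}. chart Y (fb b) (f x) = fmap F \<phi> (chart X b x)"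
    proof
      fix x assume x: "x \<in> over X {b}"
      show "chart Y (fb b) (f x) = fmap F \<phi> (chart X b x)"
        using bspec[OF L chartedD(2)[OF assms b x]] by (simp add: chartedD(3)[OF assms b x])
    qed
  next
    assume R: "\<forall>x \<in> over X {b}. chart Y (fb b) (f x) = fmap F \<phi> (chart X b x)"
    show "\<forall>z \<in> topspace (fobj F (fib X b)).
          chart Y (fb b) (f (inv_into (over X {b}) (chart X b) z)) = fmap F \<phi> z"
    proof
      fix z assume z: "z \<in> topspace (fobj F (fib X b))"
      show "chart Y (fb b) (f (inv_into (over X {b}) (chart X b) z)) = fmap F \<phi> z"
        using bspec[OF R chartedD(4)[OF assms b z]] by (simp add: chartedD(5)[OF assms b z])
    qed
  qed
  then show ?thesis unfolding family_map_def by simp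
qed

lemma family_mapD:
  assumes "family_map C F X Y f fb"
  shows "continuous_map (tot X) (tot Y) f" "continuous_map (bas X) (bas Y) fb"
    "\<And>x. x \<in> topspace (tot X) \<Longrightarrow> prj Y (f x) = fb (prj X x)"
    "\<And>x. x \<in> topspace (tot X) \<Longrightarrow> f x \<in> topspace (tot Y)"
    "\<And>b. b \<in> topspace (bas X) \<Longrightarrow> fb b \<in> topspace (bas Y)"
  using assms unfolding family_map_def by (auto simp: continuous_map_def)

lemma family_map_over:
  assumes "family_map C F X Y f fb" "x \<in> over X {b}"
  shows "f x \<in> over Y {fb b}"
  using family_mapD[OF assms(1)] assms(2) by (auto simp: over_def)

lemma restr_simps [simp]:
  "tot (restr_family X U) = subtopology (tot X) (over X U)"
  "bas (restr_family X U) = subtopology (bas X) U"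
  "prj (restr_family X U) = prj X" "fib (restr_family X U) = fib X"
  "chart (restr_family X U) = chart X"
  by (simp_all add: restr_family_def)

lemma over_restr: "over (restr_family X U) T = over X (U \<inter> T)"
  by (auto simp: over_def)

lemma over_restr_point: "b \<in> U \<Longrightarrow> over (restr_family X U) {b} = over X {b}"
  by (auto simp: over_def)

lemma is_family_restr:
  assumes "is_family C F X"
  shows "is_family C F (restr_family X U)"
  unfolding is_family_def
proof (intro conjI ballI)
  show "continuous_map (tot (restr_family X U)) (bas (restr_family X U)) (prj (restr_family X U))"
    using is_familyD(1)[OF assms]
    by (auto simp: continuous_map_in_subtopology over_def intro: continuous_map_from_subtopology)
next
  fix b assume "b \<in> topspace (bas (restr_family X U))"
  then have b: "b \<in> topspace (bas X)" "b \<in> U" by auto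
  then show "fib (restr_family X U) b \<in> Obj C" using is_familyD(3)[OF assms] by simp
  have "over X U \<inter> over X {b} = over X {b}" using b by (auto simp: over_def)
  then show "homeomorphic_map (subtopology (tot (restr_family X U)) (over (restr_family X U) {b}))
        (fobj F (fib (restr_family X U) b)) (chart (restr_family X U) b)"
    using is_familyD(4)[OF assms b(1)] by (simp add: over_restr_point[OF b(2)] subtopology_subtopology)
qed

subsection \<open>Generated topologies on spaces of maps\<close>

lemma topspace_topology_from [simp]: "topspace (topology_from C F V Y \<K>) = maps_from C F V Y"
  by (simp add: topology_from_def)

lemma topspace_function_space [simp]: "topspace (function_space C F V Y) = maps_from C F V Y"
  by (simp add: function_space_def)

lemma continuous_map_into_topology_from:
  "continuous_map T (topology_from C F V Y \<K>) g \<longleftrightarrow>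
     (\<forall>x \<in> topspace T. g x \<in> maps_from C F V Y) \<and>
     (\<forall>K \<in> \<K>. \<forall>U. openin (tot Y) U \<longrightarrow> openin T {x \<in> topspace T. g x ` K \<subseteq> U})"
  (is "?L \<longleftrightarrow> ?M \<and> ?R")
proof -
  have "?L \<longleftrightarrow> g \<in> topspace T \<rightarrow> maps_from C F V Y \<and>
    (\<forall>N. (\<exists>K \<in> \<K>. \<exists>U. openin (tot Y) U \<and> N = NKU C F V Y K U) \<longrightarrow> openin T {x \<in> topspace T. g x \<in> N})"
    using continuous_map_into_topology_subbase_eq[OF topology_from_def] by simp
  also have "\<dots> \<longleftrightarrow> ?M \<and> (\<forall>K \<in> \<K>. \<forall>U. openin (tot Y) U \<longrightarrow> openin T {x \<in> topspace T. g x \<in> NKU C F V Y K U})"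
    by auto
  also have "\<dots> \<longleftrightarrow> ?M \<and> ?R"
  proof (rule conj_cong[OF refl])
    assume M: ?M
    have "{x \<in> topspace T. g x \<in> NKU C F V Y K U} = {x \<in> topspace T. g x ` K \<subseteq> U}" for K U
      unfolding NKU_def using M by blast
    then show "(\<forall>K \<in> \<K>. \<forall>U. openin (tot Y) U \<longrightarrow> openin T {x \<in> topspace T. g x \<in> NKU C F V Y K U}) \<longleftrightarrow> ?R"
      by simp
  qed
  finally show ?thesis .
qed

lemma openin_topology_from_NKU:
  assumes "K \<in> \<K>" "openin (tot Y) U"
  shows "openin (topology_from C F V Y \<K>) {a \<in> maps_from C F V Y. a ` K \<subseteq> U}"
proof -
  have "continuous_map (topology_from C F V Y \<K>) (topology_from C F V Y \<K>) (\<lambda>x. x)" by simp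
  then show ?thesis unfolding continuous_map_into_topology_from using assms by simp
qed

text \<open>Basic neighbourhoods are indexed by \<open>j < n\<close>, so that all their conditions
  can be modified in parallel through \<open>carried\<close>.\<close>

lemma openin_topology_from_neighbourhood:
  assumes "openin (topology_from C F V Y \<K>) W" "a \<in> W"
  obtains n :: nat and K U where "\<forall>j<n. K j \<in> \<K> \<and> openin (tot Y) (U j) \<and> a ` K j \<subseteq> U j"
    "carried (maps_from C F V Y) n K U \<subseteq> W"
proof -
  let ?P = "\<lambda>N. \<exists>K \<in> \<K>. \<exists>U. openin (tot Y) U \<and> N = NKU C F V Y K U"
  have "(arbitrary union_of (finite intersection_of ?P relative_to maps_from C F V Y)) W"
    using assms(1) unfolding topology_from_def openin_subbase .
  then obtain \<U> where U: "\<U> \<subseteq> Collect (finite intersection_of ?P relative_to maps_from C F V Y)" "\<Union>\<U> = W"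
    unfolding union_of_def by (elim exE conjE)
  have "a \<in> \<Union>\<U>" using assms(2) U(2) by simp
  then obtain T where "T \<in> \<U>" and aT: "a \<in> T" by (rule UnionE)
  then have TW: "T \<subseteq> W" and "(finite intersection_of ?P relative_to maps_from C F V Y) T"
    using U by blast+
  then obtain I where I: "(finite intersection_of ?P) I" "maps_from C F V Y \<inter> I = T"
    unfolding relative_to_def by (elim exE conjE)
  then obtain \<N> where N: "finite \<N>" "\<N> \<subseteq> Collect ?P" "I = \<Inter>\<N>"
    unfolding intersection_of_def by blast
  note T = I(2)[unfolded N(3), symmetric]
  from N(1) obtain n :: nat and f where f: "\<N> = f ` {j. j < n}"
    unfolding finite_conv_nat_seg_image by (elim exE)
  have "\<forall>j. \<exists>K U. j < n \<longrightarrow> K \<in> \<K> \<and> openin (tot Y) U \<and> f j = NKU C F V Y K U"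
    using N(2) unfolding f by blast
  then obtain K U where KU: "\<And>j. j < n \<Longrightarrow> K j \<in> \<K> \<and> openin (tot Y) (U j) \<and> f j = NKU C F V Y (K j) (U j)"
    by metis
  have sub: "carried (maps_from C F V Y) n K U \<subseteq> W"
  proof
    fix x assume x: "x \<in> carried (maps_from C F V Y) n K U"
    have "x \<in> f j" if "j < n" for j using KU[OF that] x that by (simp add: NKU_def carried_def)
    moreover have "x \<in> maps_from C F V Y" using x by (simp add: carried_def)
    ultimately have "x \<in> T" unfolding T f by blast
    then show "x \<in> W" using TW by blast
  qed
  have "a ` K j \<subseteq> U j" if "j < n" for j
  proof -
    have "a \<in> f j" using aT that unfolding T f by blast
    then show ?thesis using KU[OF that] by (simp add: NKU_def)
  qed
  then show thesis using that[of n K U] KU sub by blast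
qed

lemmas continuous_map_into_function_space =
  continuous_map_into_topology_from[where \<K> = "{K. compactin (fobj F V) K}" and F = F and V = V for F V,
    folded function_space_def, unfolded Ball_def mem_Collect_eq]

lemma openin_function_space_NKU:
  assumes "compactin (fobj F V) K" "openin (tot Y) U"
  shows "openin (function_space C F V Y) {a \<in> maps_from C F V Y. a ` K \<subseteq> U}"
  unfolding function_space_def using assms by (intro openin_topology_from_NKU) auto

subsection \<open>The function space functor\<close>

text \<open>A point of \<open>F(V)\<close> is assumed so that the base point of a map out of
  \<open>V\<close> can be read off from its values; \<open>some_pt\<close> is the same choice that
  \<open>function_family\<close> makes.\<close>

locale mapping_object =
  fixes C :: "('o, 'm) category" and F :: "('o, 'm, 'f) top_functor" and V :: 'o
  assumes structured: "structure_category C F" and faithful: "faithful C F"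
    and V: "V \<in> Obj C" and nonempty: "topspace (fobj F V) \<noteq> {}"
begin

abbreviation "Fv \<equiv> hom_functor C F V"
abbreviation "pts \<equiv> topspace (fobj F V)"
abbreviation "maps Y \<equiv> maps_from C F V Y"
abbreviation "mapspace Y \<equiv> function_space C F V Y"
abbreviation "powerf Y \<equiv> function_family C F V Y"

definition some_pt :: 'f where "some_pt = (SOME v. v \<in> pts)"

lemma some_pt: "some_pt \<in> pts"
  unfolding some_pt_def using nonempty by (simp add: some_in_eq)

lemma category: "small_category C"
  using structured by (simp add: structure_category_def)

lemma hom_Obj: "f \<in> hom C A B \<Longrightarrow> A \<in> Obj C" "f \<in> hom C A B \<Longrightarrow> B \<in> Obj C"
  using category by (auto simp: small_category_def hom_def)

lemma Cmp_hom: "f \<in> hom C A B \<Longrightarrow> g \<in> hom C B D \<Longrightarrow> Cmp C g f \<in> hom C A D"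
  using category by (auto simp: small_category_def)

lemma Ide_hom: "A \<in> Obj C \<Longrightarrow> Ide C A \<in> hom C A A"
  using category by (auto simp: small_category_def)

lemma Ide_Cmp: "f \<in> hom C A B \<Longrightarrow> Cmp C (Ide C B) f = f"
  using category unfolding small_category_def by blast

lemma to_Top: "functor_to_Top C F"
  using structured by (simp add: structure_category_def)

lemma fmap_continuous: "f \<in> hom C A B \<Longrightarrow> continuous_map (fobj F A) (fobj F B) (fmap F f)"
  using to_Top by (auto simp: functor_to_Top_def)

lemma fmap_in: "f \<in> hom C A B \<Longrightarrow> x \<in> topspace (fobj F A) \<Longrightarrow> fmap F f x \<in> topspace (fobj F B)"
  using fmap_continuous by (fastforce simp: continuous_map_def)

lemma fmap_Cmp: "f \<in> hom C A B \<Longrightarrow> g \<in> hom C B D \<Longrightarrow> x \<in> topspace (fobj F A) \<Longrightarrow>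
    fmap F (Cmp C g f) x = fmap F g (fmap F f x)"
  using to_Top by (auto simp: functor_to_Top_def)

lemma fmap_inj: "f \<in> hom C A B \<Longrightarrow> g \<in> hom C A B \<Longrightarrow>
    (\<And>x. x \<in> topspace (fobj F A) \<Longrightarrow> fmap F f x = fmap F g x) \<Longrightarrow> f = g"
  using faithful unfolding faithful_def by blast

lemma Hausdorff_fobj: "A \<in> Obj C \<Longrightarrow> Hausdorff_space (fobj F A)"
  and locally_compact_fobj: "A \<in> Obj C \<Longrightarrow> locally_compact_space (fobj F A)"
  and second_countable_fobj: "A \<in> Obj C \<Longrightarrow> second_countable (fobj F A)"
  using structured by (auto simp: structure_category_def)

text \<open>Normal form of a map out of \<open>V\<close>: the base point it lies over and the
  morphism it becomes in the chart there. Continuity is left out because it is automatic, by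
  \<open>based_continuous\<close>.\<close>

definition based :: "('o, 'f, 'x, 'b) family \<Rightarrow> 'b \<Rightarrow> 'm \<Rightarrow> ('f \<Rightarrow> 'x) \<Rightarrow> bool" where
  "based Y b \<phi> a \<longleftrightarrow> b \<in> topspace (bas Y) \<and> \<phi> \<in> hom C V (fib Y b) \<and> a \<in> extensional pts \<and>
     (\<forall>v \<in> pts. a v \<in> over Y {b} \<and> chart Y b (a v) = fmap F \<phi> v)"

text \<open>As a function of \<open>\<phi>\<close> this inverts the chart of \<open>Y^V\<close> at
  \<open>b\<close>.\<close>

definition lift :: "('o, 'f, 'x, 'b) family \<Rightarrow> 'b \<Rightarrow> 'm \<Rightarrow> 'f \<Rightarrow> 'x" where
  "lift Y b \<phi> = restrict (\<lambda>v. inv_into (over Y {b}) (chart Y b) (fmap F \<phi> v)) pts"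

lemma based_lift:
  assumes "charted F Y" "b \<in> topspace (bas Y)" "\<phi> \<in> hom C V (fib Y b)"
  shows "based Y b \<phi> (lift Y b \<phi>)"
  using assms fmap_in[OF assms(3)] chartedD(4,5)[OF assms(1,2)]
  by (auto simp: based_def lift_def)

lemma based_unique:
  assumes "charted F Y" "based Y b \<phi> a" "based Y b \<phi> a'"
  shows "a = a'"
proof (rule extensionalityI)
  show "a \<in> extensional pts" "a' \<in> extensional pts" using assms by (simp_all add: based_def)
  fix v assume v: "v \<in> pts"
  have "b \<in> topspace (bas Y)" using assms(2) by (simp add: based_def)
  moreover have "a v \<in> over Y {b}" "a' v \<in> over Y {b}" "chart Y b (a v) = chart Y b (a' v)"
    using assms(2,3) v by (simp_all add: based_def)
  ultimately show "a v = a' v" using chartedD(1)[OF assms(1)] by (meson inj_onD)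
qed

text \<open>Over \<open>b\<close> the map is \<open>F(\<phi>)\<close> followed by the inverse of the
  chart, and both are continuous.\<close>

lemma based_continuous:
  assumes Y: "is_family C F Y" and a: "based Y b \<phi> a"
  shows "continuous_map (fobj F V) (tot Y) a"
proof -
  have b: "b \<in> topspace (bas Y)" and \<phi>: "\<phi> \<in> hom C V (fib Y b)" using a by (auto simp: based_def)
  have top: "topspace (subtopology (tot Y) (over Y {b})) = over Y {b}"
    using over_subset_topspace[of Y "{b}"] by auto
  obtain g where g: "homeomorphic_maps (subtopology (tot Y) (over Y {b})) (fobj F (fib Y b)) (chart Y b) g"
    using is_familyD(4)[OF Y b] homeomorphic_map_maps by blast
  then have "continuous_map (fobj F V) (subtopology (tot Y) (over Y {b})) (g \<circ> fmap F \<phi>)"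
    by (intro continuous_map_compose[OF fmap_continuous[OF \<phi>]]) (simp add: homeomorphic_maps_def)
  moreover have "(g \<circ> fmap F \<phi>) v = a v" if "v \<in> pts" for v
  proof -
    have "a v \<in> over Y {b}" "fmap F \<phi> v = chart Y b (a v)" using a that by (auto simp: based_def)
    then show ?thesis using g top by (simp add: homeomorphic_maps_def)
  qed
  ultimately have "continuous_map (fobj F V) (subtopology (tot Y) (over Y {b})) a"
    by (rule continuous_map_eq)
  then show ?thesis by (simp add: continuous_map_in_subtopology)
qed

text \<open>Reduces work with \<open>maps_from\<close> to pairs of a base point and a morphism; the
  existential base map of \<open>family_map\<close> disappears because the base of \<open>V\<close>
  is one point.\<close>

lemma maps_iff_based:
  assumes Y: "is_family C F Y"
  shows "a \<in> maps Y \<longleftrightarrow> (\<exists>b \<phi>. based Y b \<phi> a)"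
proof -
  have ch: "charted F (object_family F V)"
    by (auto simp: charted_def object_family_def over_def)
  have iff: "family_map C F (object_family F V) Y a ab \<longleftrightarrow>
      continuous_map (fobj F V) (tot Y) a \<and> ab () \<in> topspace (bas Y) \<and>
      (\<forall>v\<in>pts. prj Y (a v) = ab ()) \<and>
      (\<exists>\<phi>\<in>hom C V (fib Y (ab ())). \<forall>v\<in>pts. chart Y (ab ()) (a v) = fmap F \<phi> v)" for ab
    unfolding charted_family_map_iff[OF ch] by (simp add: object_family_def over_def)
  show ?thesis
  proof
    assume "a \<in> maps Y"
    then obtain ab where ab: "a \<in> extensional pts" "family_map C F (object_family F V) Y a ab"
      by (auto simp: maps_from_def)
    then obtain \<phi> where \<phi>: "continuous_map (fobj F V) (tot Y) a" "ab () \<in> topspace (bas Y)"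
      "\<forall>v\<in>pts. prj Y (a v) = ab ()" "\<phi> \<in> hom C V (fib Y (ab ()))" "\<forall>v\<in>pts. chart Y (ab ()) (a v) = fmap F \<phi> v"
      unfolding iff by blast
    have "based Y (ab ()) \<phi> a"
      unfolding based_def over_def using ab(1) \<phi> by (auto simp: continuous_map_def)
    then show "\<exists>b \<phi>. based Y b \<phi> a" by blast
  next
    assume "\<exists>b \<phi>. based Y b \<phi> a"
    then obtain b \<phi> where a: "based Y b \<phi> a" by blast
    have "family_map C F (object_family F V) Y a (\<lambda>_. b)"
      unfolding iff using a based_continuous[OF Y a] by (auto simp: based_def over_def)
    moreover have "a \<in> extensional pts" using a by (simp add: based_def)
    ultimately show "a \<in> maps Y" by (auto simp: maps_from_def)
  qed
qed

lemma maps_continuous: "is_family C F Y \<Longrightarrow> a \<in> maps Y \<Longrightarrow> continuous_map (fobj F V) (tot Y) a"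
  using maps_iff_based[of Y a] based_continuous[of Y _ _ a] by blast

lemma powerf_simps [simp]:
  "tot (powerf Y) = mapspace Y" "bas (powerf Y) = bas Y" "fib (powerf Y) = fib Y"
  "prj (powerf Y) a = prj Y (a some_pt)"
  by (simp_all add: function_family_def some_pt_def)

lemma based_prj: "based Y b \<phi> a \<Longrightarrow> v \<in> pts \<Longrightarrow> prj Y (a v) = b"
  by (auto simp: based_def over_def)

lemma based_prj_powerf: "based Y b \<phi> a \<Longrightarrow> prj (powerf Y) a = b"
  using based_prj some_pt by simp

text \<open>Faithfulness makes the morphism in the definite description of the chart unique.\<close>

lemma based_chart:
  assumes "based Y b \<phi> a"
  shows "chart (powerf Y) b a = \<phi>"
  unfolding function_family_def family.simps
proof (rule the_equality)
  show "\<phi> \<in> hom C V (fib Y b) \<and> (\<forall>v\<in>pts. fmap F \<phi> v = chart Y b (a v))"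
    using assms by (auto simp: based_def)
  fix \<psi> assume "\<psi> \<in> hom C V (fib Y b) \<and> (\<forall>v\<in>pts. fmap F \<psi> v = chart Y b (a v))"
  then show "\<psi> = \<phi>" using assms by (intro fmap_inj[of \<psi> V "fib Y b"]) (auto simp: based_def)
qed

lemma over_powerf_point:
  assumes "is_family C F Y"
  shows "a \<in> over (powerf Y) {b} \<longleftrightarrow> (\<exists>\<phi>. based Y b \<phi> a)"
  unfolding over_def using maps_iff_based[OF assms, of a] based_prj_powerf[of Y _ _ a]
  by (simp only: powerf_simps topspace_function_space mem_Collect_eq) blast

lemma over_powerfE:
  assumes "is_family C F Y" "a \<in> over (powerf Y) {b}"
  obtains \<phi> where "based Y b \<phi> a"
  using assms(2) unfolding over_powerf_point[OF assms(1)] by blast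

lemma over_powerf_all:
  assumes "is_family C F Y"
  shows "a \<in> over (powerf Y) U \<longleftrightarrow> (\<exists>b \<phi>. b \<in> U \<and> based Y b \<phi> a)"
  unfolding over_def using maps_iff_based[OF assms, of a] based_prj_powerf[of Y _ _ a]
  by (simp only: powerf_simps topspace_function_space mem_Collect_eq) blast

subsection \<open>The spaces of morphisms\<close>

lemma is_family_object: "W \<in> Obj C \<Longrightarrow> is_family C F (object_family F W)"
proof -
  have "subtopology (fobj F W) (over (object_family F W) {()}) = fobj F W"
    by (simp add: object_family_def over_def)
  then show "is_family C F (object_family F W)" if "W \<in> Obj C"
    using that by (auto simp: is_family_def object_family_def)
qed

lemma based_object:
  "W \<in> Obj C \<Longrightarrow> \<phi> \<in> hom C V W \<Longrightarrow> based (object_family F W) () \<phi> (restrict (fmap F \<phi>) pts)"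
  using fmap_in by (auto simp: based_def object_family_def over_def)

lemma restrict_fmap_maps:
  assumes "\<phi> \<in> hom C V W"
  shows "restrict (fmap F \<phi>) pts \<in> maps (object_family F W)"
  unfolding maps_iff_based[OF is_family_object[OF hom_Obj(2)[OF assms]]]
  using based_object[OF hom_Obj(2)[OF assms] assms] by blast

lemma topspace_fobj_Fv [simp]: "topspace (fobj Fv W) = hom C V W"
  using restrict_fmap_maps by (auto simp: hom_functor_def topspace_pullback_topology)

lemma fmap_Fv [simp]: "fmap Fv \<psi> \<phi> = Cmp C \<psi> \<phi>"
  by (simp add: hom_functor_def)

lemma image_restrict: "compactin (fobj F V) K \<Longrightarrow> restrict f pts ` K = f ` K"
  using compactin_subset_topspace by (force simp: restrict_def)

lemma continuous_map_fobj_Fv: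
  "continuous_map (fobj Fv W) (mapspace (object_family F W)) (\<lambda>\<phi>. restrict (fmap F \<phi>) pts)"
  unfolding continuous_map_def hom_functor_def
  using restrict_fmap_maps
  by (auto simp: openin_pullback_topology topspace_pullback_topology vimage_def Int_def conj_commute)

lemma openin_hom_NKU:
  assumes "compactin (fobj F V) K" "openin (fobj F W) U"
  shows "openin (fobj Fv W) {\<phi> \<in> hom C V W. fmap F \<phi> ` K \<subseteq> U}"
proof -
  have "openin (tot (object_family F W)) U" using assms by (simp add: object_family_def)
  then have "openin (fobj Fv W) {\<phi> \<in> topspace (fobj Fv W). restrict (fmap F \<phi>) pts ` K \<subseteq> U}"
    using continuous_map_fobj_Fv[of W] assms(1) unfolding continuous_map_into_function_space by blast
  then show ?thesis by (simp only: image_restrict[OF assms(1)] topspace_fobj_Fv)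
qed

lemma continuous_map_into_fobj_Fv:
  "continuous_map T (fobj Fv W) g \<longleftrightarrow>
     (\<forall>x \<in> topspace T. g x \<in> hom C V W) \<and>
     (\<forall>K U. compactin (fobj F V) K \<longrightarrow> openin (fobj F W) U \<longrightarrow>
        openin T {x \<in> topspace T. fmap F (g x) ` K \<subseteq> U})" (is "?L \<longleftrightarrow> ?R")
proof
  assume L: ?L
  then have hom: "\<forall>x \<in> topspace T. g x \<in> hom C V W" by (auto simp: continuous_map_def)
  have "openin T {x \<in> topspace T. g x \<in> {\<phi> \<in> hom C V W. fmap F \<phi> ` K \<subseteq> U}}"
    if "compactin (fobj F V) K" "openin (fobj F W) U" for K U
    using L openin_hom_NKU[OF that] by (rule openin_continuous_map_preimage)
  moreover have "{x \<in> topspace T. g x \<in> {\<phi> \<in> hom C V W. fmap F \<phi> ` K \<subseteq> U}}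
      = {x \<in> topspace T. fmap F (g x) ` K \<subseteq> U}" for K U
    using hom by blast
  ultimately show ?R using hom by simp
next
  assume R: ?R
  have "continuous_map T (mapspace (object_family F W)) (\<lambda>x. restrict (fmap F (g x)) pts)"
    unfolding continuous_map_into_function_space
  proof (intro conjI allI impI)
    show "restrict (fmap F (g x)) pts \<in> maps (object_family F W)" if "x \<in> topspace T" for x
      using R that restrict_fmap_maps by blast
    fix K U assume K: "compactin (fobj F V) K" and "openin (tot (object_family F W)) U"
    then have "openin (fobj F W) U" by (simp add: object_family_def)
    then show "openin T {x \<in> topspace T. restrict (fmap F (g x)) pts ` K \<subseteq> U}"
      unfolding image_restrict[OF K] using R K by blast
  qed
  moreover have "(\<lambda>x. restrict (fmap F (g x)) pts) = (\<lambda>\<phi>. restrict (fmap F \<phi>) pts) \<circ> g"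
    by (simp add: o_def)
  ultimately show ?L unfolding hom_functor_def top_functor.simps
    using R by (intro continuous_map_pullback') auto
qed

text \<open>The preimage of \<open>N_{K,U}\<close> is again sub-basic, with \<open>U\<close>
  replaced by its preimage under \<open>F(\<psi>)\<close>.\<close>

lemma continuous_Cmp:
  assumes "\<psi> \<in> hom C A B"
  shows "continuous_map (fobj Fv A) (fobj Fv B) (\<lambda>\<phi>. Cmp C \<psi> \<phi>)"
  unfolding continuous_map_into_fobj_Fv
proof (intro conjI allI impI ballI)
  show "Cmp C \<psi> \<phi> \<in> hom C V B" if "\<phi> \<in> topspace (fobj Fv A)" for \<phi> using that Cmp_hom assms by simp
  fix K U assume K: "compactin (fobj F V) K" and U: "openin (fobj F B) U"
  let ?U = "{x \<in> topspace (fobj F A). fmap F \<psi> x \<in> U}"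
  have "openin (fobj F A) ?U"
    using fmap_continuous[OF assms] U by (rule openin_continuous_map_preimage)
  moreover have "fmap F (Cmp C \<psi> \<phi>) ` K \<subseteq> U \<longleftrightarrow> fmap F \<phi> ` K \<subseteq> ?U" if "\<phi> \<in> hom C V A" for \<phi>
    using fmap_Cmp[OF that assms] fmap_in[OF that] compactin_subset_topspace[OF K]
    by (auto simp: image_subset_iff subset_iff)
  then have "{\<phi> \<in> topspace (fobj Fv A). fmap F (Cmp C \<psi> \<phi>) ` K \<subseteq> U} = {\<phi> \<in> hom C V A. fmap F \<phi> ` K \<subseteq> ?U}"
    by auto
  ultimately show "openin (fobj Fv A) {\<phi> \<in> topspace (fobj Fv A). fmap F (Cmp C \<psi> \<phi>) ` K \<subseteq> U}"
    using openin_hom_NKU[OF K] by simp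
qed

lemma functor_to_Top_Fv: "functor_to_Top C Fv"
  unfolding functor_to_Top_def
proof (intro conjI allI impI ballI)
  show "continuous_map (fobj Fv A) (fobj Fv B) (fmap Fv f)" if "f \<in> hom C A B" for A B f
    using continuous_Cmp[OF that] by (simp add: hom_functor_def)
  show "fmap Fv (Ide C A) x = x" if "A \<in> Obj C" "x \<in> topspace (fobj Fv A)" for A x
    using that Ide_Cmp by simp
  show "fmap Fv (Cmp C g f) x = fmap Fv g (fmap Fv f x)"
    if "f \<in> hom C A B" "g \<in> hom C B D" "x \<in> topspace (fobj Fv A)" for A B D f g x
  proof -
    have "\<forall>T U V W f g h. f \<in> hom C T U \<longrightarrow> g \<in> hom C U V \<longrightarrow> h \<in> hom C V W \<longrightarrow>
        Cmp C h (Cmp C g f) = Cmp C (Cmp C h g) f"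
      using category by (simp add: small_category_def)
    then show ?thesis using that by (metis fmap_Fv topspace_fobj_Fv)
  qed
qed

end

subsection \<open>Functoriality\<close>

context mapping_object
begin

text \<open>The map that \<open>f\<close> induces on function spaces, cut down to \<open>pts\<close>
  so that the values stay extensional.\<close>

definition post :: "('x \<Rightarrow> 'y) \<Rightarrow> ('f \<Rightarrow> 'x) \<Rightarrow> 'f \<Rightarrow> 'y" where
  "post f a = restrict (\<lambda>v. f (a v)) pts"

lemma post_apply [simp]: "v \<in> pts \<Longrightarrow> post f a v = f (a v)"
  by (simp add: post_def)

lemma post_image: "compactin (fobj F V) K \<Longrightarrow> post f a ` K = f ` a ` K"
  unfolding post_def image_image by (rule image_restrict)

lemma based_post:
  assumes a: "based X b \<phi> a" and \<psi>: "\<psi> \<in> hom C (fib X b) (fib Y c)"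
    and c: "c \<in> topspace (bas Y)"
    and f: "\<And>x. x \<in> over X {b} \<Longrightarrow> f x \<in> over Y {c} \<and> chart Y c (f x) = fmap F \<psi> (chart X b x)"
  shows "based Y c (Cmp C \<psi> \<phi>) (post f a)"
  unfolding based_def
proof (intro conjI ballI)
  have \<phi>: "\<phi> \<in> hom C V (fib X b)" using a by (simp add: based_def)
  show "c \<in> topspace (bas Y)" by (rule c)
  show "Cmp C \<psi> \<phi> \<in> hom C V (fib Y c)" using \<phi> \<psi> by (rule Cmp_hom)
  show "post f a \<in> extensional pts" by (simp add: post_def)
  fix v assume v: "v \<in> pts"
  then have "a v \<in> over X {b}" "chart X b (a v) = fmap F \<phi> v" using a by (auto simp: based_def)
  then show "post f a v \<in> over Y {c}" "chart Y c (post f a v) = fmap F (Cmp C \<psi> \<phi>) v"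
    using f v fmap_Cmp[OF \<phi> \<psi>] by auto
qed

text \<open>One \<open>\<psi>\<close> serves for all maps over \<open>b\<close>. On a fibre of the
  function family, post-composition is therefore composition with a fixed morphism, as a family map
  requires.\<close>

lemma family_map_based:
  assumes "charted F X" "family_map C F X Y f fb" "b \<in> topspace (bas X)"
  obtains \<psi> where "\<psi> \<in> hom C (fib X b) (fib Y (fb b))"
    "\<And>\<phi> a. based X b \<phi> a \<Longrightarrow> based Y (fb b) (Cmp C \<psi> \<phi>) (post f a)"
proof -
  obtain \<psi> where \<psi>: "\<psi> \<in> hom C (fib X b) (fib Y (fb b))"
      "\<forall>x \<in> over X {b}. chart Y (fb b) (f x) = fmap F \<psi> (chart X b x)"
    using assms unfolding charted_family_map_iff[OF assms(1)] by blast
  have "based Y (fb b) (Cmp C \<psi> \<phi>) (post f a)" if "based X b \<phi> a" for \<phi> a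
    using that \<psi> family_mapD(5)[OF assms(2,3)] family_map_over[OF assms(2)]
    by (intro based_post[of X b]) auto
  with \<psi>(1) show thesis by (rule that)
qed

lemma post_maps:
  assumes X: "is_family C F X" and Y: "is_family C F Y" and f: "family_map C F X Y f fb" and a: "a \<in> maps X"
  shows "post f a \<in> maps Y"
proof -
  obtain b \<phi> where b: "based X b \<phi> a" using a maps_iff_based[OF X] by blast
  then have "b \<in> topspace (bas X)" by (simp add: based_def)
  then obtain \<psi> where "based Y (fb b) (Cmp C \<psi> \<phi>) (post f a)"
    using family_map_based[OF is_familyD(2)[OF X] f] b by metis
  then show ?thesis using maps_iff_based[OF Y] by blast
qed

lemma continuous_post:
  assumes X: "is_family C F X" and Y: "is_family C F Y" and f: "family_map C F X Y f fb"
  shows "continuous_map (mapspace X) (mapspace Y) (post f)"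
  unfolding continuous_map_into_function_space
proof (intro conjI allI impI)
  show "post f a \<in> maps Y" if "a \<in> topspace (mapspace X)" for a
    using that post_maps[OF X Y f] by simp
  fix K U assume K: "compactin (fobj F V) K" and U: "openin (tot Y) U"
  let ?U = "{x \<in> topspace (tot X). f x \<in> U}"
  have "openin (tot X) ?U"
    using family_mapD(1)[OF f] U by (rule openin_continuous_map_preimage)
  moreover have "post f a ` K \<subseteq> U \<longleftrightarrow> a ` K \<subseteq> ?U" if "a \<in> maps X" for a
  proof -
    have "a ` K \<subseteq> topspace (tot X)"
      using maps_continuous[OF X that] compactin_subset_topspace[OF K] by (auto simp: continuous_map_def)
    then show ?thesis unfolding post_image[OF K] by auto
  qed
  then have "{a \<in> topspace (mapspace X). post f a ` K \<subseteq> U} = {a \<in> maps X. a ` K \<subseteq> ?U}"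
    by auto
  ultimately show "openin (mapspace X) {a \<in> topspace (mapspace X). post f a ` K \<subseteq> U}"
    using openin_function_space_NKU[OF K] by simp
qed

text \<open>Both topologies are generated by sets \<open>N_{K,U}\<close> with \<open>K\<close>
  compact. The chart of \<open>Y\<close> is a homeomorphism on the fibre, so traces of open sets of
  \<open>Y\<close> correspond to open sets of \<open>F(Y_b)\<close>, and the two sub-bases
  match.\<close>

lemma chart_powerf:
  assumes Y: "is_family C F Y" and b: "b \<in> topspace (bas Y)"
  shows "homeomorphic_maps (subtopology (mapspace Y) (over (powerf Y) {b})) (fobj Fv (fib Y b))
    (chart (powerf Y) b) (lift Y b)"
proof -
  note ch = is_familyD(2)[OF Y]
  have over: "topspace (subtopology (mapspace Y) (over (powerf Y) {b})) = over (powerf Y) {b}"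
    using over_subset_topspace[of "powerf Y" "{b}"] by auto
  have lift: "based Y b \<phi> (lift Y b \<phi>)" if "\<phi> \<in> hom C V (fib Y b)" for \<phi>
    by (rule based_lift[OF ch b that])
  show ?thesis
    unfolding homeomorphic_maps_def over
  proof (intro conjI ballI)
    show "continuous_map (subtopology (mapspace Y) (over (powerf Y) {b})) (fobj Fv (fib Y b)) (chart (powerf Y) b)"
      unfolding continuous_map_into_fobj_Fv over
    proof (intro conjI ballI allI impI)
      show "chart (powerf Y) b a \<in> hom C V (fib Y b)" if "a \<in> over (powerf Y) {b}" for a
        using over_powerfE[OF Y that] based_chart by (metis based_def)
      fix K U assume K: "compactin (fobj F V) K" and U: "openin (fobj F (fib Y b)) U"
      have "continuous_map (subtopology (tot Y) (over Y {b})) (fobj F (fib Y b)) (chart Y b)"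
        using is_familyD(4)[OF Y b] homeomorphic_imp_continuous_map by blast
      then have "openin (subtopology (tot Y) (over Y {b}))
          {x \<in> topspace (subtopology (tot Y) (over Y {b})). chart Y b x \<in> U}"
        using U by (rule openin_continuous_map_preimage)
      then obtain G where G: "openin (tot Y) G"
          "{x \<in> topspace (subtopology (tot Y) (over Y {b})). chart Y b x \<in> U} = G \<inter> over Y {b}"
        unfolding openin_subtopology by blast
      have "fmap F (chart (powerf Y) b a) ` K \<subseteq> U \<longleftrightarrow> a ` K \<subseteq> G" if a: "a \<in> over (powerf Y) {b}" for a
      proof -
        obtain \<phi> where \<phi>: "based Y b \<phi> a" by (rule over_powerfE[OF Y a])
        have "fmap F \<phi> v \<in> U \<longleftrightarrow> a v \<in> G" if "v \<in> K" for v
        proof -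
          have v: "v \<in> pts" using K that compactin_subset_topspace by blast
          then have "a v \<in> over Y {b}" "chart Y b (a v) = fmap F \<phi> v" using \<phi> by (auto simp: based_def)
          moreover have "a v \<in> {x \<in> topspace (subtopology (tot Y) (over Y {b})). chart Y b x \<in> U} \<longleftrightarrow> a v \<in> G \<inter> over Y {b}"
            unfolding G(2) ..
          ultimately show ?thesis using over_subset_topspace[of Y "{b}"] by auto
        qed
        then show ?thesis unfolding based_chart[OF \<phi>] by auto
      qed
      then have "{a \<in> over (powerf Y) {b}. fmap F (chart (powerf Y) b a) ` K \<subseteq> U}
          = {a \<in> maps Y. a ` K \<subseteq> G} \<inter> over (powerf Y) {b}"
        using over_subset_topspace[of "powerf Y" "{b}"] by auto
      then show "openin (subtopology (mapspace Y) (over (powerf Y) {b}))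
          {a \<in> over (powerf Y) {b}. fmap F (chart (powerf Y) b a) ` K \<subseteq> U}"
        by (simp only: openin_subtopology_Int openin_function_space_NKU[OF K G(1)])
    qed
    show "continuous_map (fobj Fv (fib Y b)) (subtopology (mapspace Y) (over (powerf Y) {b})) (lift Y b)"
      unfolding continuous_map_in_subtopology continuous_map_into_function_space
    proof (intro conjI allI impI)
      show "lift Y b \<phi> \<in> maps Y" if "\<phi> \<in> topspace (fobj Fv (fib Y b))" for \<phi>
        using that lift maps_iff_based[OF Y] by auto
      show "lift Y b \<in> topspace (fobj Fv (fib Y b)) \<rightarrow> over (powerf Y) {b}"
        using lift over_powerf_point[OF Y, of _ b] by fastforce
      fix K U assume K: "compactin (fobj F V) K" and U: "openin (tot Y) U"
      let ?G = "chart Y b ` (U \<inter> over Y {b})"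
      have "openin (subtopology (tot Y) (over Y {b})) (U \<inter> over Y {b})"
        using U by (auto simp: openin_subtopology)
      then have G: "openin (fobj F (fib Y b)) ?G"
        using homeomorphic_imp_open_map[OF is_familyD(4)[OF Y b]] unfolding open_map_def by blast
      have "lift Y b \<phi> ` K \<subseteq> U \<longleftrightarrow> fmap F \<phi> ` K \<subseteq> ?G" if \<phi>: "\<phi> \<in> hom C V (fib Y b)" for \<phi>
      proof -
        have "lift Y b \<phi> v \<in> U \<longleftrightarrow> fmap F \<phi> v \<in> ?G" if "v \<in> K" for v
        proof -
          have v: "v \<in> pts" using K that compactin_subset_topspace by blast
          then have 1: "lift Y b \<phi> v \<in> over Y {b}" and 2: "chart Y b (lift Y b \<phi> v) = fmap F \<phi> v"
            using lift[OF \<phi>] by (auto simp: based_def)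
          have "lift Y b \<phi> v \<in> U" if "fmap F \<phi> v \<in> ?G"
          proof -
            obtain x where "x \<in> U" "x \<in> over Y {b}" "chart Y b x = fmap F \<phi> v" using \<open>fmap F \<phi> v \<in> ?G\<close> by auto
            then show ?thesis using chartedD(1)[OF ch b] 1 2 by (metis inj_onD)
          qed
          then show ?thesis using 1 2 by (metis IntI imageI)
        qed
        then show ?thesis by blast
      qed
      then have "{\<phi> \<in> topspace (fobj Fv (fib Y b)). lift Y b \<phi> ` K \<subseteq> U} = {\<phi> \<in> hom C V (fib Y b). fmap F \<phi> ` K \<subseteq> ?G}"
        unfolding topspace_fobj_Fv by blast
      then show "openin (fobj Fv (fib Y b)) {\<phi> \<in> topspace (fobj Fv (fib Y b)). lift Y b \<phi> ` K \<subseteq> U}"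
        using openin_hom_NKU[OF K G] by simp
    qed
    show "lift Y b (chart (powerf Y) b a) = a" if a: "a \<in> over (powerf Y) {b}" for a
    proof -
      obtain \<phi> where \<phi>: "based Y b \<phi> a" by (rule over_powerfE[OF Y a])
      then have "\<phi> \<in> hom C V (fib Y b)" by (simp add: based_def)
      then show ?thesis unfolding based_chart[OF \<phi>] using based_unique[OF ch _ \<phi>] lift by blast
    qed
    show "chart (powerf Y) b (lift Y b \<phi>) = \<phi>" if "\<phi> \<in> topspace (fobj Fv (fib Y b))" for \<phi>
      using that based_chart[OF lift] by simp
  qed
qed

text \<open>The projection is evaluation at \<open>some_pt\<close> followed by the projection of
  \<open>Y\<close>. A one-point set is compact, so the preimage of an open set of the base is
  sub-basic.\<close>

lemma is_family_powerf:
  assumes Y: "is_family C F Y"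
  shows "is_family C Fv (powerf Y)"
  unfolding is_family_def
proof (intro conjI ballI)
  have "openin (mapspace Y) {a \<in> topspace (mapspace Y). prj Y (a some_pt) \<in> G}" if G: "openin (bas Y) G" for G
  proof -
    have "prj Y (a some_pt) \<in> G \<longleftrightarrow> a ` {some_pt} \<subseteq> over Y G" if "a \<in> maps Y" for a
      using maps_continuous[OF Y that] some_pt by (auto simp: over_def continuous_map_def)
    then have "{a \<in> topspace (mapspace Y). prj Y (a some_pt) \<in> G} = {a \<in> maps Y. a ` {some_pt} \<subseteq> over Y G}"
      by auto
    then show ?thesis
      using openin_function_space_NKU[of F V "{some_pt}", OF _ openin_over[OF Y G]] some_pt by simp
  qed
  moreover have "prj Y (a some_pt) \<in> topspace (bas Y)" if "a \<in> maps Y" for a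
    using maps_continuous[OF Y that] some_pt is_familyD(5)[OF Y] by (auto simp: continuous_map_def)
  ultimately show "continuous_map (tot (powerf Y)) (bas (powerf Y)) (prj (powerf Y))"
    by (auto simp: continuous_map_def)
next
  fix b assume b: "b \<in> topspace (bas (powerf Y))"
  then show "fib (powerf Y) b \<in> Obj C" using is_familyD(3)[OF Y] by simp
  show "homeomorphic_map (subtopology (tot (powerf Y)) (over (powerf Y) {b})) (fobj Fv (fib (powerf Y) b)) (chart (powerf Y) b)"
    using homeomorphic_maps_imp_map[OF chart_powerf[OF Y, of b]] b by simp
qed

lemma family_map_powerf:
  assumes X: "is_family C F X" and Y: "is_family C F Y" and f: "family_map C F X Y f fb"
  shows "family_map C Fv (powerf X) (powerf Y) (post f) fb"
  unfolding charted_family_map_iff[OF is_familyD(2)[OF is_family_powerf[OF X]]]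
proof (intro conjI ballI)
  show "continuous_map (tot (powerf X)) (tot (powerf Y)) (post f)"
    using continuous_post[OF X Y f] by simp
  show "continuous_map (bas (powerf X)) (bas (powerf Y)) fb"
    using family_mapD(2)[OF f] by simp
  show "prj (powerf Y) (post f a) = fb (prj (powerf X) a)" if "a \<in> topspace (tot (powerf X))" for a
  proof -
    have "a some_pt \<in> topspace (tot X)"
      using maps_continuous[OF X] that some_pt by (auto simp: continuous_map_def)
    then show ?thesis using some_pt family_mapD(3)[OF f] by simp
  qed
  fix b assume "b \<in> topspace (bas (powerf X))"
  then have "b \<in> topspace (bas X)" by simp
  then obtain \<psi> where \<psi>: "\<psi> \<in> hom C (fib X b) (fib Y (fb b))"
    "\<And>\<phi> a. based X b \<phi> a \<Longrightarrow> based Y (fb b) (Cmp C \<psi> \<phi>) (post f a)"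
    using family_map_based[OF is_familyD(2)[OF X] f] by blast
  have "chart (powerf Y) (fb b) (post f a) = fmap Fv \<psi> (chart (powerf X) b a)" if a: "a \<in> over (powerf X) {b}" for a
  proof -
    obtain \<phi> where \<phi>: "based X b \<phi> a" by (rule over_powerfE[OF X a])
    show ?thesis using based_chart[OF \<phi>] based_chart[OF \<psi>(2)[OF \<phi>]] by simp
  qed
  then show "\<exists>\<psi>\<in>hom C (fib (powerf X) b) (fib (powerf Y) (fb b)).
      \<forall>a\<in>over (powerf X) {b}. chart (powerf Y) (fb b) (post f a) = fmap Fv \<psi> (chart (powerf X) b a)"
    using \<psi>(1) by auto
qed

lemma post_post:
  assumes X: "is_family C F X" and a: "a \<in> maps X"
    and g: "\<And>x. x \<in> topspace (tot X) \<Longrightarrow> g (f x) = x"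
  shows "post g (post f a) = a"
proof (rule extensionalityI)
  show "post g (post f a) \<in> extensional pts" by (simp add: post_def)
  show "a \<in> extensional pts" using a by (simp add: maps_from_def)
  show "post g (post f a) v = a v" if "v \<in> pts" for v
    using that g maps_continuous[OF X a] by (auto simp: continuous_map_def)
qed

lemma family_iso_powerf:
  assumes X: "is_family C F X" and Y: "is_family C F Y" and f: "family_iso C F X Y f fb"
  shows "family_iso C Fv (powerf X) (powerf Y) (post f) fb"
proof -
  obtain g gb where g: "family_map C F X Y f fb" "family_map C F Y X g gb"
    "\<forall>x\<in>topspace (tot X). g (f x) = x" "\<forall>y\<in>topspace (tot Y). f (g y) = y"
    "\<forall>b\<in>topspace (bas X). gb (fb b) = b" "\<forall>c\<in>topspace (bas Y). fb (gb c) = c"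
    using f unfolding family_iso_def by blast
  have "\<forall>a\<in>topspace (tot (powerf X)). post g (post f a) = a"
    using post_post[OF X, of _ g f] g(3) by simp
  moreover have "\<forall>a\<in>topspace (tot (powerf Y)). post f (post g a) = a"
    using post_post[OF Y, of _ f g] g(4) by simp
  ultimately show ?thesis
    unfolding family_iso_def
    using family_map_powerf[OF X Y g(1)] family_map_powerf[OF Y X g(2)] g(5,6)
    by (intro conjI exI[of _ "post g"] exI[of _ gb]) auto
qed

lemma based_restr:
  "based (restr_family Y U) b \<phi> a \<longleftrightarrow> b \<in> U \<and> based Y b \<phi> a"
  by (auto simp: based_def over_restr_point)

lemma maps_restr:
  assumes Y: "is_family C F Y"
  shows "maps (restr_family Y U) = over (powerf Y) U"
  using maps_iff_based[OF is_family_restr[OF Y]] over_powerf_all[OF Y] by (auto simp: based_restr)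

text \<open>The two families are equal, not merely isomorphic, because \<open>restr_family\<close>
  keeps a subspace of the total space. Function families therefore commute with the stages of the
  filtration by plain rewriting.\<close>

lemma restr_powerf:
  assumes Y: "is_family C F Y"
  shows "restr_family (powerf Y) U = powerf (restr_family Y U)"
proof -
  let ?R = "restr_family Y U"
  note R = is_family_restr[OF Y, of U]
  have maps: "maps ?R = over (powerf Y) U" by (rule maps_restr[OF Y])
  have sub: "over (powerf Y) U \<subseteq> maps Y" using over_subset_topspace[of "powerf Y"] by simp
  have "subtopology (mapspace Y) (over (powerf Y) U) = mapspace ?R" (is "?S = ?T")
  proof -
    have top: "topspace ?S = maps ?R" using maps sub by auto
    have "continuous_map ?S ?T (\<lambda>a. a)"
      unfolding continuous_map_into_function_space top
    proof (intro conjI allI impI)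
      fix K G assume K: "compactin (fobj F V) K" and G: "openin (tot ?R) G"
      then obtain G' where G': "openin (tot Y) G'" "G = G' \<inter> over Y U" by (auto simp: openin_subtopology)
      have "a ` K \<subseteq> over Y U" if "a \<in> maps ?R" for a
        using maps_continuous[OF R that] compactin_subset_topspace[OF K] by (auto simp: continuous_map_def)
      then have "{a \<in> maps ?R. a ` K \<subseteq> G} = {a \<in> maps Y. a ` K \<subseteq> G'} \<inter> over (powerf Y) U"
        unfolding G' maps using sub by blast
      then show "openin ?S {a \<in> maps ?R. a ` K \<subseteq> G}"
        by (simp only: openin_subtopology_Int openin_function_space_NKU[OF K G'(1)])
    qed
    moreover have "continuous_map ?T ?S (\<lambda>a. a)"
      unfolding continuous_map_in_subtopology continuous_map_into_function_space topspace_function_space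
    proof (intro conjI allI impI)
      show "a \<in> maps Y" if "a \<in> maps ?R" for a using that maps sub by blast
      show "(\<lambda>a. a) \<in> maps ?R \<rightarrow> over (powerf Y) U" using maps by blast
      fix K G assume K: "compactin (fobj F V) K" and G: "openin (tot Y) G"
      have op: "openin (tot ?R) (G \<inter> over Y U)" using G by (auto simp: openin_subtopology)
      have "a ` K \<subseteq> over Y U" if "a \<in> maps ?R" for a
        using maps_continuous[OF R that] compactin_subset_topspace[OF K] by (auto simp: continuous_map_def)
      then have eq: "{a \<in> maps ?R. a ` K \<subseteq> G} = {a \<in> maps ?R. a ` K \<subseteq> G \<inter> over Y U}" by blast
      show "openin ?T {a \<in> maps ?R. a ` K \<subseteq> G}"
        unfolding eq by (rule openin_function_space_NKU[OF K op])
    qed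
    ultimately have "homeomorphic_maps ?S ?T id id" by (simp add: homeomorphic_maps_def id_def)
    then show ?thesis by (simp add: homeomorphic_maps_id)
  qed
  then show ?thesis
    by (simp add: function_family_def restr_family_def)
qed

section \<open>Function families of product families\<close>

lemma is_family_product:
  assumes "W \<in> Obj C"
  shows "is_family C F (product_family F B W)"
  unfolding is_family_def
proof (intro conjI ballI)
  show "continuous_map (tot (product_family F B W)) (bas (product_family F B W)) (prj (product_family F B W))"
    by (simp add: product_family_def continuous_map_fst)
  fix b assume b: "b \<in> topspace (bas (product_family F B W))"
  show "fib (product_family F B W) b \<in> Obj C" using assms by (simp add: product_family_def)
  have over: "over (product_family F B W) {b} = {b} \<times> topspace (fobj F W)"
    using b by (auto simp: over_def product_family_def)
  have "homeomorphic_maps (subtopology (prod_topology B (fobj F W)) ({b} \<times> topspace (fobj F W))) (fobj F W) snd (Pair b)"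
    unfolding homeomorphic_maps_def
    using b by (auto simp: continuous_map_in_subtopology continuous_map_pairwise o_def product_family_def
        intro: continuous_map_from_subtopology continuous_map_snd)
  then show "homeomorphic_map (subtopology (tot (product_family F B W)) (over (product_family F B W) {b}))
      (fobj F (fib (product_family F B W) b)) (chart (product_family F B W) b)"
    unfolding over using homeomorphic_maps_map by (auto simp: product_family_def)
qed

lemma based_product:
  "based (product_family F B W) b \<phi> a \<longleftrightarrow>
     b \<in> topspace B \<and> \<phi> \<in> hom C V W \<and> a = restrict (\<lambda>v. (b, fmap F \<phi> v)) pts"
proof
  assume L: "based (product_family F B W) b \<phi> a"
  then have "a \<in> extensional pts" by (simp add: based_def)
  moreover have "a v = (b, fmap F \<phi> v)" if "v \<in> pts" for v
    using L that by (auto simp: based_def over_def product_family_def prod_eq_iff)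
  ultimately have "a = restrict (\<lambda>v. (b, fmap F \<phi> v)) pts" by (intro extensionalityI[of _ pts]) auto
  then show "b \<in> topspace B \<and> \<phi> \<in> hom C V W \<and> a = restrict (\<lambda>v. (b, fmap F \<phi> v)) pts"
    using L by (simp add: based_def product_family_def)
next
  assume "b \<in> topspace B \<and> \<phi> \<in> hom C V W \<and> a = restrict (\<lambda>v. (b, fmap F \<phi> v)) pts"
  then show "based (product_family F B W) b \<phi> a"
    using fmap_in by (auto simp: based_def over_def product_family_def)
qed

text \<open>A map into \<open>B \<times> W\<close> over \<open>b\<close> is
  \<open>v \<mapsto> (b, F(\<phi>) v)\<close>, and the isomorphism sends it to
  \<open>(b, \<phi>)\<close>. The delicate point is continuity of the inverse: an open set
  \<open>G\<close> around the compact set of values need not be a product, and the tube lemma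
  supplies a product inside it.\<close>

lemma powerf_product:
  fixes B :: "'b topology"
  assumes W: "W \<in> Obj C"
  shows "family_iso C Fv (powerf (product_family F B W)) (product_family Fv B W)
    (\<lambda>a. (fst (a some_pt), chart (powerf (product_family F B W)) (fst (a some_pt)) a)) id"
    (is "family_iso C Fv (powerf ?P) ?Q ?f id")
proof -
  note P = is_family_product[OF W, of B]
  let ?g = "\<lambda>(b, \<phi>). restrict (\<lambda>v. (b, fmap F \<phi> v)) pts"
  have maps: "a \<in> maps ?P \<longleftrightarrow> (\<exists>b \<phi>. b \<in> topspace B \<and> \<phi> \<in> hom C V W \<and> a = ?g (b, \<phi>))" for a
    unfolding maps_iff_based[OF P] based_product by simp
  have f_g: "?f (?g (b, \<phi>)) = (b, \<phi>)" if "b \<in> topspace B" "\<phi> \<in> hom C V W" for b \<phi>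
  proof -
    have "based ?P b \<phi> (?g (b, \<phi>))" using that by (simp add: based_product)
    then show ?thesis using based_chart some_pt by auto
  qed
  have chQ: "charted Fv ?Q"
    by (auto simp: charted_def product_family_def over_def bij_betw_def inj_on_def image_iff)
  have 1: "family_map C Fv (powerf ?P) ?Q ?f id"
    unfolding charted_family_map_iff[OF is_familyD(2)[OF is_family_powerf[OF P]]]
  proof (intro conjI ballI)
    have "continuous_map (mapspace ?P) B (prj (powerf ?P))"
      using is_familyD(1)[OF is_family_powerf[OF P]] by (simp add: product_family_def)
    then have c1: "continuous_map (mapspace ?P) B (\<lambda>a. fst (a some_pt))"
      by (rule continuous_map_eq) (simp add: product_family_def)
    have c2: "continuous_map (mapspace ?P) (fobj Fv W) (\<lambda>a. snd (?f a))"
      unfolding continuous_map_into_fobj_Fv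
    proof (intro conjI ballI allI impI)
      show "snd (?f a) \<in> hom C V W" if "a \<in> topspace (mapspace ?P)" for a
        using that f_g unfolding topspace_function_space maps by fastforce
      fix K U assume K: "compactin (fobj F V) K" and U: "openin (fobj F W) U"
      have "fmap F (snd (?f a)) ` K \<subseteq> U \<longleftrightarrow> a ` K \<subseteq> topspace B \<times> U" if aP: "a \<in> maps ?P" for a
      proof -
        obtain b \<phi> where a: "b \<in> topspace B" "\<phi> \<in> hom C V W" "a = ?g (b, \<phi>)"
          using aP unfolding maps by (elim exE conjE)
        have "a ` K = (\<lambda>v. (b, fmap F \<phi> v)) ` K" unfolding a(3) prod.case by (rule image_restrict[OF K])
        moreover have "?f a = (b, \<phi>)" unfolding a(3) by (rule f_g[OF a(1,2)])
        then have "snd (?f a) = snd (b, \<phi>)" by (rule arg_cong)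
        then have "snd (?f a) = \<phi>" by (simp only: snd_conv)
        ultimately show ?thesis using a(1) by (simp add: image_subset_iff)
      qed
      then have eq: "{a \<in> topspace (mapspace ?P). fmap F (snd (?f a)) ` K \<subseteq> U} = {a \<in> maps ?P. a ` K \<subseteq> topspace B \<times> U}"
        by auto
      have "openin (tot ?P) (topspace B \<times> U)"
        using U by (simp add: product_family_def openin_prod_Times_iff)
      from openin_function_space_NKU[OF K this]
      show "openin (mapspace ?P) {a \<in> topspace (mapspace ?P). fmap F (snd (?f a)) ` K \<subseteq> U}"
        unfolding eq .
    qed
    show "continuous_map (tot (powerf ?P)) (tot ?Q) ?f"
      using c1 c2 by (simp add: product_family_def continuous_map_pairwise o_def)
    show "continuous_map (bas (powerf ?P)) (bas ?Q) id" by (simp add: product_family_def)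
    show "prj ?Q (?f a) = id (prj (powerf ?P) a)" for a by (simp add: product_family_def)
    fix b assume "b \<in> topspace (bas (powerf ?P))"
    have "chart ?Q b (?f a) = Cmp C (Ide C W) (chart (powerf ?P) b a)" if aP: "a \<in> over (powerf ?P) {b}" for a
    proof -
      have ab: "fst (a some_pt) = b" using aP by (auto simp: over_def product_family_def)
      obtain \<phi> where "based ?P b \<phi> a" by (rule over_powerfE[OF P aP])
      then have "chart (powerf ?P) b a \<in> hom C V W" by (auto simp: based_chart based_product)
      then show ?thesis using ab Ide_Cmp by (simp add: product_family_def)
    qed
    then show "\<exists>\<psi>\<in>hom C (fib (powerf ?P) b) (fib ?Q (id b)).
        \<forall>a\<in>over (powerf ?P) {b}. chart ?Q (id b) (?f a) = fmap Fv \<psi> (chart (powerf ?P) b a)"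
      using Ide_hom[OF W] by (intro bexI[of _ "Ide C W"]) (auto simp: product_family_def)
  qed
  have 2: "family_map C Fv ?Q (powerf ?P) ?g id"
    unfolding charted_family_map_iff[OF chQ]
  proof (intro conjI ballI)
    show "continuous_map (bas ?Q) (bas (powerf ?P)) id" by (simp add: product_family_def)
    have "continuous_map (prod_topology B (fobj Fv W)) (mapspace ?P) ?g"
      unfolding continuous_map_into_function_space
    proof (intro conjI allI impI)
      show "?g x \<in> maps ?P" if "x \<in> topspace (prod_topology B (fobj Fv W))" for x
        using that unfolding maps by auto
      fix K G assume K: "compactin (fobj F V) K" and G: "openin (tot ?P) G"
      let ?S = "{x \<in> topspace (prod_topology B (fobj Fv W)). ?g x ` K \<subseteq> G}"
      have "\<exists>T. openin (prod_topology B (fobj Fv W)) T \<and> x \<in> T \<and> T \<subseteq> ?S" if x: "x \<in> ?S" for x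
      proof -
        obtain b \<phi> where x': "x = (b, \<phi>)" by fastforce
        have b: "b \<in> topspace B" and \<phi>: "\<phi> \<in> hom C V W" using x by (auto simp: x')
        have im: "?g (c, \<theta>) ` K = {c} \<times> fmap F \<theta> ` K" for c :: 'b and \<theta>
          unfolding prod.case image_restrict[OF K] by auto
        have "?g (b, \<phi>) ` K \<subseteq> G" using x unfolding x' by (elim CollectE conjE)
        then have "{b} \<times> fmap F \<phi> ` K \<subseteq> G" unfolding im .
        moreover have "compactin (fobj F W) (fmap F \<phi> ` K)"
          using K fmap_continuous[OF \<phi>] by (rule image_compactin)
        moreover have "openin (prod_topology B (fobj F W)) G" using G by (simp add: product_family_def)
        ultimately obtain U T where UT: "openin B U" "openin (fobj F W) T" "b \<in> U" "fmap F \<phi> ` K \<subseteq> T" "U \<times> T \<subseteq> G"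
          using tube_lemma_right b by metis
        let ?T = "U \<times> {\<phi> \<in> hom C V W. fmap F \<phi> ` K \<subseteq> T}"
        have "openin (prod_topology B (fobj Fv W)) ?T"
          using UT(1) openin_hom_NKU[OF K UT(2)] by (simp add: openin_prod_Times_iff)
        moreover have "x \<in> ?T" using UT \<phi> by (auto simp: x')
        moreover have "?T \<subseteq> ?S"
        proof
          fix y assume "y \<in> ?T"
          then obtain c \<theta> where y: "y = (c, \<theta>)" "c \<in> U" "\<theta> \<in> hom C V W" "fmap F \<theta> ` K \<subseteq> T" by auto
          then have "?g y ` K \<subseteq> G" unfolding y(1) im using UT(5) by blast
          moreover have "c \<in> topspace B" using y(2) openin_subset[OF UT(1)] by blast
          ultimately show "y \<in> ?S" using y by simp
        qed
        ultimately show ?thesis by blast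
      qed
      then show "openin (prod_topology B (fobj Fv W)) ?S"
        using openin_subopen[of _ ?S] by blast
    qed
    then show "continuous_map (tot ?Q) (tot (powerf ?P)) ?g" by (simp add: product_family_def)
    show "prj (powerf ?P) (?g x) = id (prj ?Q x)" for x
      using some_pt by (simp add: product_family_def split: prod.splits)
    fix b assume "b \<in> topspace (bas ?Q)"
    then have b: "b \<in> topspace B" by (simp add: product_family_def)
    have "chart (powerf ?P) b (?g x) = Cmp C (Ide C W) (chart ?Q b x)" if x: "x \<in> over ?Q {b}" for x
    proof -
      obtain \<phi> where x': "x = (b, \<phi>)" "\<phi> \<in> hom C V W" using x by (auto simp: over_def product_family_def)
      have "based ?P b \<phi> (?g x)" using x' b by (simp add: based_product)
      then show ?thesis using based_chart x' Ide_Cmp by (simp add: product_family_def)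
    qed
    then show "\<exists>\<psi>\<in>hom C (fib ?Q b) (fib (powerf ?P) (id b)).
        \<forall>x\<in>over ?Q {b}. chart (powerf ?P) (id b) (?g x) = fmap Fv \<psi> (chart ?Q b x)"
      using Ide_hom[OF W] by (intro bexI[of _ "Ide C W"]) (auto simp: product_family_def)
  qed
  have "\<forall>a\<in>topspace (tot (powerf ?P)). ?g (?f a) = a"
  proof
    fix a assume "a \<in> topspace (tot (powerf ?P))"
    then obtain b \<phi> where a: "b \<in> topspace B" "\<phi> \<in> hom C V W" "a = ?g (b, \<phi>)"
      unfolding powerf_simps topspace_function_space maps by (elim exE conjE)
    show "?g (?f a) = a" unfolding a(3) f_g[OF a(1,2)] ..
  qed
  moreover have "\<forall>x\<in>topspace (tot ?Q). ?f (?g x) = x"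
  proof
    fix x assume "x \<in> topspace (tot ?Q)"
    then obtain b \<phi> where x: "x = (b, \<phi>)" "b \<in> topspace B" "\<phi> \<in> hom C V W"
      by (auto simp: product_family_def)
    show "?f (?g x) = x" unfolding x(1) by (rule f_g[OF x(2,3)])
  qed
  ultimately show ?thesis
    unfolding family_iso_def using 1 2 by (intro conjI exI[of _ ?g] exI[of _ id]) auto
qed

end

section \<open>Composition of family maps and isomorphisms\<close>

lemma family_map_compose:
  assumes C: "small_category C" and G: "functor_to_Top C G"
    and X: "charted G X" and Y: "charted G Y"
    and f: "family_map C G X Y f fb" and g: "family_map C G Y Z g gb"
  shows "family_map C G X Z (g \<circ> f) (gb \<circ> fb)"
  unfolding charted_family_map_iff[OF X]
proof (intro conjI ballI)
  show "continuous_map (tot X) (tot Z) (g \<circ> f)"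
    using family_mapD(1)[OF f] family_mapD(1)[OF g] by (rule continuous_map_compose)
  show "continuous_map (bas X) (bas Z) (gb \<circ> fb)"
    using family_mapD(2)[OF f] family_mapD(2)[OF g] by (rule continuous_map_compose)
  show "prj Z ((g \<circ> f) x) = (gb \<circ> fb) (prj X x)" if "x \<in> topspace (tot X)" for x
    using family_mapD(3)[OF f that] family_mapD(3)[OF g family_mapD(4)[OF f that]] by simp
  fix b assume b: "b \<in> topspace (bas X)"
  obtain \<phi> where \<phi>: "\<phi> \<in> hom C (fib X b) (fib Y (fb b))"
      "\<forall>x\<in>over X {b}. chart Y (fb b) (f x) = fmap G \<phi> (chart X b x)"
    using f b unfolding charted_family_map_iff[OF X] by blast
  obtain \<psi> where \<psi>: "\<psi> \<in> hom C (fib Y (fb b)) (fib Z (gb (fb b)))"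
      "\<forall>y\<in>over Y {fb b}. chart Z (gb (fb b)) (g y) = fmap G \<psi> (chart Y (fb b) y)"
    using g family_mapD(5)[OF f b] unfolding charted_family_map_iff[OF Y] by blast
  show "\<exists>\<theta>\<in>hom C (fib X b) (fib Z ((gb \<circ> fb) b)).
      \<forall>x\<in>over X {b}. chart Z ((gb \<circ> fb) b) ((g \<circ> f) x) = fmap G \<theta> (chart X b x)"
  proof (intro bexI[of _ "Cmp C \<psi> \<phi>"] ballI)
    show "Cmp C \<psi> \<phi> \<in> hom C (fib X b) (fib Z ((gb \<circ> fb) b))"
      using C \<phi>(1) \<psi>(1) by (auto simp: small_category_def)
    fix x assume x: "x \<in> over X {b}"
    have "fmap G (Cmp C \<psi> \<phi>) z = fmap G \<psi> (fmap G \<phi> z)" if "z \<in> topspace (fobj G (fib X b))" for z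
      using G \<phi>(1) \<psi>(1) that by (auto simp: functor_to_Top_def)
    then show "chart Z ((gb \<circ> fb) b) ((g \<circ> f) x) = fmap G (Cmp C \<psi> \<phi>) (chart X b x)"
      using \<phi>(2) \<psi>(2) x family_map_over[OF f x] chartedD(2)[OF X b x] by simp
  qed
qed

lemma family_iso_compose:
  assumes C: "small_category C" and G: "functor_to_Top C G"
    and X: "charted G X" and Y: "charted G Y" and Z: "charted G Z"
    and f: "family_iso C G X Y f fb" and g: "family_iso C G Y Z g gb"
  shows "family_iso C G X Z (g \<circ> f) (gb \<circ> fb)"
proof -
  obtain f' fb' where f': "family_map C G X Y f fb" "family_map C G Y X f' fb'"
    "\<forall>x\<in>topspace (tot X). f' (f x) = x" "\<forall>y\<in>topspace (tot Y). f (f' y) = y"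
    "\<forall>b\<in>topspace (bas X). fb' (fb b) = b" "\<forall>c\<in>topspace (bas Y). fb (fb' c) = c"
    using f unfolding family_iso_def by blast
  obtain g' gb' where g': "family_map C G Y Z g gb" "family_map C G Z Y g' gb'"
    "\<forall>x\<in>topspace (tot Y). g' (g x) = x" "\<forall>y\<in>topspace (tot Z). g (g' y) = y"
    "\<forall>b\<in>topspace (bas Y). gb' (gb b) = b" "\<forall>c\<in>topspace (bas Z). gb (gb' c) = c"
    using g unfolding family_iso_def by blast
  show ?thesis
    unfolding family_iso_def
  proof (intro conjI exI[of _ "f' \<circ> g'"] exI[of _ "fb' \<circ> gb'"] ballI)
    show "family_map C G X Z (g \<circ> f) (gb \<circ> fb)"
      using family_map_compose[OF C G X Y f'(1) g'(1)] .
    show "family_map C G Z X (f' \<circ> g') (fb' \<circ> gb')"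
      using family_map_compose[OF C G Z Y g'(2) f'(2)] .
  qed (use f' g' family_mapD(4,5)[OF f'(1)] family_mapD(4,5)[OF g'(2)] in auto)
qed

lemma charted_product: "charted G (product_family G B W)"
  by (auto simp: charted_def product_family_def over_def bij_betw_def inj_on_def image_iff)

lemma is_bundleD:
  assumes "is_bundle C F X"
  shows "is_family C F X"
    and "b \<in> topspace (bas X) \<Longrightarrow> \<exists>U W f fb. U \<subseteq> topspace (bas X) \<and> b \<in> bas X interior_of U \<and>
       W \<in> Obj C \<and> family_iso C F (restr_family X U) (product_family F (subtopology (bas X) U) W) f fb"
  using assms unfolding is_bundle_def by blast+

context mapping_object
begin

text \<open>Besides the trivialisation \<open>g\<close> of the function family its effect on maps is
  recorded: \<open>g a\<close> consists of the base point and the morphism of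
  \<open>post f a\<close>. The compactness of sets of maps over a chart is derived from this
  formula.\<close>

lemma family_iso_powerf_product:
  fixes B :: "'c topology"
  assumes X: "is_family C F X" and W: "W \<in> Obj C"
    and f: "family_iso C F X (product_family F B W) f fb"
  obtains g where "family_iso C Fv (powerf X) (product_family Fv B W) g fb"
    "\<forall>b \<phi> a. based X b \<phi> a \<longrightarrow>
       (\<exists>\<psi>. based (product_family F B W) (fb b) \<psi> (post f a) \<and> g a = (fb b, \<psi>))"
proof -
  let ?P = "product_family F B W"
  let ?h = "\<lambda>a. (fst (a some_pt), chart (powerf ?P) (fst (a some_pt)) a)"
  note P = is_family_product[OF W, of B]
  have "family_iso C Fv (powerf X) (product_family Fv B W) (?h \<circ> post f) (id \<circ> fb)"
    by (rule family_iso_compose[OF category functor_to_Top_Fv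
        is_familyD(2)[OF is_family_powerf[OF X]] is_familyD(2)[OF is_family_powerf[OF P]] charted_product
        family_iso_powerf[OF X P f] powerf_product[OF W]])
  then have 1: "family_iso C Fv (powerf X) (product_family Fv B W) (?h \<circ> post f) fb" by simp
  have 2: "\<exists>\<psi>. based ?P (fb b) \<psi> (post f a) \<and> (?h \<circ> post f) a = (fb b, \<psi>)"
    if a: "based X b \<phi> a" for b \<phi> a
  proof -
    have b: "b \<in> topspace (bas X)" using a by (simp add: based_def)
    have "family_map C F X ?P f fb" using f by (simp add: family_iso_def)
    then obtain \<psi> where "based ?P (fb b) (Cmp C \<psi> \<phi>) (post f a)"
      using family_map_based[OF is_familyD(2)[OF X] _ b] a by metis
    note \<psi> = this
    have "fst (post f a some_pt) = fb b"
      using based_prj[OF \<psi> some_pt] by (simp add: product_family_def)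
    then have "(?h \<circ> post f) a = (fb b, Cmp C \<psi> \<phi>)" using based_chart[OF \<psi>] by simp
    with \<psi> show ?thesis by blast
  qed
  show thesis by (rule that[OF 1]) (use 2 in blast)
qed

text \<open>The same neighbourhoods trivialise, with fibre \<open>W^V\<close> in place of
  \<open>W\<close>.\<close>

lemma is_bundle_powerf:
  assumes X: "is_bundle C F X"
  shows "is_bundle C Fv (powerf X)"
  unfolding is_bundle_def
proof (intro conjI ballI)
  note Xf = is_bundleD(1)[OF X]
  show "is_family C Fv (powerf X)" by (rule is_family_powerf[OF Xf])
  fix b assume "b \<in> topspace (bas (powerf X))"
  then have "b \<in> topspace (bas X)" by simp
  from is_bundleD(2)[OF X this]
  obtain U W f fb where U: "U \<subseteq> topspace (bas X)" "b \<in> bas X interior_of U" "W \<in> Obj C"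
    "family_iso C F (restr_family X U) (product_family F (subtopology (bas X) U) W) f fb"
    by (elim exE conjE)
  obtain g where "family_iso C Fv (powerf (restr_family X U)) (product_family Fv (subtopology (bas X) U) W) g fb"
    by (rule family_iso_powerf_product[OF is_family_restr[OF Xf] U(3,4)])
  then have "family_iso C Fv (restr_family (powerf X) U) (product_family Fv (subtopology (bas (powerf X)) U) W) g fb"
    by (simp add: restr_powerf[OF Xf])
  then show "\<exists>U\<subseteq>topspace (bas (powerf X)). b \<in> bas (powerf X) interior_of U \<and>
      (\<exists>W\<in>Obj C. \<exists>f fb. family_iso C Fv (restr_family (powerf X) U)
         (product_family Fv (subtopology (bas (powerf X)) U) W) f fb)"
    using U(1-3) by auto
qed

subsection \<open>Topological properties of the spaces of morphisms\<close>

text \<open>Distinct morphisms differ at a point \<open>v\<close> by faithfulness. Disjoint open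
  sets \<open>P\<close>, \<open>Q\<close> around the two values give the disjoint sets
  \<open>N_{{v},P}\<close> and \<open>N_{{v},Q}\<close>.\<close>

lemma Hausdorff_fobj_Fv:
  assumes W: "W \<in> Obj C"
  shows "Hausdorff_space (fobj Fv W)"
  unfolding Hausdorff_space_def
proof (intro allI impI)
  fix \<phi> \<psi> assume "\<phi> \<in> topspace (fobj Fv W) \<and> \<psi> \<in> topspace (fobj Fv W) \<and> \<phi> \<noteq> \<psi>"
  then have h: "\<phi> \<in> hom C V W" "\<psi> \<in> hom C V W" "\<phi> \<noteq> \<psi>" by auto
  then obtain v where v: "v \<in> pts" "fmap F \<phi> v \<noteq> fmap F \<psi> v" using fmap_inj by blast
  then obtain P Q where PQ: "openin (fobj F W) P" "openin (fobj F W) Q" "fmap F \<phi> v \<in> P" "fmap F \<psi> v \<in> Q" "disjnt P Q"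
    using Hausdorff_fobj[OF W] fmap_in[OF h(1) v(1)] fmap_in[OF h(2) v(1)] unfolding Hausdorff_space_def by metis
  have K: "compactin (fobj F V) {v}" using v by simp
  let ?N = "\<lambda>U. {\<phi> \<in> hom C V W. fmap F \<phi> ` {v} \<subseteq> U}"
  have "disjnt (?N P) (?N Q)" using PQ(5) by (auto simp: disjnt_iff)
  then show "\<exists>U T. openin (fobj Fv W) U \<and> openin (fobj Fv W) T \<and> \<phi> \<in> U \<and> \<psi> \<in> T \<and> disjnt U T"
    using openin_hom_NKU[OF K PQ(1)] openin_hom_NKU[OF K PQ(2)] PQ(3,4) h
    by (intro exI[of _ "?N P"] exI[of _ "?N Q"]) auto
qed

lemma openin_fobj_Fv_neighbourhood:
  assumes "openin (fobj Fv W) T" "\<phi> \<in> T"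
  obtains n :: nat and K U
    where "\<forall>j<n. compactin (fobj F V) (K j) \<and> openin (fobj F W) (U j) \<and> fmap F \<phi> ` K j \<subseteq> U j"
    "{\<psi> \<in> hom C V W. \<forall>j<n. fmap F \<psi> ` K j \<subseteq> U j} \<subseteq> T"
proof -
  let ?r = "\<lambda>\<phi>. restrict (fmap F \<phi>) pts"
  obtain T' where T': "openin (mapspace (object_family F W)) T'" "T = ?r -` T' \<inter> hom C V W"
    using assms(1) by (auto simp: hom_functor_def openin_pullback_topology)
  have "openin (topology_from C F V (object_family F W) {K. compactin (fobj F V) K}) T'" "?r \<phi> \<in> T'"
    using T' assms(2) by (auto simp: function_space_def)
  then obtain n K U where nKU: "\<forall>j<n. K j \<in> {K. compactin (fobj F V) K} \<and>
       openin (tot (object_family F W)) (U j) \<and> ?r \<phi> ` K j \<subseteq> U j"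
     "carried (maps (object_family F W)) n K U \<subseteq> T'"
    by (rule openin_topology_from_neighbourhood)
  show thesis
  proof (rule that)
    have 1: "compactin (fobj F V) (K j) \<and> openin (fobj F W) (U j) \<and> fmap F \<phi> ` K j \<subseteq> U j" if "j < n" for j
    proof -
      have "compactin (fobj F V) (K j) \<and> openin (fobj F W) (U j) \<and> ?r \<phi> ` K j \<subseteq> U j"
        using nKU(1)[rule_format, OF that] by (simp only: object_family_def family.simps mem_Collect_eq)
      then show ?thesis by (simp only: image_restrict simp_thms cong: conj_cong)
    qed
    then show "\<forall>j<n. compactin (fobj F V) (K j) \<and> openin (fobj F W) (U j) \<and> fmap F \<phi> ` K j \<subseteq> U j" by blast
    show "{\<psi> \<in> hom C V W. \<forall>j<n. fmap F \<psi> ` K j \<subseteq> U j} \<subseteq> T"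
    proof
      fix \<psi> assume \<psi>: "\<psi> \<in> {\<psi> \<in> hom C V W. \<forall>j<n. fmap F \<psi> ` K j \<subseteq> U j}"
      have "?r \<psi> ` K j \<subseteq> U j" if "j < n" for j
        unfolding image_restrict[OF conjunct1[OF 1[OF that]]] using that \<psi> by blast
      then have "?r \<psi> \<in> carried (maps (object_family F W)) n K U"
        using \<psi> restrict_fmap_maps unfolding carried_def by blast
      then show "\<psi> \<in> T" using nKU(2) \<psi> unfolding T'(2) by blast
    qed
  qed
qed

text \<open>A countable sub-basis consists of the \<open>N_{K,T}\<close> where \<open>K\<close> runs
  through the compact closures of members of a countable base of \<open>F(V)\<close>, and
  \<open>T\<close> through a countable base of \<open>F(W)\<close> that absorbs compact sets. Local
  compactness of \<open>F(V)\<close> makes these sufficient: a compact set inside an open one is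
  covered by finitely many such closures that stay inside.\<close>

lemma second_countable_fobj_Fv:
  assumes W: "W \<in> Obj C"
  shows "second_countable (fobj Fv W)"
proof -
  obtain B where B: "countable B" "\<And>b. b \<in> B \<Longrightarrow> openin (fobj F V) b"
      "\<And>U v. openin (fobj F V) U \<Longrightarrow> v \<in> U \<Longrightarrow> \<exists>b\<in>B. v \<in> b \<and> b \<subseteq> U"
    using second_countable_fobj[OF V] unfolding second_countable_def by metis
  obtain \<Q> where Q: "countable \<Q>" "\<And>T. T \<in> \<Q> \<Longrightarrow> openin (fobj F W) T"
    "\<And>K U. compactin (fobj F W) K \<Longrightarrow> openin (fobj F W) U \<Longrightarrow> K \<subseteq> U \<Longrightarrow> \<exists>T\<in>\<Q>. K \<subseteq> T \<and> T \<subseteq> U"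
    using countable_base_finite_unions[OF second_countable_fobj[OF W]] by metis
  let ?N = "\<lambda>(b, T). {\<phi> \<in> hom C V W. fmap F \<phi> ` (fobj F V closure_of b) \<subseteq> T}"
  define \<S> where "\<S> = ?N ` ({b \<in> B. compactin (fobj F V) (fobj F V closure_of b)} \<times> \<Q>)"
  have S: "countable \<S>" unfolding \<S>_def using B(1) Q(1) by (intro countable_image countable_SIGMA) auto
  have Sopen: "openin (fobj Fv W) s" if "s \<in> \<S>" for s
    using that Q(2) openin_hom_NKU unfolding \<S>_def by auto
  have refine: "\<exists>\<G>. finite \<G> \<and> \<G> \<subseteq> \<S> \<and> \<phi> \<in> \<Inter>\<G> \<and> hom C V W \<inter> \<Inter>\<G> \<subseteq> {\<phi> \<in> hom C V W. fmap F \<phi> ` K \<subseteq> U}"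
    if \<phi>: "\<phi> \<in> hom C V W" and K: "compactin (fobj F V) K" and U: "openin (fobj F W) U" and KU: "fmap F \<phi> ` K \<subseteq> U"
    for \<phi> K U
  proof -
    let ?G = "{v \<in> pts. fmap F \<phi> v \<in> U}"
    have G: "openin (fobj F V) ?G"
      using fmap_continuous[OF \<phi>] U by (rule openin_continuous_map_preimage)
    let ?B = "{b \<in> B. compactin (fobj F V) (fobj F V closure_of b) \<and> fobj F V closure_of b \<subseteq> ?G}"
    have "K \<subseteq> \<Union>?B"
    proof
      fix v assume v: "v \<in> K"
      then have vG: "v \<in> ?G" using KU compactin_subset_topspace[OF K] by blast
      then have c: "compactin (fobj F V) {v}" "{v} \<subseteq> ?G" by auto
      obtain P L where P: "openin (fobj F V) P" "compactin (fobj F V) L" "{v} \<subseteq> P" "P \<subseteq> L" "L \<subseteq> ?G"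
        by (rule compact_neighbourhood_within[OF locally_compact_fobj[OF V] Hausdorff_fobj[OF V] c(1) G c(2)])
      have "v \<in> P" using P(3) by simp
      from B(3)[OF P(1) this] obtain b where b: "b \<in> B" "v \<in> b" "b \<subseteq> P" by (elim bexE conjE)
      have "closedin (fobj F V) L" using P(2) compactin_imp_closedin[OF Hausdorff_fobj[OF V]] by blast
      then have "fobj F V closure_of b \<subseteq> L" using b P by (intro closure_of_minimal) auto
      then have "b \<in> ?B" using b P closed_compactin[OF P(2)] by auto
      then show "v \<in> \<Union>?B" using b(2) by (rule UnionI)
    qed
    then have "\<exists>\<F>. finite \<F> \<and> \<F> \<subseteq> ?B \<and> K \<subseteq> \<Union>\<F>"
      using B(2) by (intro compactinD[OF K]) auto
    then obtain \<F> where F: "finite \<F>" "\<F> \<subseteq> ?B" "K \<subseteq> \<Union>\<F>" by blast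
    have "\<forall>b\<in>\<F>. \<exists>T. T \<in> \<Q> \<and> fmap F \<phi> ` (fobj F V closure_of b) \<subseteq> T \<and> T \<subseteq> U"
    proof
      fix b assume "b \<in> \<F>"
      then have b: "compactin (fobj F V) (fobj F V closure_of b)" "fobj F V closure_of b \<subseteq> ?G" using F(2) by auto
      have "compactin (fobj F W) (fmap F \<phi> ` (fobj F V closure_of b))"
        using b(1) fmap_continuous[OF \<phi>] by (rule image_compactin)
      then show "\<exists>T. T \<in> \<Q> \<and> fmap F \<phi> ` (fobj F V closure_of b) \<subseteq> T \<and> T \<subseteq> U"
        using Q(3)[OF _ U] b(2) by blast
    qed
    from bchoice[OF this] obtain T where T: "\<forall>b\<in>\<F>. T b \<in> \<Q> \<and> fmap F \<phi> ` (fobj F V closure_of b) \<subseteq> T b \<and> T b \<subseteq> U"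
      by (elim exE)
    let ?\<G> = "(\<lambda>b. ?N (b, T b)) ` \<F>"
    have "?\<G> \<subseteq> \<S>" unfolding \<S>_def using F(2) T by blast
    moreover have "\<phi> \<in> \<Inter>?\<G>" using T \<phi> by auto
    moreover have "hom C V W \<inter> \<Inter>?\<G> \<subseteq> {\<phi> \<in> hom C V W. fmap F \<phi> ` K \<subseteq> U}"
    proof
      fix \<psi> assume \<psi>: "\<psi> \<in> hom C V W \<inter> \<Inter>?\<G>"
      have "fmap F \<psi> v \<in> U" if v: "v \<in> K" for v
      proof -
        obtain b where b: "b \<in> \<F>" "v \<in> b" using F(3) v by blast
        have "b \<subseteq> fobj F V closure_of b" 
          using F(2) b(1) by (intro closure_of_subset openin_subset B(2)) blast
        moreover have "\<psi> \<in> ?N (b, T b)" using \<psi> b(1) by blast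
        then have "fmap F \<psi> ` (fobj F V closure_of b) \<subseteq> T b" by simp
        ultimately show ?thesis using T b by blast
      qed
      then show "\<psi> \<in> {\<phi> \<in> hom C V W. fmap F \<phi> ` K \<subseteq> U}" using \<psi> by auto
    qed
    ultimately show ?thesis using F(1) by (intro exI[of _ ?\<G>]) blast
  qed
  let ?base = "(\<lambda>\<G>. hom C V W \<inter> \<Inter>\<G>) ` {\<G>. \<G> \<subseteq> \<S> \<and> finite \<G>}"
  show ?thesis
    unfolding second_countable_def
  proof (intro exI[of _ ?base] conjI ballI allI impI)
    have "countable {\<G>. \<G> \<subseteq> \<S> \<and> finite \<G>}"
      using countable_Collect_finite_subset[OF S] by (simp add: conj_commute)
    then show "countable ?base" by simp
  next
    fix T assume "T \<in> ?base"
    then obtain \<G> where G: "\<G> \<subseteq> \<S>" "finite \<G>" "T = hom C V W \<inter> \<Inter>\<G>" by blast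
    have "openin (fobj Fv W) (\<Inter>(insert (hom C V W) \<G>))"
      using G(1,2) Sopen openin_topspace[of "fobj Fv W"] by (intro openin_Inter) auto
    then show "openin (fobj Fv W) T" using G(3) by simp
  next
    fix T \<phi> assume T: "openin (fobj Fv W) T \<and> \<phi> \<in> T"
    then have \<phi>: "\<phi> \<in> hom C V W" using openin_subset by fastforce
    from T have T': "openin (fobj Fv W) T" "\<phi> \<in> T" by auto
    obtain n :: nat and K U where nKU: "\<forall>j<n. compactin (fobj F V) (K j) \<and> openin (fobj F W) (U j) \<and> fmap F \<phi> ` K j \<subseteq> U j"
      "{\<psi> \<in> hom C V W. \<forall>j<n. fmap F \<psi> ` K j \<subseteq> U j} \<subseteq> T"
      by (rule openin_fobj_Fv_neighbourhood[OF T'])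
    have "\<forall>j\<in>{..<n}. \<exists>\<G>. finite \<G> \<and> \<G> \<subseteq> \<S> \<and> \<phi> \<in> \<Inter>\<G> \<and>
        hom C V W \<inter> \<Inter>\<G> \<subseteq> {\<phi> \<in> hom C V W. fmap F \<phi> ` K j \<subseteq> U j}"
      using refine[OF \<phi>] nKU(1) by simp
    from bchoice[OF this] obtain G where G: "\<forall>j\<in>{..<n}. finite (G j) \<and> G j \<subseteq> \<S> \<and> \<phi> \<in> \<Inter>(G j) \<and>
        hom C V W \<inter> \<Inter>(G j) \<subseteq> {\<phi> \<in> hom C V W. fmap F \<phi> ` K j \<subseteq> U j}"
      by (elim exE)
    let ?T = "hom C V W \<inter> \<Inter>(\<Union>(G ` {..<n}))"
    have "\<Union>(G ` {..<n}) \<subseteq> \<S>" "finite (\<Union>(G ` {..<n}))" using G by auto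
    then have "?T \<in> ?base" by blast
    moreover have "\<phi> \<in> ?T" using G \<phi> by auto
    moreover have "?T \<subseteq> T"
    proof
      fix \<psi> assume \<psi>: "\<psi> \<in> ?T"
      have "fmap F \<psi> ` K j \<subseteq> U j" if "j < n" for j
      proof -
        have "\<psi> \<in> hom C V W \<inter> \<Inter>(G j)" using \<psi> that by auto
        then show ?thesis using G that by blast
      qed
      then show "\<psi> \<in> T" using nKU(2) \<psi> by blast
    qed
    ultimately show "\<exists>V\<in>?base. \<phi> \<in> V \<and> V \<subseteq> T" by (intro bexI[of _ ?T] conjI)
  qed
qed

end

section \<open>NKC categories\<close>

locale nkc_object = mapping_object C F V
  for C :: "('o, 'm) category" and F :: "('o, 'm, 'a) top_functor" and V :: 'o +
  assumes NKC: "NKC C F"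
begin

text \<open>The object \<open>W\<close> as a family over a one-point base space in the type \<open>'a\<close>, to which
  \<open>generating\<close> applies.\<close>

definition point_family :: "'o \<Rightarrow> ('o, 'a, 'a, 'a) family" where
  "point_family W =
     \<lparr>tot = fobj F W, bas = discrete_topology {some_pt}, prj = (\<lambda>_. some_pt), fib = (\<lambda>_. W), chart = (\<lambda>_. id)\<rparr>"

lemma is_family_point_family: "W \<in> Obj C \<Longrightarrow> is_family C F (point_family W)"
  by (simp add: is_family_def point_family_def over_def)

lemma mapspace_point_family:
  assumes W: "W \<in> Obj C"
  shows "mapspace (point_family W) = mapspace (object_family F W)"
proof -
  have "based (point_family W) some_pt \<phi> a \<longleftrightarrow> based (object_family F W) () \<phi> a" for \<phi> a
    by (simp add: based_def point_family_def object_family_def over_def)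
  moreover have "based (point_family W) b \<phi> a \<Longrightarrow> b = some_pt" for b \<phi> a
    by (simp add: based_def point_family_def)
  ultimately have maps: "maps (point_family W) = maps (object_family F W)"
    using maps_iff_based[OF is_family_point_family[OF W]] maps_iff_based[OF is_family_object[OF W]] by fastforce
  have "tot (point_family W) = tot (object_family F W)" by (simp add: point_family_def object_family_def)
  then show ?thesis using maps by (simp add: function_space_def topology_from_def NKU_def)
qed

text \<open>A nonempty member is demanded because a condition on the empty set says nothing about
  where a map lies, whereas compactness over a bundle relies on such a condition to confine the base
  point.\<close>

definition nkc_generating :: "'a set set \<Rightarrow> bool" where
  "nkc_generating \<K> \<longleftrightarrow> generating C F V \<K> \<and> (\<exists>K\<in>\<K>. K \<noteq> {}) \<and>
    (\<forall>K\<in>\<K>. \<forall>W\<in>Obj C. \<forall>D. compactin (fobj F W) D \<longrightarrow>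
       compactin (fobj Fv W) {\<phi> \<in> hom C V W. fmap F \<phi> ` K \<subseteq> D})"

lemma ex_nkc_generating: "\<exists>\<K>. nkc_generating \<K>"
proof -
  from NKC V obtain \<K> where K: "generating C F V \<K>"
    "\<forall>K\<in>\<K>. \<forall>W\<in>Obj C. \<forall>D. compactin (fobj F W) D \<longrightarrow>
       compactin (fobj Fv W) {\<phi> \<in> hom C V W. fmap F \<phi> ` K \<subseteq> D}"
    unfolding NKC_def by blast
  show ?thesis
  proof (cases "\<exists>K\<in>\<K>. K \<noteq> {}")
    case True
    then show ?thesis using K unfolding nkc_generating_def by blast
  next
    case False
    \<comment> \<open>Then the function spaces are indiscrete, and all compact sets do.\<close>
    have indiscrete: "T = hom C V W" if W: "W \<in> Obj C" and T: "openin (fobj Fv W) T" "\<phi> \<in> T" for W T \<phi>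
    proof -
      let ?r = "\<lambda>\<phi>. restrict (fmap F \<phi>) pts"
      obtain T' where T': "openin (mapspace (object_family F W)) T'" "T = ?r -` T' \<inter> hom C V W"
        using T(1) by (auto simp: hom_functor_def openin_pullback_topology)
      have "mapspace (point_family W) = topology_from C F V (point_family W) \<K>"
        using K(1) is_family_point_family[OF W] unfolding generating_def by blast
      then have "openin (topology_from C F V (point_family W) \<K>) T'"
        using T'(1) mapspace_point_family[OF W] by simp
      moreover have "?r \<phi> \<in> T'" using T(2) T'(2) by blast
      ultimately obtain n Q U where Q: "\<forall>j<n. Q j \<in> \<K> \<and> openin (tot (point_family W)) (U j) \<and> ?r \<phi> ` Q j \<subseteq> U j"
        "carried (maps (point_family W)) n Q U \<subseteq> T'"
        by (rule openin_topology_from_neighbourhood)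
      have "Q j = {}" if "j < n" for j using Q(1)[rule_format, OF that] False by blast
      then have "carried (maps (point_family W)) n Q U = maps (point_family W)" by (auto simp: carried_def)
      moreover have "maps (point_family W) = maps (object_family F W)"
        using arg_cong[OF mapspace_point_family[OF W], of topspace] by simp
      ultimately have "maps (object_family F W) \<subseteq> T'" using Q(2) by simp
      then show ?thesis using restrict_fmap_maps unfolding T'(2) by blast
    qed
    have all_compact: "compactin (fobj Fv W) S" if W: "W \<in> Obj C" and S: "S \<subseteq> hom C V W" for W S
      unfolding compactin_def
    proof (intro conjI allI impI)
      show "S \<subseteq> topspace (fobj Fv W)" using S by simp
      fix \<U> assume U: "(\<forall>U\<in>\<U>. openin (fobj Fv W) U) \<and> S \<subseteq> \<Union>\<U>"
      show "\<exists>\<F>. finite \<F> \<and> \<F> \<subseteq> \<U> \<and> S \<subseteq> \<Union>\<F>"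
      proof (cases "S = {}")
        case False
        then obtain \<phi> T where "\<phi> \<in> T" "T \<in> \<U>" using U by blast
        then have "T = hom C V W" using indiscrete[OF W] U by blast
        then show ?thesis using S \<open>T \<in> \<U>\<close> by (intro exI[of _ "{T}"]) auto
      qed auto
    qed
    have "nkc_generating {K. compactin (fobj F V) K}"
      unfolding nkc_generating_def
    proof (intro conjI ballI allI impI)
      show "generating C F V {K. compactin (fobj F V) K}"
        by (simp add: generating_def function_space_def)
      show "\<exists>K\<in>{K. compactin (fobj F V) K}. K \<noteq> {}"
        using some_pt by (intro bexI[of _ "{some_pt}"]) auto
      show "compactin (fobj Fv W) {\<phi> \<in> hom C V W. fmap F \<phi> ` K \<subseteq> D}" if "W \<in> Obj C" for W K D
        by (rule all_compact[OF that]) blast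
    qed
    then show ?thesis by blast
  qed
qed

definition \<K> :: "'a set set" where "\<K> = (SOME \<K>. nkc_generating \<K>)"

lemma nkc_generating: "nkc_generating \<K>"
  unfolding \<K>_def using ex_nkc_generating by (rule someI_ex)

lemma \<K>_compactin: "K \<in> \<K> \<Longrightarrow> compactin (fobj F V) K"
  using nkc_generating unfolding nkc_generating_def generating_def by blast

lemma mapspace_\<K>: "is_family C F (Y :: ('o, 'a, 'a, 'a) family) \<Longrightarrow> mapspace Y = topology_from C F V Y \<K>"
  using nkc_generating unfolding nkc_generating_def generating_def by blast

lemma \<K>_nonempty: "\<exists>K\<in>\<K>. K \<noteq> {}"
  using nkc_generating unfolding nkc_generating_def by blast

lemma compactin_hom_NKC:
  "K \<in> \<K> \<Longrightarrow> compactin (fobj F W) D \<Longrightarrow> W \<in> Obj C \<Longrightarrow>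
     compactin (fobj Fv W) {\<phi> \<in> hom C V W. fmap F \<phi> ` K \<subseteq> D}"
  using nkc_generating unfolding nkc_generating_def by blast

text \<open>To a basic neighbourhood from the generating family a vacuous condition is added at
  index \<open>0\<close>: a nonempty \<open>K0\<close> goes into the whole total space. When open
  sets are later replaced by compact ones, this condition supplies the compactness of the set of
  maps.\<close>

lemma mapspace_neighbourhood:
  fixes Y :: "('o, 'a, 'a, 'a) family"
  assumes Y: "is_family C F Y" and W: "openin (mapspace Y) W" "a \<in> W"
  obtains n :: nat and K U where "0 < n" "K 0 \<in> \<K>" "K 0 \<noteq> {}"
    "\<forall>j<n. compactin (fobj F V) (K j) \<and> openin (tot Y) (U j) \<and> a ` K j \<subseteq> U j"
    "carried (maps Y) n K U \<subseteq> W"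
proof -
  have "openin (topology_from C F V Y \<K>) W" using W(1) mapspace_\<K>[OF Y] by simp
  from openin_topology_from_neighbourhood[OF this W(2)]
  obtain n :: nat and K U where nKU: "\<forall>j<n. K j \<in> \<K> \<and> openin (tot Y) (U j) \<and> a ` K j \<subseteq> U j"
    "carried (maps Y) n K U \<subseteq> W" .
  obtain K0 where K0: "K0 \<in> \<K>" "K0 \<noteq> {}" using \<K>_nonempty by blast
  let ?K = "case_nat K0 K" and ?U = "case_nat (topspace (tot Y)) U"
  have a: "a \<in> maps Y" using W openin_subset by fastforce
  show thesis
  proof (rule that[of "Suc n" ?K ?U])
    show "\<forall>j<Suc n. compactin (fobj F V) (?K j) \<and> openin (tot Y) (?U j) \<and> a ` ?K j \<subseteq> ?U j"
    proof (intro allI impI)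
      fix j assume j: "j < Suc n"
      show "compactin (fobj F V) (?K j) \<and> openin (tot Y) (?U j) \<and> a ` ?K j \<subseteq> ?U j"
      proof (cases j)
        case 0
        have "a ` K0 \<subseteq> topspace (tot Y)"
          using maps_continuous[OF Y a] compactin_subset_topspace[OF \<K>_compactin[OF K0(1)]]
          by (auto simp: continuous_map_def)
        then show ?thesis using 0 \<K>_compactin[OF K0(1)] by simp
      next
        case (Suc i)
        then show ?thesis using nKU(1)[rule_format, of i] j \<K>_compactin by simp
      qed
    qed
    have "carried (maps Y) (Suc n) ?K ?U \<subseteq> carried (maps Y) n K U"
    proof
      fix x assume x: "x \<in> carried (maps Y) (Suc n) ?K ?U"
      have "x ` K j \<subseteq> U j" if "j < n" for j
      proof -
        have "x ` ?K (Suc j) \<subseteq> ?U (Suc j)" using x that unfolding carried_def by blast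
        then show ?thesis by simp
      qed
      then show "x \<in> carried (maps Y) n K U" using x by (simp add: carried_def)
    qed
    then show "carried (maps Y) (Suc n) ?K ?U \<subseteq> W" using nKU(2) by blast
  qed (use K0 in auto)
qed

text \<open>For \<open>K\<close> in the generating family and a compact neighbourhood
  \<open>L\<close> of its image, \<open>N_{K,L}\<close> is a neighbourhood of \<open>\<phi>\<close>
  that is compact by NKC. Of the three topological axioms for \<open>F^V\<close> this is the one
  that rests on NKC.\<close>

lemma locally_compact_fobj_Fv:
  assumes W: "W \<in> Obj C"
  shows "locally_compact_space (fobj Fv W)"
  unfolding locally_compact_space_def
proof
  fix \<phi> assume "\<phi> \<in> topspace (fobj Fv W)"
  then have \<phi>: "\<phi> \<in> hom C V W" by simp
  obtain K where K: "K \<in> \<K>" using \<K>_nonempty by blast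
  have c: "compactin (fobj F W) (fmap F \<phi> ` K)"
    using \<K>_compactin[OF K] fmap_continuous[OF \<phi>] by (rule image_compactin)
  obtain P L where P: "openin (fobj F W) P" "compactin (fobj F W) L" "fmap F \<phi> ` K \<subseteq> P" "P \<subseteq> L"
    by (rule compact_neighbourhood_within[OF locally_compact_fobj[OF W] Hausdorff_fobj[OF W] c
          openin_topspace compactin_subset_topspace[OF c]])
  show "\<exists>U Q. openin (fobj Fv W) U \<and> compactin (fobj Fv W) Q \<and> \<phi> \<in> U \<and> U \<subseteq> Q"
    using openin_hom_NKU[OF \<K>_compactin[OF K] P(1)] compactin_hom_NKC[OF K P(2) W] \<phi> P(3,4)
    by (intro exI[of _ "{\<phi> \<in> hom C V W. fmap F \<phi> ` K \<subseteq> P}"] exI[of _ "{\<phi> \<in> hom C V W. fmap F \<phi> ` K \<subseteq> L}"]) auto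
qed

lemma structure_category_Fv: "structure_category C Fv"
  unfolding structure_category_def
  using category functor_to_Top_Fv locally_compact_fobj_Fv second_countable_fobj_Fv Hausdorff_fobj_Fv by blast

end

section \<open>The topology of a bundle\<close>

lemma locally_compact_space_openin_cover:
  assumes "\<And>x. x \<in> topspace X \<Longrightarrow> \<exists>S. openin X S \<and> x \<in> S \<and> locally_compact_space (subtopology X S)"
  shows "locally_compact_space X"
  unfolding locally_compact_space_def
proof
  fix x assume x: "x \<in> topspace X"
  obtain S where S: "openin X S" "x \<in> S" "locally_compact_space (subtopology X S)" using assms[OF x] by blast
  then have "x \<in> topspace (subtopology X S)" using x by simp
  then obtain U K where "openin (subtopology X S) U" "compactin (subtopology X S) K" "x \<in> U" "U \<subseteq> K"
    using S(3) unfolding locally_compact_space_def by blast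
  then show "\<exists>U K. openin X U \<and> compactin X K \<and> x \<in> U \<and> U \<subseteq> K"
    using S(1) by (meson compactin_subtopology openin_trans_full)
qed

lemma second_countable_finite_open_cover:
  assumes "finite \<S>" "topspace X \<subseteq> \<Union>\<S>" "\<And>S. S \<in> \<S> \<Longrightarrow> openin X S \<and> second_countable (subtopology X S)"
  shows "second_countable X"
proof -
  have "\<forall>S\<in>\<S>. \<exists>B. countable B \<and> (\<forall>V\<in>B. openin (subtopology X S) V) \<and>
       (\<forall>U x. openin (subtopology X S) U \<and> x \<in> U \<longrightarrow> (\<exists>V\<in>B. x \<in> V \<and> V \<subseteq> U))"
    using assms(3) unfolding second_countable_def by blast
  from bchoice[OF this] obtain B where B: "\<forall>S\<in>\<S>. countable (B S) \<and> (\<forall>V\<in>B S. openin (subtopology X S) V) \<and>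
       (\<forall>U x. openin (subtopology X S) U \<and> x \<in> U \<longrightarrow> (\<exists>V\<in>B S. x \<in> V \<and> V \<subseteq> U))"
    by (elim exE)
  show ?thesis
    unfolding second_countable_def
  proof (intro exI[of _ "\<Union>(B ` \<S>)"] conjI ballI allI impI)
    show "countable (\<Union>(B ` \<S>))" 
      by (rule countable_UN[OF countable_finite[OF assms(1)]]) (use B in blast)
  next
    fix V assume "V \<in> \<Union>(B ` \<S>)"
    then obtain S where "S \<in> \<S>" "V \<in> B S" by blast
    then show "openin X V" using B assms(3) by (meson openin_trans_full)
  next
    fix U x assume U: "openin X U \<and> x \<in> U"
    then have "x \<in> \<Union>\<S>" using assms(2) openin_subset by blast
    then obtain S where S: "S \<in> \<S>" "x \<in> S" by (rule UnionE)
    have "openin (subtopology X S) (U \<inter> S)" using U by (simp add: openin_subtopology_Int)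
    moreover have "x \<in> U \<inter> S" using U S by blast
    ultimately have "\<exists>V\<in>B S. x \<in> V \<and> V \<subseteq> U \<inter> S" using B S(1) by meson
    then show "\<exists>V\<in>\<Union>(B ` \<S>). x \<in> V \<and> V \<subseteq> U" using S(1) by blast
  qed
qed

lemma family_iso_homeomorphic_maps:
  assumes "family_iso C F X Y f fb"
  obtains g gb where "family_map C F X Y f fb" "family_map C F Y X g gb"
    "homeomorphic_maps (tot X) (tot Y) f g" "homeomorphic_maps (bas X) (bas Y) fb gb"
proof -
  obtain g gb where g: "family_map C F X Y f fb" "family_map C F Y X g gb"
    "\<forall>x\<in>topspace (tot X). g (f x) = x" "\<forall>y\<in>topspace (tot Y). f (g y) = y"
    "\<forall>b\<in>topspace (bas X). gb (fb b) = b" "\<forall>c\<in>topspace (bas Y). fb (gb c) = c"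
    using assms unfolding family_iso_def by blast
  then show thesis
    using that[of g gb] family_mapD(1,2)[OF g(1)] family_mapD(1,2)[OF g(2)]
    by (simp add: homeomorphic_maps_def)
qed

lemma product_simps:
  "tot (product_family F B W) = prod_topology B (fobj F W)" "bas (product_family F B W) = B"
  "prj (product_family F B W) = fst"
  by (simp_all add: product_family_def)

text \<open>A trivialisation may move the base by a homeomorphism \<open>fb\<close>. Replacing the
  first coordinate of \<open>f\<close> by the projection and correcting the inverse by
  \<open>fb\<close> gives one over the identity, which then restricts to every subset
  \<open>T\<close> of \<open>U\<close> by the same formulas.\<close>

lemma bundle_chart:
  assumes M: "is_bundle C F M" and b: "b \<in> topspace (bas M)"
  obtains U W g g' where "openin (bas M) U" "b \<in> U" "W \<in> Obj C"
    "\<forall>T\<subseteq>U. homeomorphic_maps (subtopology (tot M) (over M T))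
       (prod_topology (subtopology (bas M) T) (fobj F W)) g g'"
    "\<forall>x\<in>over M U. fst (g x) = prj M x"
proof -
  from is_bundleD(2)[OF M b] obtain U0 W f fb where U0: "U0 \<subseteq> topspace (bas M)" "b \<in> bas M interior_of U0"
    "W \<in> Obj C" and iso: "family_iso C F (restr_family M U0) (product_family F (subtopology (bas M) U0) W) f fb"
    by (elim exE conjE)
  obtain f' fb' where f: "family_map C F (restr_family M U0) (product_family F (subtopology (bas M) U0) W) f fb"
    "family_map C F (product_family F (subtopology (bas M) U0) W) (restr_family M U0) f' fb'"
    and hom: "homeomorphic_maps (subtopology (tot M) (over M U0)) (prod_topology (subtopology (bas M) U0) (fobj F W)) f f'"
    and homb: "homeomorphic_maps (subtopology (bas M) U0) (subtopology (bas M) U0) fb fb'"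
    by (rule family_iso_homeomorphic_maps[OF iso]) (simp add: product_simps)
  let ?g = "\<lambda>x. (prj M x, snd (f x))" and ?g' = "\<lambda>(t, w). f' (fb t, w)"
  note Mf = is_bundleD(1)[OF M]
  have f_fst: "fst (f x) = fb (prj M x)" if "x \<in> over M U0" for x
    using family_mapD(3)[OF f(1), of x] that over_subset_topspace[of M U0] by (auto simp: product_simps)
  have f'_prj: "prj M (f' (s, w)) = fb' s" if "s \<in> U0" "s \<in> topspace (bas M)" "w \<in> topspace (fobj F W)" for s w
    using family_mapD(3)[OF f(2), of "(s, w)"] that by (auto simp: product_simps)
  have f_f': "f' (f x) = x" if "x \<in> over M U0" for x
    using hom that over_subset_topspace[of M U0] by (auto simp: homeomorphic_maps_def)
  have f'_f: "f (f' (s, w)) = (s, w)" if "s \<in> U0" "s \<in> topspace (bas M)" "w \<in> topspace (fobj F W)" for s w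
    using hom that by (auto simp: homeomorphic_maps_def)
  have fb'_fb: "fb' (fb t) = t" "fb t \<in> U0" "fb t \<in> topspace (bas M)" if "t \<in> U0" for t
    using homb that U0(1) by (auto simp: homeomorphic_maps_def continuous_map_def Pi_iff)
  show thesis
  proof (rule that[of "bas M interior_of U0" W ?g ?g'])
    show "openin (bas M) (bas M interior_of U0)" by simp
    show "b \<in> bas M interior_of U0" "W \<in> Obj C" using U0 by auto
    show "\<forall>x\<in>over M (bas M interior_of U0). fst (prj M x, snd (f x)) = prj M x" by simp
    have "homeomorphic_maps (subtopology (tot M) (over M T)) (prod_topology (subtopology (bas M) T) (fobj F W)) ?g ?g'"
      if "T \<subseteq> bas M interior_of U0" for T
    proof -
      have T: "T \<subseteq> U0" using that interior_of_subset[of "bas M" U0] by (rule subset_trans)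
      have overT: "over M T \<subseteq> over M U0" using T by (auto simp: over_def)
      have top: "topspace (subtopology (tot M) (over M T)) = over M T"
        using over_subset_topspace[of M T] by auto
      show "homeomorphic_maps (subtopology (tot M) (over M T)) (prod_topology (subtopology (bas M) T) (fobj F W)) ?g ?g'"
        unfolding homeomorphic_maps_def top
      proof (intro conjI ballI)
        have "continuous_map (subtopology (tot M) (over M T)) (prod_topology (subtopology (bas M) U0) (fobj F W)) f"
          using hom continuous_map_from_subtopology_mono[OF _ overT] by (auto simp: homeomorphic_maps_def)
        then have "continuous_map (subtopology (tot M) (over M T)) (fobj F W) (snd \<circ> f)"
          by (rule continuous_map_compose) (rule continuous_map_snd)
        moreover have "continuous_map (subtopology (tot M) (over M T)) (subtopology (bas M) T) (prj M)"
          using is_familyD(1)[OF Mf] by (auto simp: continuous_map_in_subtopology over_def intro: continuous_map_from_subtopology)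
        ultimately show "continuous_map (subtopology (tot M) (over M T)) (prod_topology (subtopology (bas M) T) (fobj F W)) ?g"
          by (simp add: continuous_map_pairwise o_def)
        have "continuous_map (subtopology (bas M) T) (subtopology (bas M) U0) fb"
          using homb continuous_map_from_subtopology_mono[OF _ T] by (auto simp: homeomorphic_maps_def)
        then have "continuous_map (prod_topology (subtopology (bas M) T) (fobj F W)) (prod_topology (subtopology (bas M) U0) (fobj F W))
             (\<lambda>x. (fb (fst x), snd x))"
          using continuous_map_compose[OF continuous_map_fst, of "subtopology (bas M) T" "subtopology (bas M) U0" fb "fobj F W"]
          by (simp add: continuous_map_pairwise o_def continuous_map_snd)
        then have "continuous_map (prod_topology (subtopology (bas M) T) (fobj F W)) (subtopology (tot M) (over M U0))
             (f' \<circ> (\<lambda>x. (fb (fst x), snd x)))"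
          by (rule continuous_map_compose) (use hom in \<open>simp add: homeomorphic_maps_def\<close>)
        then have c: "continuous_map (prod_topology (subtopology (bas M) T) (fobj F W)) (tot M) ?g'"
          by (simp add: continuous_map_in_subtopology o_def split_def)
        moreover have "?g' x \<in> over M T" if "x \<in> topspace (prod_topology (subtopology (bas M) T) (fobj F W))" for x
        proof -
          obtain t w where x: "x = (t, w)" "t \<in> T" "w \<in> topspace (fobj F W)" using \<open>x \<in> _\<close> by auto
          have t: "t \<in> U0" using x(2) T by blast
          have "prj M (?g' x) = t" using f'_prj[OF fb'_fb(2,3)[OF t] x(3)] fb'_fb(1)[OF t] x(1) by simp
          moreover have "?g' x \<in> topspace (tot M)"
            by (rule funcset_mem[OF continuous_map_funspace[OF c] that])
          ultimately show ?thesis using x(2) by (simp add: over_def)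
        qed
        ultimately show "continuous_map (prod_topology (subtopology (bas M) T) (fobj F W)) (subtopology (tot M) (over M T)) ?g'"
          by (auto simp: continuous_map_in_subtopology)
        show "?g' (?g x) = x" if "x \<in> over M T" for x
        proof -
          have x: "x \<in> over M U0" using that overT by blast
          have "f x = (fb (prj M x), snd (f x))" using f_fst[OF x] by (simp add: prod_eq_iff)
          then show ?thesis using f_f'[OF x] by simp
        qed
        show "?g (?g' y) = y" if "y \<in> topspace (prod_topology (subtopology (bas M) T) (fobj F W))" for y
        proof -
          obtain t w where y: "y = (t, w)" "t \<in> T" "w \<in> topspace (fobj F W)" using \<open>y \<in> _\<close> by auto
          have t: "t \<in> U0" using y(2) T by blast
          show ?thesis
            using f'_prj[OF fb'_fb(2,3)[OF t] y(3)] fb'_fb(1)[OF t] f'_f[OF fb'_fb(2,3)[OF t] y(3)] y(1) by simp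
        qed
      qed
    qed
    then show "\<forall>T\<subseteq>bas M interior_of U0. homeomorphic_maps (subtopology (tot M) (over M T))
       (prod_topology (subtopology (bas M) T) (fobj F W)) ?g ?g'" by blast
  qed
qed

context mapping_object
begin

lemma Hausdorff_bundle:
  assumes M: "is_bundle C F M" and B: "Hausdorff_space (bas M)"
  shows "Hausdorff_space (tot M)"
  unfolding Hausdorff_space_def
proof (intro allI impI)
  note Mf = is_bundleD(1)[OF M]
  fix x y assume xy: "x \<in> topspace (tot M) \<and> y \<in> topspace (tot M) \<and> x \<noteq> y"
  then have prj: "prj M x \<in> topspace (bas M)" "prj M y \<in> topspace (bas M)" using is_familyD(5)[OF Mf] by auto
  show "\<exists>U V. openin (tot M) U \<and> openin (tot M) V \<and> x \<in> U \<and> y \<in> V \<and> disjnt U V"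
  proof (cases "prj M x = prj M y")
    case False
    then obtain P Q where PQ: "openin (bas M) P" "openin (bas M) Q" "prj M x \<in> P" "prj M y \<in> Q" "disjnt P Q"
      using B prj unfolding Hausdorff_space_def by metis
    have "disjnt (over M P) (over M Q)" using PQ(5) by (auto simp: over_def disjnt_iff)
    moreover have "x \<in> over M P" "y \<in> over M Q" using PQ xy by (auto simp: over_def)
    ultimately show ?thesis using openin_over[OF Mf PQ(1)] openin_over[OF Mf PQ(2)] by blast
  next
    case True
    obtain U W g g' where U: "openin (bas M) U" "prj M x \<in> U" "W \<in> Obj C" and
      g: "\<forall>T\<subseteq>U. homeomorphic_maps (subtopology (tot M) (over M T))
         (prod_topology (subtopology (bas M) T) (fobj F W)) g g'"
      by (rule bundle_chart[OF M prj(1)])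
    have "Hausdorff_space (prod_topology (subtopology (bas M) U) (fobj F W))"
      using B Hausdorff_fobj[OF U(3)] by (simp add: Hausdorff_space_prod_topology Hausdorff_space_subtopology)
    then have H: "Hausdorff_space (subtopology (tot M) (over M U))"
      using homeomorphic_Hausdorff_space homeomorphic_maps_imp_homeomorphic_space[OF g[rule_format, OF subset_refl]] by blast
    have "x \<in> over M U" "y \<in> over M U" using True xy U(2) by (auto simp: over_def)
    then have "\<exists>P Q. openin (subtopology (tot M) (over M U)) P \<and> openin (subtopology (tot M) (over M U)) Q \<and> x \<in> P \<and> y \<in> Q \<and> disjnt P Q"
      using H xy unfolding Hausdorff_space_def by simp
    then show ?thesis using openin_over[OF Mf U(1)] openin_trans_full by meson
  qed
qed

text \<open>Locally, the part over \<open>c\<close> is a product of a subspace of \<open>c\<close>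
  with a fibre, and both factors have the property in question. Second countability passes to the
  whole because finitely many charts cover the compact \<open>c\<close>.\<close>

lemma
  assumes M: "is_bundle C F M" and B: "Hausdorff_space (bas M)" and c: "compactin (bas M) c"
  shows locally_compact_over: "locally_compact_space (subtopology (tot M) (over M c))"
    and second_countable_over:
      "second_countable (subtopology (bas M) c) \<Longrightarrow> second_countable (subtopology (tot M) (over M c))"
proof -
  note Mf = is_bundleD(1)[OF M]
  let ?D = "subtopology (tot M) (over M c)" and ?c = "subtopology (bas M) c"
  have cB: "c \<subseteq> topspace (bas M)" by (rule compactin_subset_topspace[OF c])
  have topc: "topspace ?c = c" using cB by auto
  have lc: "locally_compact_space ?c" and Hc: "Hausdorff_space ?c"
    using c B by (simp_all add: compactin_subspace compact_imp_locally_compact_space Hausdorff_space_subtopology)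
  have chart: "\<exists>T. openin ?c T \<and> b \<in> T \<and> openin ?D (over M T) \<and>
      locally_compact_space (subtopology ?D (over M T)) \<and>
      (second_countable ?c \<longrightarrow> second_countable (subtopology ?D (over M T)))" if b: "b \<in> c" for b
  proof -
    have bB: "b \<in> topspace (bas M)" using b cB by blast
    obtain U W g g' where U: "openin (bas M) U" "b \<in> U" "W \<in> Obj C" and
      g: "\<forall>T\<subseteq>U. homeomorphic_maps (subtopology (tot M) (over M T))
         (prod_topology (subtopology (bas M) T) (fobj F W)) g g'"
      by (rule bundle_chart[OF M bB])
    let ?T = "U \<inter> c"
    have opT: "openin ?c ?T" by (rule openin_subtopology_Int[OF U(1)])
    have overT: "over M ?T = over M U \<inter> over M c" by (auto simp: over_def)
    have opD: "openin ?D (over M ?T)" unfolding overT by (rule openin_subtopology_Int[OF openin_over[OF Mf U(1)]])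
    have subD: "subtopology ?D (over M ?T) = subtopology (tot M) (over M ?T)"
      using overT by (simp add: subtopology_subtopology Int_absorb1)
    have subT: "subtopology ?c ?T = subtopology (bas M) ?T" by (simp add: subtopology_subtopology Int_ac)
    have hom: "subtopology ?D (over M ?T) homeomorphic_space prod_topology (subtopology (bas M) ?T) (fobj F W)"
      unfolding subD by (rule homeomorphic_maps_imp_homeomorphic_space[OF g[rule_format]]) blast
    have "locally_compact_space (subtopology (bas M) ?T)"
      using locally_compact_space_open_subset[OF _ lc opT] Hc unfolding subT by blast
    then have "locally_compact_space (prod_topology (subtopology (bas M) ?T) (fobj F W))"
      using locally_compact_fobj[OF U(3)] by (simp add: locally_compact_space_prod_topology)
    then have "locally_compact_space (subtopology ?D (over M ?T))"
      using homeomorphic_locally_compact_space[OF hom] by blast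
    moreover have "second_countable (subtopology ?D (over M ?T))" if "second_countable ?c"
    proof -
      have "second_countable (subtopology (bas M) ?T)"
        using second_countable_subtopology[OF that, of ?T] unfolding subT .
      then have 1: "second_countable (prod_topology (subtopology (bas M) ?T) (fobj F W))"
        using second_countable_fobj[OF U(3)] second_countable_prod_topology by blast
      obtain h where h: "homeomorphic_map (prod_topology (subtopology (bas M) ?T) (fobj F W)) (subtopology ?D (over M ?T)) h"
        using hom homeomorphic_space homeomorphic_space_sym by blast
      show ?thesis
        by (rule second_countable_open_map_image[OF homeomorphic_imp_continuous_map[OF h] homeomorphic_imp_open_map[OF h]
              homeomorphic_imp_surjective_map[OF h] 1])
    qed
    ultimately show ?thesis using opT opD b U(2) by (intro exI[of _ ?T]) auto
  qed
  have prjc: "prj M x \<in> c" "x \<in> over M T" if "x \<in> topspace ?D" "prj M x \<in> T" for x T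
    using that by (auto simp: over_def)
  show "locally_compact_space ?D"
  proof (rule locally_compact_space_openin_cover)
    fix x assume x: "x \<in> topspace ?D"
    then have "prj M x \<in> c" by (auto simp: over_def)
    from chart[OF this] obtain T where "prj M x \<in> T" "openin ?D (over M T)" "locally_compact_space (subtopology ?D (over M T))"
      by blast
    then show "\<exists>S. openin ?D S \<and> x \<in> S \<and> locally_compact_space (subtopology ?D S)"
      using prjc(2)[OF x] by (intro exI[of _ "over M T"]) simp
  qed
  assume sc: "second_countable ?c"
  have "\<forall>b\<in>c. \<exists>T. openin ?c T \<and> b \<in> T \<and> openin ?D (over M T) \<and> second_countable (subtopology ?D (over M T))"
    using chart sc by blast
  from bchoice[OF this] obtain T where T: "\<forall>b\<in>c. openin ?c (T b) \<and> b \<in> T b \<and> openin ?D (over M (T b)) \<and>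
      second_countable (subtopology ?D (over M (T b)))"
    by (elim exE)
  have cc: "compactin ?c c" using c by (simp add: compactin_subtopology)
  have "\<exists>\<F>. finite \<F> \<and> \<F> \<subseteq> T ` c \<and> c \<subseteq> \<Union>\<F>"
    by (rule compactinD[OF cc]) (use T in blast)+
  then obtain \<F> where F: "finite \<F>" "\<F> \<subseteq> T ` c" "c \<subseteq> \<Union>\<F>" by blast
  show "second_countable ?D"
  proof (rule second_countable_finite_open_cover)
    show "finite (over M ` \<F>)" using F(1) by simp
    show "topspace ?D \<subseteq> \<Union>(over M ` \<F>)" using F(3) by (auto simp: over_def)
    fix S assume "S \<in> over M ` \<F>"
    then obtain b where "b \<in> c" "S = over M (T b)" using F(2) by blast
    then show "openin ?D S \<and> second_countable (subtopology ?D S)" using T by blast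
  qed
qed

text \<open>The tube lemma turns the coherence of the base space into coherence of the total space,
  because the fibres are locally compact.\<close>

lemma bundle_coherent:
  assumes M: "is_bundle C F M" and cw: "relative_CW (bas M) A E"
    and G: "G \<subseteq> topspace (tot M)"
    and GA: "openin (subtopology (tot M) (over M A)) (G \<inter> over M A)"
    and GE: "\<And>n e c. (e, c) \<in> E n \<Longrightarrow> openin (subtopology (tot M) (over M c)) (G \<inter> over M c)"
  shows "openin (tot M) G"
proof (subst openin_subopen, intro ballI)
  note Mf = is_bundleD(1)[OF M]
  fix x assume x: "x \<in> G"
  have b: "prj M x \<in> topspace (bas M)" using x G is_familyD(5)[OF Mf] by blast
  obtain U W g g' where U: "openin (bas M) U" "prj M x \<in> U" "W \<in> Obj C" and
      g: "\<forall>T\<subseteq>U. homeomorphic_maps (subtopology (tot M) (over M T))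
         (prod_topology (subtopology (bas M) T) (fobj F W)) g g'" and
      fst: "\<forall>x\<in>over M U. fst (g x) = prj M x"
    by (rule bundle_chart[OF M b])
  have UB: "U \<subseteq> topspace (bas M)" by (rule openin_subset[OF U(1)])
  \<comment> \<open>The pieces whose topologies determine that of the base: \<open>A\<close> and the
    closed cells.\<close>
  let ?Q = "{Q. \<exists>n e. Q = A \<or> (e, Q) \<in> E n}"
  have Qop: "openin (prod_topology (subtopology (bas M) (U \<inter> Q)) (fobj F W))
      {y \<in> topspace (prod_topology (subtopology (bas M) (U \<inter> Q)) (fobj F W)). g' y \<in> G}" if Q: "Q \<in> ?Q" for Q
  proof -
    have "openin (subtopology (tot M) (over M Q)) (G \<inter> over M Q)" using Q GA GE by blast
    moreover have "continuous_map (prod_topology (subtopology (bas M) (U \<inter> Q)) (fobj F W)) (subtopology (tot M) (over M (U \<inter> Q))) g'"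
      using g[rule_format, of "U \<inter> Q"] by (simp add: homeomorphic_maps_def)
    then have c: "continuous_map (prod_topology (subtopology (bas M) (U \<inter> Q)) (fobj F W)) (subtopology (tot M) (over M Q)) g'"
      by (auto simp: continuous_map_in_subtopology over_def)
    ultimately have "openin (prod_topology (subtopology (bas M) (U \<inter> Q)) (fobj F W))
        {y \<in> topspace (prod_topology (subtopology (bas M) (U \<inter> Q)) (fobj F W)). g' y \<in> G \<inter> over M Q}"
      by (intro openin_continuous_map_preimage)
    moreover have "{y \<in> topspace (prod_topology (subtopology (bas M) (U \<inter> Q)) (fobj F W)). g' y \<in> G \<inter> over M Q}
        = {y \<in> topspace (prod_topology (subtopology (bas M) (U \<inter> Q)) (fobj F W)). g' y \<in> G}"
      using c by (auto simp: continuous_map_def)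
    ultimately show ?thesis by simp
  qed
  have cover: "\<exists>Q\<in>?Q. t \<in> Q" if t: "t \<in> topspace (bas M)" for t
  proof -
    have "t \<in> A \<or> (\<exists>n. \<exists>x\<in>E n. t \<in> fst x)" using t relative_CWD(3)[OF cw] by blast
    then show ?thesis
    proof
      assume "\<exists>n. \<exists>x\<in>E n. t \<in> fst x"
      then obtain n e c where "(e, c) \<in> E n" "t \<in> e" by auto
      then show ?thesis using relative_CWD(5)[OF cw \<open>(e, c) \<in> E n\<close>] by blast
    qed blast
  qed
  define w where "w = snd (g x)"
  have xU: "x \<in> over M U" using x G U(2) by (auto simp: over_def)
  then have gx: "g x = (prj M x, w)" using fst[rule_format, OF xU] by (simp add: w_def prod_eq_iff)
  have topU: "topspace (subtopology (tot M) (over M U)) = over M U" using over_subset_topspace[of M U] by auto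
  have gU: "homeomorphic_maps (subtopology (tot M) (over M U)) (prod_topology (subtopology (bas M) U) (fobj F W)) g g'"
    by (rule g[rule_format]) simp
  then have "g x \<in> topspace (prod_topology (subtopology (bas M) U) (fobj F W))"
    using xU topU by (auto simp: homeomorphic_maps_def continuous_map_def)
  then have w: "w \<in> topspace (fobj F W)" by (simp add: gx)
  have g'gx: "g' (prj M x, w) = x" using gU xU topU gx by (auto simp: homeomorphic_maps_def)
  obtain Q0 where Q0: "Q0 \<in> ?Q" "prj M x \<in> Q0" using cover[OF b] by blast
  let ?N = "{v \<in> topspace (fobj F W). g' (prj M x, v) \<in> G}"
  have Nop: "openin (fobj F W) ?N"
  proof -
    have "continuous_map (fobj F W) (prod_topology (subtopology (bas M) (U \<inter> Q0)) (fobj F W)) (\<lambda>v. (prj M x, v))"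
      using U(2) Q0(2) b by (simp add: continuous_map_pairwise o_def)
    from openin_continuous_map_preimage[OF this Qop[OF Q0(1)]]
    have "openin (fobj F W) {v \<in> topspace (fobj F W).
        (prj M x, v) \<in> {y \<in> topspace (prod_topology (subtopology (bas M) (U \<inter> Q0)) (fobj F W)). g' y \<in> G}}" .
    moreover have "{v \<in> topspace (fobj F W).
        (prj M x, v) \<in> {y \<in> topspace (prod_topology (subtopology (bas M) (U \<inter> Q0)) (fobj F W)). g' y \<in> G}} = ?N"
      using U(2) Q0(2) b by auto
    ultimately show ?thesis by simp
  qed
  have wN: "compactin (fobj F W) {w}" "{w} \<subseteq> ?N" using w g'gx x by auto
  obtain P L where PL: "openin (fobj F W) P" "compactin (fobj F W) L" "{w} \<subseteq> P" "P \<subseteq> L" "L \<subseteq> ?N"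
    by (rule compact_neighbourhood_within[OF locally_compact_fobj[OF U(3)] Hausdorff_fobj[OF U(3)] wN(1) Nop wN(2)])
  have LW: "L \<subseteq> topspace (fobj F W)" by (rule compactin_subset_topspace[OF PL(2)])
  \<comment> \<open>The base points over which the whole compact set \<open>L\<close> stays in
    \<open>G\<close>. The tube lemma makes the trace of \<open>Z\<close> on every piece open, the
    weak topology makes \<open>Z\<close> open, and \<open>Z \<times> P\<close> becomes a
    neighbourhood of \<open>x\<close> inside \<open>G\<close>.\<close>
  define Z where "Z = {t \<in> U. \<forall>v\<in>L. g' (t, v) \<in> G}"
  have ZQ: "openin (subtopology (bas M) Q) (Z \<inter> Q)" if Q: "Q \<in> ?Q" for Q
  proof -
    have "openin (subtopology (bas M) (U \<inter> Q)) (Z \<inter> Q)"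
    proof (subst openin_subopen, intro ballI)
      fix t assume t: "t \<in> Z \<inter> Q"
      let ?R = "{y \<in> topspace (prod_topology (subtopology (bas M) (U \<inter> Q)) (fobj F W)). g' y \<in> G}"
      have tU: "t \<in> topspace (subtopology (bas M) (U \<inter> Q))" using t UB by (auto simp: Z_def)
      have "{t} \<times> L \<subseteq> ?R" using t tU LW by (auto simp: Z_def)
      from tube_lemma_right[OF Qop[OF Q] PL(2) tU this]
      obtain H T where H: "openin (subtopology (bas M) (U \<inter> Q)) H" "t \<in> H" "L \<subseteq> T" "H \<times> T \<subseteq> ?R"
        by (elim exE conjE)
      have "H \<subseteq> Z \<inter> Q"
      proof
        fix s assume s: "s \<in> H"
        then have "s \<in> U \<inter> Q" using openin_subset[OF H(1)] by auto
        moreover have "g' (s, v) \<in> G" if "v \<in> L" for v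
        proof -
          have "(s, v) \<in> ?R" using H(3,4) s that by (intro subsetD[OF H(4)]) blast
          then show ?thesis by simp
        qed
        ultimately show "s \<in> Z \<inter> Q" by (simp add: Z_def)
      qed
      then show "\<exists>T. openin (subtopology (bas M) (U \<inter> Q)) T \<and> t \<in> T \<and> T \<subseteq> Z \<inter> Q" using H(1,2) by blast
    qed
    moreover have "subtopology (bas M) (U \<inter> Q) = subtopology (subtopology (bas M) Q) (U \<inter> Q)"
      by (simp add: subtopology_subtopology Int_ac)
    moreover have "openin (subtopology (bas M) Q) (U \<inter> Q)" by (rule openin_subtopology_Int[OF U(1)])
    ultimately show ?thesis using openin_trans_full by metis
  qed
  have "closedin (bas M) (topspace (bas M) - Z)"
  proof (rule relative_CWD(11)[OF cw])
    have *: "closedin (bas M) ((topspace (bas M) - Z) \<inter> Q)" if Q: "Q \<in> ?Q" "closedin (bas M) Q" for Q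
    proof -
      have "closedin (subtopology (bas M) Q) (topspace (subtopology (bas M) Q) - (Z \<inter> Q))"
        using ZQ[OF Q(1)] by (rule openin_closedin_eq[THEN iffD1, THEN conjunct2])
      then have "closedin (bas M) (topspace (subtopology (bas M) Q) - (Z \<inter> Q))"
        using Q(2) closedin_trans_full by blast
      moreover have "topspace (subtopology (bas M) Q) - (Z \<inter> Q) = (topspace (bas M) - Z) \<inter> Q" by auto
      ultimately show ?thesis by simp
    qed
    show "closedin (bas M) ((topspace (bas M) - Z) \<inter> A)"
      by (rule *) (use relative_CWD(2)[OF cw] in auto)
    show "closedin (bas M) ((topspace (bas M) - Z) \<inter> c)" if "(e, c) \<in> E n" for n e c
      by (rule *) (use that relative_CWD(7)[OF cw that] compactin_imp_closedin[OF relative_CWD(1)[OF cw]] in auto)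
  qed blast
  moreover have "Z \<subseteq> topspace (bas M)" using UB by (auto simp: Z_def)
  ultimately have Z: "openin (bas M) Z" by (simp add: openin_closedin_eq)
  have ZU: "Z \<subseteq> U" by (auto simp: Z_def)
  let ?O = "{y \<in> topspace (subtopology (tot M) (over M U)). g y \<in> Z \<times> P}"
  have "openin (prod_topology (subtopology (bas M) U) (fobj F W)) (Z \<times> P)"
    using Z ZU PL(1) by (simp add: openin_prod_Times_iff openin_subtopology_alt)
      (metis Int_absorb2 imageI mem_Collect_eq inf.absorb_iff2 inf_commute)
  then have "openin (subtopology (tot M) (over M U)) ?O"
    using gU by (intro openin_continuous_map_preimage) (auto simp: homeomorphic_maps_def)
  then have "openin (tot M) ?O" using openin_over[OF Mf U(1)] openin_trans_full by blast
  moreover have "x \<in> ?O"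
  proof -
    have "prj M x \<in> Z" using PL(5) U(2) by (auto simp: Z_def)
    then show ?thesis using xU topU gx PL(3) by auto
  qed
  moreover have "?O \<subseteq> G"
  proof
    fix y assume y: "y \<in> ?O"
    then obtain t v where tv: "g y = (t, v)" "t \<in> Z" "v \<in> P" by auto
    have "g' (g y) = y" using gU y by (auto simp: homeomorphic_maps_def)
    then have "g' (t, v) = y" by (simp only: tv(1))
    then show "y \<in> G" using tv PL(4) by (auto simp: Z_def)
  qed
  ultimately show "\<exists>T. openin (tot M) T \<and> x \<in> T \<and> T \<subseteq> G" by (intro exI[of _ ?O] conjI)
qed

end

section \<open>Closed and compact sets of maps into a bundle\<close>

context nkc_object
begin

text \<open>A map violates the conditions exactly if it sends one point of some \<open>K j\<close>
  outside \<open>E j\<close>, and each such one-point condition is open.\<close>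

lemma closedin_carried:
  assumes Y: "is_family C F Y" and K: "\<forall>j<n. compactin (fobj F V) (K j)" and E: "\<forall>j<n. closedin (tot Y) (E j)"
  shows "closedin (mapspace Y) (carried (maps Y) n K E)"
proof -
  have "openin (mapspace Y) {a \<in> maps Y. a ` {v} \<subseteq> topspace (tot Y) - E j}" if "j < n" "v \<in> K j" for j v
  proof (rule openin_function_space_NKU)
    show "compactin (fobj F V) {v}" using K that compactin_subset_topspace by fastforce
    show "openin (tot Y) (topspace (tot Y) - E j)" using E that by blast
  qed
  then have "openin (mapspace Y) (\<Union>j\<in>{..<n}. \<Union>v\<in>K j. {a \<in> maps Y. a ` {v} \<subseteq> topspace (tot Y) - E j})"
    by (intro openin_Union ballI) auto
  moreover have "topspace (mapspace Y) - carried (maps Y) n K E =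
      (\<Union>j\<in>{..<n}. \<Union>v\<in>K j. {a \<in> maps Y. a ` {v} \<subseteq> topspace (tot Y) - E j})"
  proof -
    have "a v \<in> topspace (tot Y)" if "a \<in> maps Y" "j < n" "v \<in> K j" for a j v
      using maps_continuous[OF Y that(1)] K that(2,3) compactin_subset_topspace by (fastforce simp: continuous_map_def)
    then show ?thesis unfolding carried_def topspace_function_space by blast
  qed
  ultimately show ?thesis by (simp add: closedin_def carried_def)
qed

text \<open>The trivialisation embeds the set as a closed subset of a product: base points in the
  projection of \<open>E\<close>, and morphisms sending \<open>K\<close> into a compact subset of
  the fibre, which form a compact set by NKC. As \<open>K\<close> is nonempty, a map sending
  \<open>K\<close> into \<open>E\<close> must have its base point in \<open>U\<close>, so
  restricting to \<open>U\<close> loses nothing.\<close>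

lemma compactin_carried_chart:
  assumes M: "is_family C F M" and H: "Hausdorff_space (tot M)" and W: "W \<in> Obj C"
    and f: "family_iso C F (restr_family M U) (product_family F (subtopology (bas M) U) W) f fb"
    and K: "K \<in> \<K>" "K \<noteq> {}" and E: "compactin (tot M) E" "E \<subseteq> over M U"
  shows "compactin (mapspace M) {a \<in> maps M. a ` K \<subseteq> E}"
proof -
  let ?R = "restr_family M U" and ?P = "product_family F (subtopology (bas M) U) W"
  note R = is_family_restr[OF M, of U]
  note Kc = \<K>_compactin[OF K(1)]
  obtain g where g: "family_iso C Fv (powerf ?R) (product_family Fv (subtopology (bas M) U) W) g fb"
    and gb: "\<forall>b \<phi> a. based ?R b \<phi> a \<longrightarrow> (\<exists>\<psi>. based ?P (fb b) \<psi> (post f a) \<and> g a = (fb b, \<psi>))"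
    by (rule family_iso_powerf_product[OF R W f])
  let ?Q = "prod_topology (subtopology (bas M) U) (fobj Fv W)"
  obtain g' where g': "homeomorphic_maps (mapspace ?R) ?Q g g'"
    by (rule family_iso_homeomorphic_maps[OF g]) (simp add: product_simps)
  have fc: "continuous_map (tot ?R) (tot ?P) f"
    using f unfolding family_iso_def by (blast dest: family_mapD(1))
  have ER: "compactin (tot ?R) E" using E by (simp add: compactin_subtopology)
  let ?S = "{a \<in> maps ?R. a ` K \<subseteq> E}"
  let ?D = "fst ` f ` E \<times> {\<phi> \<in> hom C V W. fmap F \<phi> ` K \<subseteq> snd ` f ` E}"
  have fE: "compactin (prod_topology (subtopology (bas M) U) (fobj F W)) (f ` E)"
    using image_compactin[OF ER fc] by (simp add: product_simps)
  have D: "compactin ?Q ?D"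
    using image_compactin[OF fE continuous_map_fst] compactin_hom_NKC[OF K(1) image_compactin[OF fE continuous_map_snd] W]
    by (simp add: compactin_Times)
  have gD: "g ` ?S \<subseteq> ?D"
  proof
    fix y assume "y \<in> g ` ?S"
    then obtain a where a: "a \<in> maps ?R" "a ` K \<subseteq> E" "y = g a" by blast
    then obtain b \<phi> where ab: "based ?R b \<phi> a" using maps_iff_based[OF R] by blast
    from gb[rule_format, OF ab] obtain \<psi> where \<psi>: "based ?P (fb b) \<psi> (post f a)" "g a = (fb b, \<psi>)" by blast
    have *: "f (a v) = (fb b, fmap F \<psi> v)" if "v \<in> K" for v
    proof -
      have "v \<in> pts" using compactin_subset_topspace[OF Kc] that by blast
      then show ?thesis using \<psi>(1) unfolding based_product by (metis post_apply restrict_apply')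
    qed
    have fE: "(fb b, fmap F \<psi> v) \<in> f ` E" if v: "v \<in> K" for v using a(2) v *[OF v] by (metis image_subset_iff image_eqI)
    obtain v0 where "v0 \<in> K" using K(2) by blast
    then have "fb b \<in> fst ` f ` E" using fE by (metis fst_conv image_eqI)
    moreover have "fmap F \<psi> ` K \<subseteq> snd ` f ` E" using fE by (metis snd_conv image_eqI image_subsetI)
    moreover have "\<psi> \<in> hom C V W" using \<psi>(1) by (simp add: based_product)
    ultimately show "y \<in> ?D" using a(3) \<psi>(2) by simp
  qed
  have "closedin (tot ?R) E"
    using ER H by (intro compactin_imp_closedin) (simp_all add: Hausdorff_space_subtopology)
  then have "closedin (mapspace ?R) (carried (maps ?R) 1 (\<lambda>_. K) (\<lambda>_. E))"
    using Kc by (intro closedin_carried[OF R]) auto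
  then have S: "closedin (mapspace ?R) ?S" by (simp add: carried_def)
  have gh: "homeomorphic_map (mapspace ?R) ?Q g" using g' homeomorphic_maps_imp_map by blast
  have "closedin ?Q (g ` ?S)"
    using homeomorphic_imp_closed_map[OF gh] S by (simp add: closed_map_def)
  then have "compactin ?Q (g ` ?S)" using D gD closed_compactin by blast
  then have "compactin (mapspace ?R) ?S"
    using homeomorphic_map_compactness[OF gh, of ?S] by (metis (no_types, lifting) mem_Collect_eq subsetI topspace_function_space)
  moreover have "mapspace ?R = subtopology (mapspace M) (over (powerf M) U)"
    using arg_cong[OF restr_powerf[OF M, of U], of tot] by simp
  ultimately have "compactin (mapspace M) ?S" by (simp add: compactin_subtopology)
  moreover have "?S = {a \<in> maps M. a ` K \<subseteq> E}"
  proof -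
    have "a \<in> over (powerf M) U" if a: "a \<in> maps M" "a ` K \<subseteq> E" for a
    proof -
      obtain b \<phi> where ab: "based M b \<phi> a" using maps_iff_based[OF M] a(1) by blast
      obtain v0 where v0: "v0 \<in> K" using K(2) by blast
      then have "v0 \<in> pts" using compactin_subset_topspace[OF Kc] by blast
      then have "prj M (a v0) = b" by (rule based_prj[OF ab])
      then have "b \<in> U" using a(2) v0 E(2) by (auto simp: over_def)
      then show ?thesis using ab over_powerf_all[OF M] by blast
    qed
    moreover have "over (powerf M) U \<subseteq> maps M" using over_subset_topspace[of "powerf M" U] by simp
    ultimately show ?thesis unfolding maps_restr[OF M] by blast
  qed
  ultimately show ?thesis by simp
qed

text \<open>The projection \<open>c\<close> of \<open>E\<close> is covered by finitely many compact
  sets \<open>L b\<close>, each inside a trivialising neighbourhood. A map lies over a single point,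
  so \<open>K\<close> goes entirely into the part of \<open>E\<close> over one \<open>L b\<close>,
  and the set is a finite union of compact ones.\<close>

lemma compactin_carried_bundle:
  assumes M: "is_bundle C F M" and B: "Hausdorff_space (bas M)"
    and K: "K \<in> \<K>" "K \<noteq> {}" and E: "compactin (tot M) E"
  shows "compactin (mapspace M) {a \<in> maps M. a ` K \<subseteq> E}"
proof -
  note Mf = is_bundleD(1)[OF M]
  note H = Hausdorff_bundle[OF M B]
  define c where "c = prj M ` E"
  have c: "compactin (bas M) c" unfolding c_def by (rule image_compactin[OF E is_familyD(1)[OF Mf]])
  have cB: "c \<subseteq> topspace (bas M)" by (rule compactin_subset_topspace[OF c])
  let ?sc = "subtopology (bas M) c"
  have lc: "locally_compact_space ?sc" and Hc: "Hausdorff_space ?sc"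
    using c B by (simp_all add: compactin_subspace compact_imp_locally_compact_space Hausdorff_space_subtopology)
  have "\<exists>P. openin ?sc P \<and> b \<in> P \<and> (\<exists>L. P \<subseteq> L \<and> compactin (bas M) L \<and>
      compactin (mapspace M) {a \<in> maps M. a ` K \<subseteq> E \<inter> over M L})" if b: "b \<in> c" for b
  proof -
    have "b \<in> topspace (bas M)" using b cB by blast
    from is_bundleD(2)[OF M this] obtain U W f fb where U: "U \<subseteq> topspace (bas M)" "b \<in> bas M interior_of U" "W \<in> Obj C"
      "family_iso C F (restr_family M U) (product_family F (subtopology (bas M) U) W) f fb"
      by (elim exE conjE)
    have op: "openin ?sc (bas M interior_of U \<inter> c)" by (rule openin_subtopology_Int) simp
    have bc: "compactin ?sc {b}" "{b} \<subseteq> bas M interior_of U \<inter> c" using b cB U(2) by auto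
    obtain P L where PL: "openin ?sc P" "compactin ?sc L" "{b} \<subseteq> P" "P \<subseteq> L" "L \<subseteq> bas M interior_of U \<inter> c"
      by (rule compact_neighbourhood_within[OF lc Hc bc(1) op bc(2)])
    have L: "compactin (bas M) L" using PL(2) by (simp add: compactin_subtopology)
    have "closedin (tot M) (over M L)"
      by (rule closedin_over[OF Mf]) (rule compactin_imp_closedin[OF B L])
    then have EL: "compactin (tot M) (E \<inter> over M L)" using E by (rule compact_Int_closedin[rotated])
    have "L \<subseteq> U" using PL(5) interior_of_subset[of "bas M" U] by blast
    then have "E \<inter> over M L \<subseteq> over M U" by (auto simp: over_def)
    from compactin_carried_chart[OF Mf H U(3,4) K EL this] show ?thesis using PL(1,3,4) L by blast
  qed
  then have "\<forall>b\<in>c. \<exists>P. openin ?sc P \<and> b \<in> P \<and> (\<exists>L. P \<subseteq> L \<and> compactin (bas M) L \<and>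
      compactin (mapspace M) {a \<in> maps M. a ` K \<subseteq> E \<inter> over M L})" by blast
  from bchoice[OF this] obtain P where P: "\<forall>b\<in>c. openin ?sc (P b) \<and> b \<in> P b \<and> (\<exists>L. P b \<subseteq> L \<and> compactin (bas M) L \<and>
      compactin (mapspace M) {a \<in> maps M. a ` K \<subseteq> E \<inter> over M L})" by (elim exE)
  then have "\<forall>b\<in>c. \<exists>L. P b \<subseteq> L \<and> compactin (bas M) L \<and>
      compactin (mapspace M) {a \<in> maps M. a ` K \<subseteq> E \<inter> over M L}" by blast
  from bchoice[OF this] obtain L where L: "\<forall>b\<in>c. P b \<subseteq> L b \<and> compactin (bas M) (L b) \<and>
      compactin (mapspace M) {a \<in> maps M. a ` K \<subseteq> E \<inter> over M (L b)}" by (elim exE)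
  have "compactin ?sc c" using c by (simp add: compactin_subtopology)
  then have "\<exists>\<F>. finite \<F> \<and> \<F> \<subseteq> P ` c \<and> c \<subseteq> \<Union>\<F>"
    using P by (intro compactinD) blast+
  then obtain \<F> where F: "finite \<F>" "\<F> \<subseteq> P ` c" "c \<subseteq> \<Union>\<F>" by blast
  obtain I where I: "finite I" "I \<subseteq> c" "\<F> = P ` I" using finite_subset_image[OF F(1,2)] by blast
  have "{a \<in> maps M. a ` K \<subseteq> E} = (\<Union>b\<in>I. {a \<in> maps M. a ` K \<subseteq> E \<inter> over M (L b)})"
  proof
    show "{a \<in> maps M. a ` K \<subseteq> E} \<subseteq> (\<Union>b\<in>I. {a \<in> maps M. a ` K \<subseteq> E \<inter> over M (L b)})"
    proof
      fix a assume "a \<in> {a \<in> maps M. a ` K \<subseteq> E}"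
      then have a: "a \<in> maps M" "a ` K \<subseteq> E" by auto
      obtain t \<phi> where ab: "based M t \<phi> a" using maps_iff_based[OF Mf] a(1) by blast
      have prj: "prj M (a v) = t" if "v \<in> K" for v
        using based_prj[OF ab] compactin_subset_topspace[OF \<K>_compactin[OF K(1)]] that by blast
      obtain v0 where v0: "v0 \<in> K" using K(2) by blast
      then have "t \<in> c" unfolding c_def using prj[OF v0] a(2) by blast
      then obtain b where b: "b \<in> I" "t \<in> P b" using F(3) unfolding I(3) by blast
      then have "t \<in> L b" using L I(2) by blast
      then have "a ` K \<subseteq> over M (L b)"
        using prj a(2) compactin_subset_topspace[OF E] unfolding over_def by auto
      then show "a \<in> (\<Union>b\<in>I. {a \<in> maps M. a ` K \<subseteq> E \<inter> over M (L b)})" using a b(1) by blast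
    qed
  qed blast
  moreover have "compactin (mapspace M) (\<Union>b\<in>I. {a \<in> maps M. a ` K \<subseteq> E \<inter> over M (L b)})"
    using I(1,2) L by (intro compactin_Union) auto
  ultimately show ?thesis by simp
qed

end

section \<open>Extending neighbourhoods over a bundle\<close>

lemma carried_mono:
  assumes "\<And>j. j < n \<Longrightarrow> U j \<subseteq> U' j"
  shows "carried H n K U \<subseteq> carried H n K U'"
  using assms unfolding carried_def by blast

lemma over_mono: "U \<subseteq> T \<Longrightarrow> over X U \<subseteq> over X T"
  by (auto simp: over_def)

context nkc_object
begin

lemma maps_base:
  assumes Y: "is_family C F Y" and a: "a \<in> maps Y"
  obtains b where "b \<in> topspace (bas Y)" "\<forall>v\<in>pts. a v \<in> over Y {b}"
proof -
  obtain b \<phi> where "based Y b \<phi> a" using maps_iff_based[OF Y] a by blast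
  then show thesis by (intro that[of b]) (auto simp: based_def)
qed

text \<open>In use, \<open>c\<close> is a closed cell and \<open>d\<close> its frontier;
  \<open>extend_carrying_open_sets\<close> is applied to the part of the bundle over
  \<open>c\<close>. Compactness of the carried sets comes from the condition at index
  \<open>0\<close>, the others being closed. The dichotomy holds because the base point of a map
  lies in \<open>d\<close> or not.\<close>

lemma extend_over_cell:
  fixes n :: nat
  assumes M: "is_bundle C F M" and B: "Hausdorff_space (bas M)"
    and c: "compactin (bas M) c" "second_countable (subtopology (bas M) c)" and d: "closedin (bas M) d" "d \<subseteq> c"
    and K: "0 < n" "K 0 \<in> \<K>" "K 0 \<noteq> {}" "\<forall>j<n. compactin (fobj F V) (K j)"
    and W: "openin (mapspace M) W"
    and U: "\<forall>j<n. openin (subtopology (tot M) (over M d)) (U j)"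
    and L: "\<forall>j<n. compactin (tot M) (L j) \<and> L j \<subseteq> over M c \<and> L j \<inter> over M d \<subseteq> U j"
    and UW: "carried (maps M) n K U \<subseteq> W" and LW: "carried (maps M) n K L \<subseteq> W"
  obtains P where "\<forall>j<n. openin (subtopology (tot M) (over M c)) (P j) \<and> P j \<inter> over M d = U j \<and> L j \<subseteq> P j"
    "carried (maps M) n K P \<subseteq> W"
proof -
  note Mf = is_bundleD(1)[OF M]
  note H = Hausdorff_bundle[OF M B]
  let ?Y = "subtopology (tot M) (over M c)" and ?A = "over M d"
  have dc: "?A \<subseteq> over M c" using d(2) by (rule over_mono)
  have Ksub: "K j \<subseteq> pts" if "j < n" for j using K(4) that compactin_subset_topspace by blast
  have LC: "locally_compact_space ?Y" by (rule locally_compact_over[OF M B c(1)])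
  have HY: "Hausdorff_space ?Y" using H by (rule Hausdorff_space_subtopology)
  have clo: "closedin (mapspace M) (carried (maps M) n K E)" if E: "\<forall>j<n. compactin ?Y (E j)" for E
    using E H by (intro closedin_carried[OF Mf K(4)]) (simp add: compactin_subtopology compactin_imp_closedin)
  have cpt: "compactin (mapspace M) (carried (maps M) n K E)" if E: "\<forall>j<n. compactin ?Y (E j)" for E
  proof -
    have "compactin (tot M) (E 0)" using E K(1) by (simp add: compactin_subtopology)
    from compactin_carried_bundle[OF M B K(2,3) this]
    have "compactin (mapspace M) {a \<in> maps M. a ` K 0 \<subseteq> E 0}" .
    moreover have "carried (maps M) n K E \<subseteq> {a \<in> maps M. a ` K 0 \<subseteq> E 0}"
      using K(1) by (auto simp: carried_def)
    ultimately show ?thesis using clo[OF E] closed_compactin by blast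
  qed
  have img: "compactin ?Y (a ` K j)" if "a \<in> maps M" "j < n" "a ` K j \<subseteq> topspace ?Y" for a j
    using image_compactin[OF K(4)[rule_format, OF that(2)] maps_continuous[OF Mf that(1)]] that(3)
    by (simp add: compactin_subtopology)
  have dich: "(\<forall>j<n. a ` K j \<subseteq> ?A) \<or> (\<forall>j<n. a ` K j \<inter> ?A = {})" if a: "a \<in> maps M" for a
  proof -
    obtain b where b: "b \<in> topspace (bas M)" "\<forall>v\<in>pts. a v \<in> over M {b}" by (rule maps_base[OF Mf a])
    show ?thesis
    proof (cases "b \<in> d")
      case True
      then have "a v \<in> ?A" if "v \<in> pts" for v using b(2) that by (auto simp: over_def)
      then show ?thesis using Ksub by blast
    next
      case False
      then have "a v \<notin> ?A" if "v \<in> pts" for v using b(2) that by (auto simp: over_def)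
      then show ?thesis using Ksub by blast
    qed
  qed
  have A: "closedin ?Y ?A"
    using closedin_over[OF Mf d(1)] dc by (simp add: closedin_subset_topspace closedin_closed_subtopology[THEN iffD2] closedin_subtopology_Int_closed)
  have sub: "subtopology ?Y ?A = subtopology (tot M) ?A"
    using dc by (simp add: subtopology_subtopology inf.absorb2)
  have dcomp: "compactin (bas M) d" using closed_compactin[OF c(1) d(2,1)] .
  have "second_countable (subtopology (subtopology (bas M) c) d)" using c(2) by (rule second_countable_subtopology)
  then have dsc: "second_countable (subtopology (bas M) d)" using d(2) by (simp add: subtopology_subtopology inf.absorb2)
  have UD: "\<forall>j<n. \<exists>D::nat \<Rightarrow> _. (\<forall>m. compactin ?Y (D m)) \<and> U j = (\<Union>m. D m)"
  proof (intro allI impI)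
    fix j assume "j < n"
    then have Uj: "openin (subtopology (tot M) ?A) (U j)" using U by blast
    obtain D :: "nat \<Rightarrow> _" where D: "\<And>m. compactin (subtopology (tot M) ?A) (D m)" "U j = (\<Union>m. D m)"
      using open_sigma_compact[OF locally_compact_over[OF M B dcomp] Hausdorff_space_subtopology[OF H]
          second_countable_over[OF M B dcomp dsc] Uj] by blast
    have "compactin ?Y (D m)" for m using D(1)[of m] dc by (auto simp: compactin_subtopology)
    then show "\<exists>D::nat \<Rightarrow> _. (\<forall>m. compactin ?Y (D m)) \<and> U j = (\<Union>m. D m)" using D(2) by blast
  qed
  have U': "\<forall>j<n. openin (subtopology ?Y ?A) (U j)" using U by (simp add: sub)
  have L': "\<forall>j<n. compactin ?Y (L j) \<and> L j \<inter> ?A \<subseteq> U j" using L by (simp add: compactin_subtopology)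
  show thesis
  proof (rule extend_carrying_open_sets[of ?Y n "mapspace M" K ?A W U L])
    fix P assume "\<forall>j<n. openin ?Y (P j) \<and> P j \<inter> ?A = U j \<and> L j \<subseteq> P j"
      "carried (topspace (mapspace M)) n K P \<subseteq> W"
    then show thesis by (intro that[of P]) simp_all
  qed (use LC HY cpt clo img dich A W U' UD L' UW LW in simp_all)
qed

text \<open>Induction over the skeleta relative to \<open>A\<close>. Cells of one dimension are
  treated independently, because a map lies over a single point and so over a single open cell. The
  sets \<open>L j\<close> stand for the images of a given map over \<open>t0\<close> that has to
  stay inside; they are absorbed when the cell of \<open>t0\<close> is reached.\<close>

lemma extend_bundle:
  fixes n :: nat
  assumes M: "is_bundle C F M" and cw: "relative_CW (bas M) A E"
    and K: "0 < n" "K 0 \<in> \<K>" "K 0 \<noteq> {}" "\<forall>j<n. compactin (fobj F V) (K j)"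
    and W: "openin (mapspace M) W"
    and U: "\<forall>j<n. openin (subtopology (tot M) (over M A)) (U j)"
    and L: "\<forall>j<n. compactin (tot M) (L j) \<and> L j \<subseteq> over M {t0}" "\<forall>j<n. L j \<inter> over M A \<subseteq> U j"
    and UW: "carried (maps M) n K U \<subseteq> W" and LW: "carried (maps M) n K L \<subseteq> W"
  obtains P where "\<forall>j<n. openin (tot M) (P j) \<and> P j \<inter> over M A = U j \<and> L j \<subseteq> P j"
    "carried (maps M) n K P \<subseteq> W"
proof -
  note Mf = is_bundleD(1)[OF M] and B = relative_CWD(1)[OF cw]
  \<comment> \<open>\<open>A\<close> with all cells of dimension below \<open>k\<close>. The shift
    puts \<open>A\<close> at index \<open>0\<close> and the frontier of a \<open>k\<close>-cell
    inside \<open>st k\<close>.\<close>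
  define st where "st k = A \<union> (\<Union>m<k. \<Union>(fst ` E m))" for k
  have st_Suc: "st (Suc k) = st k \<union> \<Union>(fst ` E k)" for k
    by (auto simp: st_def lessThan_Suc)
  have st_mono: "st k \<subseteq> st l" if "k \<le> l" for k l
    using that unfolding st_def by (intro Un_mono UN_mono) auto
  have st_disj: "e \<inter> st k = {}" if ec: "(e, c) \<in> E m" "k \<le> m" for e c m k
  proof -
    have "e \<inter> fst x = {}" if "x \<in> E l" "l < k" for x l
      using relative_CWD(4)[OF cw ec(1) that(1)] that(2) ec(2) by auto
    then show ?thesis using relative_CWD(6)[OF cw ec(1)] unfolding st_def by blast
  qed
  have bd_st: "c - e \<subseteq> st m" if ec: "(e, c) \<in> E m" for e c m
  proof -
    obtain J where J: "finite J" "J \<subseteq> (\<Union>k<m. E k)" "c - e \<subseteq> A \<union> \<Union>(fst ` J)"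
      using relative_CWD(10)[OF cw ec] by blast
    have "\<Union>(fst ` J) \<subseteq> \<Union>(fst ` (\<Union>k<m. E k))" by (rule Union_mono[OF image_mono[OF J(2)]])
    also have "\<dots> = (\<Union>k<m. \<Union>(fst ` E k))" by auto
    finally show ?thesis using J(3) unfolding st_def by (meson Un_mono order_refl order_trans)
  qed
  have cell_st: "c \<subseteq> st (Suc m)" if ec: "(e, c) \<in> E m" for e c m
  proof -
    have "e \<in> fst ` E m" using image_eqI[OF _ ec, of e fst] by simp
    then have "e \<subseteq> \<Union>(fst ` E m)" by (rule Union_upper)
    then show ?thesis using bd_st[OF ec] unfolding st_Suc by blast
  qed
  have st_all: "\<exists>k. b \<in> st k" if "b \<in> topspace (bas M)" for b
  proof -
    have "b \<in> A \<or> (\<exists>k. b \<in> \<Union>(fst ` E k))" using relative_CWD(3)[OF cw] that by blast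
    then show ?thesis
    proof
      assume "b \<in> A" then show ?thesis by (auto simp: st_def)
    next
      assume "\<exists>k. b \<in> \<Union>(fst ` E k)"
      then obtain k where "b \<in> \<Union>(fst ` E k)" by blast
      then show ?thesis using st_Suc[of k] by blast
    qed
  qed
  have Ksub: "K j \<subseteq> pts" if "j < n" for j using K(4) that compactin_subset_topspace by blast
  \<comment> \<open>The nonempty \<open>K 0\<close> locates the base point: a condition on its image
    alone puts all images of \<open>a\<close> over one point of \<open>T\<close>.\<close>
  have based_in: "\<exists>b. b \<in> T \<and> (\<forall>j<n. a ` K j \<subseteq> over M {b})" if a: "a \<in> maps M" and sub: "a ` K 0 \<subseteq> over M T" for a T
  proof -
    obtain b where b: "b \<in> topspace (bas M)" "\<forall>v\<in>pts. a v \<in> over M {b}" by (rule maps_base[OF Mf a])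
    obtain v where v: "v \<in> K 0" using K(3) by blast
    then have "a v \<in> over M {b}" "a v \<in> over M T" using b(2) Ksub[OF K(1)] sub by auto
    then have "b \<in> T" by (auto simp: over_def)
    moreover have "a ` K j \<subseteq> over M {b}" if "j < n" for j using b(2) Ksub[OF that] by blast
    ultimately show ?thesis by blast
  qed
  have UA: "U j \<subseteq> over M A" if "j < n" for j using U that openin_subset by fastforce
  \<comment> \<open>Openness is required over each closed cell separately; openness in the total
    space is obtained at the end from \<open>bundle_coherent\<close>.\<close>
  define ok where "ok k P \<longleftrightarrow>
      (\<forall>j<n. P j \<subseteq> over M (st k) \<and> P j \<inter> over M A = U j \<and> L j \<inter> over M (st k) \<subseteq> P j) \<and>
      (\<forall>m<k. \<forall>(e, c)\<in>E m. \<forall>j<n. openin (subtopology (tot M) (over M c)) (P j \<inter> over M c)) \<and>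
      carried (maps M) n K P \<subseteq> W" for k P
  define step where "step k P P' \<longleftrightarrow> (\<forall>j<n. P' j \<inter> over M (st k) = P j)" for k :: nat and P P' :: "nat \<Rightarrow> _ set"
  have "\<exists>P'. ok (Suc k) P' \<and> step k P P'" if ok: "ok k P" for k P
  proof -
    have okD: "P j \<subseteq> over M (st k)" "P j \<inter> over M A = U j" "L j \<inter> over M (st k) \<subseteq> P j" if "j < n" for j
      using ok that unfolding ok_def by blast+
    have okE: "openin (subtopology (tot M) (over M c)) (P j \<inter> over M c)" if "m < k" "(e, c) \<in> E m" "j < n" for m e c j
      using ok that unfolding ok_def by blast
    have okW: "carried (maps M) n K P \<subseteq> W" using ok unfolding ok_def by blast
    have cell: "\<exists>Q. (\<forall>j<n. Q j \<subseteq> over M c \<and> openin (subtopology (tot M) (over M c)) (Q j) \<and>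
        Q j \<inter> over M (c - e) = P j \<inter> over M (c - e) \<and> (t0 \<in> e \<longrightarrow> L j \<subseteq> Q j)) \<and> carried (maps M) n K Q \<subseteq> W"
      if ec: "(e, c) \<in> E k" for e c
    proof -
      let ?d = "c - e"
      have d: "closedin (bas M) ?d" "?d \<subseteq> c" using relative_CWD(9)[OF cw ec] by auto
      have clA: "closedin (tot M) (over M A)" by (rule closedin_over[OF Mf relative_CWD(2)[OF cw]])
      have cld: "closedin (tot M) (over M ?d)" by (rule closedin_over[OF Mf d(1)])
      obtain J where J: "finite J" "J \<subseteq> (\<Union>m<k. E m)" "?d \<subseteq> A \<union> \<Union>(fst ` J)"
        using relative_CWD(10)[OF cw ec] by blast
      let ?U = "\<lambda>j. P j \<inter> over M ?d"
      \<comment> \<open>The frontier is covered by \<open>A\<close> and finitely many closed cells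
        of lower dimension, over each of which the complement of \<open>P j\<close> is closed.
        Finiteness makes it closed over the whole frontier.\<close>
      have U': "\<forall>j<n. openin (subtopology (tot M) (over M ?d)) (?U j)"
      proof (intro allI impI)
        fix j assume j: "j < n"
        have diff: "closedin (tot M) (over M Q - G)" if "closedin (tot M) (over M Q)"
          "openin (subtopology (tot M) (over M Q)) (G \<inter> over M Q)" for Q G
        proof -
          have top: "topspace (subtopology (tot M) (over M Q)) = over M Q"
            using over_subset_topspace[of M Q] by auto
          have "closedin (subtopology (tot M) (over M Q)) (over M Q - G \<inter> over M Q)"
            using that(2) closedin_diff[OF closedin_topspace that(2)] unfolding top by blast
          then have "closedin (tot M) (over M Q - G \<inter> over M Q)" using that(1) closedin_trans_full by blast
          moreover have "over M Q - G \<inter> over M Q = over M Q - G" by blast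
          ultimately show ?thesis by simp
        qed
        have "openin (subtopology (tot M) (over M A)) (P j \<inter> over M A)" using U j okD(2)[OF j] by simp
        then have c1: "closedin (tot M) (over M A - P j)" by (rule diff[OF clA])
        have c2: "closedin (tot M) (over M (snd x) - P j)" if x: "x \<in> J" for x
        proof -
          obtain m where m: "m < k" "x \<in> E m" using J(2) x by blast
          then have x': "(fst x, snd x) \<in> E m" by simp
          have "closedin (bas M) (snd x)"
            using relative_CWD(7)[OF cw x'] compactin_imp_closedin[OF B] by blast
          then show ?thesis using diff[OF closedin_over[OF Mf] okE[OF m(1) x' j]] by blast
        qed
        have "over M ?d - P j = over M ?d \<inter> ((over M A - P j) \<union> (\<Union>x\<in>J. over M (snd x) - P j))"
        proof -
          have "fst x \<subseteq> snd x" if x: "x \<in> J" for x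
          proof -
            obtain m where "x \<in> E m" using J(2) x by blast
            then show ?thesis using relative_CWD(5)[OF cw, of "fst x" "snd x" m] by simp
          qed
          then have "?d \<subseteq> A \<union> (\<Union>x\<in>J. snd x)" using J(3) by blast
          then have "over M ?d \<subseteq> over M A \<union> (\<Union>x\<in>J. over M (snd x))" by (auto simp: over_def)
          then show ?thesis by blast
        qed
        moreover have "closedin (tot M) (over M ?d \<inter> ((over M A - P j) \<union> (\<Union>x\<in>J. over M (snd x) - P j)))"
          using J(1) c1 c2 cld by (intro closedin_Int closedin_Un closedin_Union) auto
        ultimately have "closedin (tot M) (over M ?d - P j)" by simp
        then have "openin (tot M) (topspace (tot M) - (over M ?d - P j))" by blast
        then have "openin (subtopology (tot M) (over M ?d)) ((topspace (tot M) - (over M ?d - P j)) \<inter> over M ?d)"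
          by (rule openin_subtopology_Int)
        moreover have "(topspace (tot M) - (over M ?d - P j)) \<inter> over M ?d = ?U j"
          using over_subset_topspace[of M ?d] by blast
        ultimately show "openin (subtopology (tot M) (over M ?d)) (?U j)" by simp
      qed
      \<comment> \<open>Only the cell containing \<open>t0\<close> has to absorb \<open>L j\<close>.
        Its frontier misses \<open>t0\<close>, so no compatibility with \<open>P j\<close> arises
        there.\<close>
      let ?L = "\<lambda>j. if t0 \<in> e then L j else {}"
      have L': "\<forall>j<n. compactin (tot M) (?L j) \<and> ?L j \<subseteq> over M c \<and> ?L j \<inter> over M ?d \<subseteq> ?U j"
      proof (cases "t0 \<in> e")
        case True
        then have "over M {t0} \<subseteq> over M c" "over M {t0} \<inter> over M ?d = {}"
          using relative_CWD(5)[OF cw ec] by (auto simp: over_def)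
        then show ?thesis using L(1) True unfolding if_P[OF True] by blast
      qed simp
      have UW': "carried (maps M) n K ?U \<subseteq> W"
        by (rule subset_trans[OF carried_mono okW]) blast
      have LW': "carried (maps M) n K ?L \<subseteq> W"
        by (rule subset_trans[OF carried_mono LW]) simp
      obtain Q where Q: "\<forall>j<n. openin (subtopology (tot M) (over M c)) (Q j) \<and> Q j \<inter> over M ?d = ?U j \<and> ?L j \<subseteq> Q j"
        "carried (maps M) n K Q \<subseteq> W"
        by (rule extend_over_cell[OF M B relative_CWD(7,8)[OF cw ec] d K W U' L' UW' LW'])
      show ?thesis
      proof (intro exI[of _ Q] conjI allI impI)
        fix j assume j: "j < n"
        show op: "openin (subtopology (tot M) (over M c)) (Q j)"
          and "Q j \<inter> over M ?d = P j \<inter> over M ?d" using Q(1) j by blast+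
        show "Q j \<subseteq> over M c" using openin_subset[OF op] by simp
        show "L j \<subseteq> Q j" if "t0 \<in> e" using Q(1)[rule_format, OF j] that by simp
      qed (rule Q(2))
    qed
    have "\<forall>x\<in>E k. \<exists>Q. (\<forall>j<n. Q j \<subseteq> over M (snd x) \<and> openin (subtopology (tot M) (over M (snd x))) (Q j) \<and>
        Q j \<inter> over M (snd x - fst x) = P j \<inter> over M (snd x - fst x) \<and> (t0 \<in> fst x \<longrightarrow> L j \<subseteq> Q j)) \<and>
        carried (maps M) n K Q \<subseteq> W"
    proof
      fix x assume "x \<in> E k"
      then have "(fst x, snd x) \<in> E k" by simp
      from cell[OF this] show "\<exists>Q. (\<forall>j<n. Q j \<subseteq> over M (snd x) \<and> openin (subtopology (tot M) (over M (snd x))) (Q j) \<and>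
        Q j \<inter> over M (snd x - fst x) = P j \<inter> over M (snd x - fst x) \<and> (t0 \<in> fst x \<longrightarrow> L j \<subseteq> Q j)) \<and>
        carried (maps M) n K Q \<subseteq> W" .
    qed
    from bchoice[OF this] obtain Q where Q: "\<forall>x\<in>E k. (\<forall>j<n. Q x j \<subseteq> over M (snd x) \<and>
        openin (subtopology (tot M) (over M (snd x))) (Q x j) \<and>
        Q x j \<inter> over M (snd x - fst x) = P j \<inter> over M (snd x - fst x) \<and> (t0 \<in> fst x \<longrightarrow> L j \<subseteq> Q x j)) \<and>
        carried (maps M) n K (Q x) \<subseteq> W"
      by (elim exE)
    \<comment> \<open>Each \<open>Q x\<close> contributes over its open cell only. Different cells
      cannot conflict, and nothing changes over \<open>st k\<close>.\<close>
    define P' where "P' j = P j \<union> (\<Union>x\<in>E k. Q x j \<inter> over M (fst x))" for j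
    have fst_disj: "over M (fst x) \<inter> over M (st k) = {}" if "x \<in> E k" for x
      using st_disj[of "fst x" "snd x" k k] that by (auto simp: over_def)
    have P'_st: "P' j \<inter> over M (st k) = P j" if "j < n" for j
      using okD(1)[OF that] fst_disj unfolding P'_def by blast
    have P'_cell: "P' j \<inter> over M (fst x) = Q x j \<inter> over M (fst x)" if x: "x \<in> E k" and j: "j < n" for x j
    proof -
      have "over M (fst y) \<inter> over M (fst x) = {}" if "y \<in> E k" "y \<noteq> x" for y
        using relative_CWD(4)[OF cw that(1) x] that(2) by (auto simp: over_def)
      then show ?thesis using okD(1)[OF j] fst_disj[OF x] x unfolding P'_def by blast
    qed
    have A_st: "over M A \<subseteq> over M (st k)" by (rule over_mono) (auto simp: st_def)
    have "ok (Suc k) P'"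
      unfolding ok_def
    proof (intro conjI allI impI)
      fix j assume j: "j < n"
      show "P' j \<subseteq> over M (st (Suc k))"
        using okD(1)[OF j] unfolding P'_def st_Suc by (auto simp: over_def)
      show "P' j \<inter> over M A = U j" using P'_st[OF j] okD(2)[OF j] A_st by blast
      show "L j \<inter> over M (st (Suc k)) \<subseteq> P' j"
      proof
        fix y assume y: "y \<in> L j \<inter> over M (st (Suc k))"
        then have "prj M y = t0" using L(1) j by (auto simp: over_def)
        then have "t0 \<in> st k \<or> (\<exists>x\<in>E k. t0 \<in> fst x)" using y unfolding st_Suc by (auto simp: over_def)
        then show "y \<in> P' j"
        proof
          assume "t0 \<in> st k"
          then have "y \<in> over M (st k)" using y \<open>prj M y = t0\<close> by (simp add: over_def)
          then show ?thesis using okD(3)[OF j] y unfolding P'_def by blast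
        next
          assume "\<exists>x\<in>E k. t0 \<in> fst x"
          then obtain x where x: "x \<in> E k" "t0 \<in> fst x" by blast
          then have "y \<in> over M (fst x)" using y \<open>prj M y = t0\<close> by (simp add: over_def)
          moreover have "L j \<subseteq> Q x j" using Q x j by blast
          ultimately show ?thesis using y x(1) unfolding P'_def by blast
        qed
      qed
    next
      fix m assume "m < Suc k"
      have "openin (subtopology (tot M) (over M c)) (P' j \<inter> over M c)" if ec: "(e, c) \<in> E m" and j: "j < n" for e c j
      proof (cases "m = k")
        case False
        then have m: "m < k" using \<open>m < Suc k\<close> by simp
        have "over M c \<subseteq> over M (st k)"
          using cell_st[OF ec] st_mono[of "Suc m" k] m by (intro over_mono) auto
        then have "P' j \<inter> over M c = P j \<inter> over M c" using P'_st[OF j] by blast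
        then show ?thesis using okE[OF m ec j] by simp
      next
        case True
        then have ec: "(e, c) \<in> E k" using ec by simp
        have q: "Q (e, c) j \<subseteq> over M c" "openin (subtopology (tot M) (over M c)) (Q (e, c) j)"
           "Q (e, c) j \<inter> over M (c - e) = P j \<inter> over M (c - e)"
          using Q ec j by fastforce+
        have "over M (c - e) \<subseteq> over M (st k)" by (rule over_mono[OF bd_st[OF ec]])
        then have 1: "P' j \<inter> over M (c - e) = Q (e, c) j \<inter> over M (c - e)" using P'_st[OF j] q(3) by blast
        have 2: "P' j \<inter> over M e = Q (e, c) j \<inter> over M e" using P'_cell[OF ec j] by simp
        have "over M c = over M e \<union> over M (c - e)" using relative_CWD(5)[OF cw ec] by (auto simp: over_def)
        then have "P' j \<inter> over M c = Q (e, c) j" using 1 2 q(1) by blast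
        then show ?thesis using q(2) by simp
      qed
      then show "\<forall>(e, c)\<in>E m. \<forall>j<n. openin (subtopology (tot M) (over M c)) (P' j \<inter> over M c)" by blast
    next
      show "carried (maps M) n K P' \<subseteq> W"
      proof
        fix a assume "a \<in> carried (maps M) n K P'"
        then have a: "a \<in> maps M" "\<forall>j<n. a ` K j \<subseteq> P' j" by (auto simp: carried_def)
        have "P' 0 \<subseteq> over M (st (Suc k))"
          using okD(1)[OF K(1)] unfolding P'_def st_Suc by (auto simp: over_def)
        then have "a ` K 0 \<subseteq> over M (st (Suc k))" using a(2) K(1) by blast
        from based_in[OF a(1) this] obtain b where b: "b \<in> st (Suc k)" "\<forall>j<n. a ` K j \<subseteq> over M {b}" by blast
        then have "b \<in> st k \<or> (\<exists>x\<in>E k. b \<in> fst x)" unfolding st_Suc by blast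
        then show "a \<in> W"
        proof
          assume "b \<in> st k"
          then have "over M {b} \<subseteq> over M (st k)" by (intro over_mono) simp
          then have "a ` K j \<subseteq> P j" if "j < n" for j using P'_st[OF that] a(2) b(2) that by blast
          then show ?thesis using okW a(1) by (auto simp: carried_def)
        next
          assume "\<exists>x\<in>E k. b \<in> fst x"
          then obtain x where x: "x \<in> E k" "b \<in> fst x" by blast
          then have "over M {b} \<subseteq> over M (fst x)" by (intro over_mono) simp
          then have "a ` K j \<subseteq> Q x j" if "j < n" for j using P'_cell[OF x(1) that] a(2) b(2) that by blast
          then have "a \<in> carried (maps M) n K (Q x)" using a(1) by (auto simp: carried_def)
          then show ?thesis using Q x(1) by blast
        qed
      qed
    qed
    moreover have "step k P P'" using P'_st by (simp add: step_def)
    ultimately show ?thesis by blast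
  qed
  moreover have "ok 0 U"
  proof -
    have "st 0 = A" by (simp add: st_def)
    then show ?thesis unfolding ok_def using UA UW L(2) by auto
  qed
  ultimately have "\<exists>f. \<forall>k. ok k (f k) \<and> step k (f k) (f (Suc k))"
    by (intro dependent_nat_choice) blast+
  then obtain f where f: "\<And>k. ok k (f k)" "\<And>k. step k (f k) (f (Suc k))" by blast
  have f_later: "f l j \<inter> over M (st k) = f k j" if j: "j < n" and kl: "k \<le> l" for k l j
    using kl
  proof (induction rule: dec_induct)
    case base
    then show ?case using f(1)[of k] j unfolding ok_def by blast
  next
    case (step l)
    have "f (Suc l) j \<inter> over M (st l) = f l j" using f(2)[of l] j unfolding step_def by blast
    moreover have "over M (st k) \<subseteq> over M (st l)" using st_mono[OF step(1)] by (rule over_mono)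
    ultimately show ?case using step.IH by blast
  qed
  \<comment> \<open>Later stages restrict to earlier ones, so the union has trace \<open>f k\<close>
    over \<open>st k\<close>.\<close>
  define R where "R j = (\<Union>k. f k j)" for j
  have R_st: "R j \<inter> over M (st k) = f k j" if j: "j < n" for j k
  proof -
    have "f l j \<inter> over M (st k) \<subseteq> f k j" for l
    proof (cases "k \<le> l")
      case True
      then show ?thesis using f_later[OF j True] by blast
    next
      case False
      then show ?thesis using f_later[OF j, of l k] by auto
    qed
    moreover have "f k j \<subseteq> over M (st k)" using f(1)[of k] j unfolding ok_def by blast
    ultimately show ?thesis unfolding R_def by blast
  qed
  have R_top: "R j \<subseteq> topspace (tot M)" if "j < n" for j
  proof -
    have "f k j \<subseteq> over M (st k)" for k using f(1)[of k] that unfolding ok_def by blast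
    then show ?thesis unfolding R_def using over_subset_topspace[of M] by blast
  qed
  have st0: "st 0 = A" by (simp add: st_def)
  have RA: "R j \<inter> over M A = U j" if "j < n" for j
  proof -
    have "f 0 j = U j" using f(1)[of 0] that UA[OF that] unfolding ok_def st0 by blast
    then show ?thesis using R_st[OF that, of 0] unfolding st0 by simp
  qed
  show thesis
  proof (rule that[of R])
    show "\<forall>j<n. openin (tot M) (R j) \<and> R j \<inter> over M A = U j \<and> L j \<subseteq> R j"
    proof (intro allI impI conjI)
      fix j assume j: "j < n"
      show "R j \<inter> over M A = U j" by (rule RA[OF j])
      show "openin (tot M) (R j)"
      proof (rule bundle_coherent[OF M cw R_top[OF j]])
        show "openin (subtopology (tot M) (over M A)) (R j \<inter> over M A)" using U j RA[OF j] by simp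
        fix m e c assume ec: "(e, c) \<in> E m"
        have "over M c \<subseteq> over M (st (Suc m))" by (rule over_mono[OF cell_st[OF ec]])
        then have "R j \<inter> over M c = f (Suc m) j \<inter> over M c" using R_st[OF j, of "Suc m"] by blast
        moreover have "openin (subtopology (tot M) (over M c)) (f (Suc m) j \<inter> over M c)"
          using f(1)[of "Suc m"] ec j unfolding ok_def by blast
        ultimately show "openin (subtopology (tot M) (over M c)) (R j \<inter> over M c)" by simp
      qed
      show "L j \<subseteq> R j"
      proof
        fix y assume y: "y \<in> L j"
        then have yt: "y \<in> topspace (tot M)" using L(1) j compactin_subset_topspace by blast
        then obtain k where "prj M y \<in> st k" using st_all is_familyD(5)[OF Mf] by blast
        then have "y \<in> L j \<inter> over M (st k)" using y yt by (simp add: over_def)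
        moreover have "L j \<inter> over M (st k) \<subseteq> f k j" using f(1)[of k] j unfolding ok_def by blast
        ultimately show "y \<in> R j" unfolding R_def by blast
      qed
    qed
    show "carried (maps M) n K R \<subseteq> W"
    proof
      fix a assume "a \<in> carried (maps M) n K R"
      then have a: "a \<in> maps M" "\<forall>j<n. a ` K j \<subseteq> R j" by (auto simp: carried_def)
      have "topspace (tot M) \<subseteq> over M (topspace (bas M))"
        using is_familyD(5)[OF Mf] by (auto simp: over_def)
      then have "a ` K 0 \<subseteq> over M (topspace (bas M))"
        using a(2)[rule_format, OF K(1)] R_top[OF K(1)] by (meson subset_trans)
      from based_in[OF a(1) this] obtain b where b: "b \<in> topspace (bas M)" "\<forall>j<n. a ` K j \<subseteq> over M {b}" by blast
      obtain k where "b \<in> st k" using st_all[OF b(1)] by blast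
      then have "over M {b} \<subseteq> over M (st k)" by (intro over_mono) simp
      then have "a ` K j \<subseteq> f k j" if "j < n" for j using R_st[OF that, of k] a(2) b(2) that by blast
      then have "a \<in> carried (maps M) n K (f k)" using a(1) by (auto simp: carried_def)
      then show "a \<in> W" using f(1)[of k] unfolding ok_def by blast
    qed
  qed
qed

end

section \<open>Function spaces of push-outs and colimits\<close>

lemma topspace_adjunction_space:
  assumes "\<And>y. y \<in> A \<Longrightarrow> y \<in> topspace Y \<Longrightarrow> h y \<in> topspace X"
  shows "topspace (adjunction_space X Y A h) = topspace X <+> (topspace Y - A)"
proof
  show "topspace (adjunction_space X Y A h) \<subseteq> topspace X <+> (topspace Y - A)"
    using openin_topspace[of "adjunction_space X Y A h"] unfolding openin_adjunction_space by blast
  have "{x \<in> topspace X. Inl x \<in> topspace X <+> (topspace Y - A)} = topspace X"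
    "{y \<in> topspace Y. glue A h y \<in> topspace X <+> (topspace Y - A)} = topspace Y"
    using assms by (auto simp: glue_def)
  then have "openin (adjunction_space X Y A h) (topspace X <+> (topspace Y - A))"
    unfolding openin_adjunction_space by simp
  then show "topspace X <+> (topspace Y - A) \<subseteq> topspace (adjunction_space X Y A h)"
    by (rule openin_subset)
qed

lemma continuous_map_glue:
  assumes "\<And>y. y \<in> A \<Longrightarrow> y \<in> topspace Y \<Longrightarrow> h y \<in> topspace X"
  shows "continuous_map Y (adjunction_space X Y A h) (glue A h)"
  unfolding continuous_map_def
proof (intro conjI allI impI)
  have top: "topspace (adjunction_space X Y A h) = topspace X <+> (topspace Y - A)"
    by (rule topspace_adjunction_space) (rule assms)
  show "glue A h \<in> topspace Y \<rightarrow> topspace (adjunction_space X Y A h)"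
    unfolding top using assms by (auto simp: glue_def)
qed (simp add: openin_adjunction_space)

lemma pushout_simps:
  "tot (pushout_family X Y A h hb) = adjunction_space (tot X) (tot Y) (over Y A) h"
  "bas (pushout_family X Y A h hb) = adjunction_space (bas X) (bas Y) A hb"
  "prj (pushout_family X Y A h hb) = map_sum (prj X) (prj Y)"
  "fib (pushout_family X Y A h hb) (Inl b) = fib X b" "fib (pushout_family X Y A h hb) (Inr c) = fib Y c"
  "chart (pushout_family X Y A h hb) (Inl b) (Inl x) = chart X b x"
  "chart (pushout_family X Y A h hb) (Inr c) (Inr y) = chart Y c y"
  by (simp_all add: pushout_family_def)

text \<open>The functor \<open>G\<close> is arbitrary because two push-outs are considered: with
  \<open>F\<close> for the one that forms a stage of the bundle, and with \<open>F^V\<close> for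
  that of the function families.\<close>

locale gluing =
  fixes C :: "('o, 'm) category" and G :: "('o, 'm, 'f) top_functor"
    and X :: "('o, 'f, 'x, 'b) family" and Y :: "('o, 'f, 'y, 'c) family" and A h hb
  assumes X: "is_family C G X" and Y: "is_family C G Y"
    and h: "family_map C G (restr_family Y A) X h hb"
begin

abbreviation "P \<equiv> pushout_family X Y A h hb"

lemma h_in: "y \<in> over Y A \<Longrightarrow> h y \<in> topspace (tot X)"
  using family_mapD(4)[OF h, of y] over_subset_topspace[of Y A] by auto

lemma hb_in: "c \<in> A \<Longrightarrow> c \<in> topspace (bas Y) \<Longrightarrow> hb c \<in> topspace (bas X)"
  using family_mapD(5)[OF h, of c] by auto

lemma topspace_tot: "topspace (tot P) = topspace (tot X) <+> (topspace (tot Y) - over Y A)"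
  unfolding pushout_simps by (rule topspace_adjunction_space) (rule h_in)

lemma topspace_bas: "topspace (bas P) = topspace (bas X) <+> (topspace (bas Y) - A)"
  unfolding pushout_simps by (rule topspace_adjunction_space) (rule hb_in)

lemma over_Inl: "over P {Inl b} = Inl ` over X {b}"
  unfolding over_def topspace_tot by (auto simp: pushout_simps)

lemma over_Inr: "c \<notin> A \<Longrightarrow> over P {Inr c} = Inr ` over Y {c}"
  unfolding over_def topspace_tot by (auto simp: pushout_simps over_def)

lemma charted: "charted G P"
  unfolding charted_def
proof
  fix b assume b: "b \<in> topspace (bas P)"
  show "bij_betw (chart P b) (over P {b}) (topspace (fobj G (fib P b)))"
  proof (cases b)
    case (Inl x)
    then have "x \<in> topspace (bas X)" using b topspace_bas by auto
    then have "bij_betw (chart X x) (over X {x}) (topspace (fobj G (fib X x)))"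
      using is_familyD(2)[OF X] by (simp add: charted_def)
    then show ?thesis unfolding Inl over_Inl
      by (auto simp: bij_betw_def inj_on_def pushout_simps image_image)
  next
    case (Inr c)
    then have c: "c \<in> topspace (bas Y)" "c \<notin> A" using b topspace_bas by auto
    then have "bij_betw (chart Y c) (over Y {c}) (topspace (fobj G (fib Y c)))"
      using is_familyD(2)[OF Y] by (simp add: charted_def)
    then show ?thesis unfolding Inr over_Inr[OF c(2)]
      by (auto simp: bij_betw_def inj_on_def pushout_simps image_image)
  qed
qed

end

lemma (in mapping_object) openin_carried:
  assumes K: "\<forall>j<n. compactin (fobj F V) (K j)" and Q: "\<forall>j<n. openin (tot Y) (Q j)"
  shows "openin (mapspace Y) (carried (maps Y) n K Q)"
proof -
  have "carried (maps Y) n K Q = \<Inter>(insert (maps Y) ((\<lambda>j. {a \<in> maps Y. a ` K j \<subseteq> Q j}) ` {..<n}))"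
    by (auto simp: carried_def)
  moreover have "openin (mapspace Y) (\<Inter>(insert (maps Y) ((\<lambda>j. {a \<in> maps Y. a ` K j \<subseteq> Q j}) ` {..<n})))"
  proof (rule openin_Inter)
    fix T assume "T \<in> insert (maps Y) ((\<lambda>j. {a \<in> maps Y. a ` K j \<subseteq> Q j}) ` {..<n})"
    then show "openin (mapspace Y) T"
    proof
      assume "T = maps Y"
      then show ?thesis using openin_topspace[of "mapspace Y"] by (simp only: topspace_function_space)
    next
      assume "T \<in> (\<lambda>j. {a \<in> maps Y. a ` K j \<subseteq> Q j}) ` {..<n}"
      then obtain j where j: "j < n" "T = {a \<in> maps Y. a ` K j \<subseteq> Q j}" by blast
      show ?thesis unfolding j(2) using K Q j(1) by (intro openin_function_space_NKU) blast+
    qed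
  qed auto
  ultimately show ?thesis by simp
qed

section \<open>One attaching step\<close>

locale pushout_step = nkc_object C F V
  for C :: "('o, 'm) category" and F :: "('o, 'm, 'a) top_functor" and V :: 'o +
  fixes X M :: "('o, 'a, 'a, 'a) family" and F0 F1 A :: "'a set" and h hb k kb :: "'a \<Rightarrow> 'a"
    and E :: "nat \<Rightarrow> ('a set \<times> 'a set) set"
  assumes X: "is_family C F X" and M: "is_bundle C F M" and cw: "relative_CW (bas M) A E"
    and F01: "F0 \<subseteq> F1"
    and h: "family_map C F (restr_family M A) (restr_family X F0) h hb"
    and iso: "family_iso C F (pushout_family (restr_family X F0) M A h hb) (restr_family X F1)
      (case_sum id k) (case_sum id kb)"
begin

abbreviation "Y0 \<equiv> restr_family X F0"
abbreviation "Y1 \<equiv> restr_family X F1"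

lemma Mf: "is_family C F M"
  by (rule is_bundleD(1)[OF M])

lemma Y0: "is_family C F Y0" and Y1: "is_family C F Y1"
  by (rule is_family_restr[OF X])+

sublocale g: gluing C F Y0 M A h hb
  by (intro gluing.intro Y0 Mf h)

text \<open>The structure map of the push-out from \<open>M\<close> to the new stage. The given
  \<open>k\<close> describes it only off \<open>A\<close>; over \<open>A\<close> it is the attaching
  map.\<close>

definition \<kappa> where "\<kappa> x = (if x \<in> over M A then h x else k x)"
definition \<kappa>b where "\<kappa>b t = (if t \<in> A then hb t else kb t)"

lemma glue_\<kappa>: "case_sum id k (glue (over M A) h x) = \<kappa> x" "case_sum id kb (glue A hb t) = \<kappa>b t"
  by (simp_all add: glue_def \<kappa>_def \<kappa>b_def)

lemma iso_map: "family_map C F g.P Y1 (case_sum id k) (case_sum id kb)"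
  using iso by (simp add: family_iso_def)

lemma top_Y0: "topspace (tot Y0) = over X F0" and top_Y1: "topspace (tot Y1) = over X F1"
  using over_subset_topspace[of X] by auto

lemma Y0_sub_Y1: "over X F0 \<subseteq> over X F1"
  using F01 by (rule over_mono)

lemma \<kappa>_family_map: "family_map C F M Y1 \<kappa> \<kappa>b"
  unfolding charted_family_map_iff[OF is_familyD(2)[OF Mf]]
proof (intro conjI ballI)
  have "continuous_map (tot M) (tot g.P) (glue (over M A) h)"
    unfolding pushout_simps by (rule continuous_map_glue) (rule g.h_in)
  from continuous_map_compose[OF this family_mapD(1)[OF iso_map]]
  show "continuous_map (tot M) (tot Y1) \<kappa>" by (simp only: o_def glue_\<kappa>)
  have "continuous_map (bas M) (bas g.P) (glue A hb)"
    unfolding pushout_simps by (rule continuous_map_glue) (rule g.hb_in)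
  from continuous_map_compose[OF this family_mapD(2)[OF iso_map]]
  show "continuous_map (bas M) (bas Y1) \<kappa>b" by (simp only: o_def glue_\<kappa>)
  show "prj Y1 (\<kappa> x) = \<kappa>b (prj M x)" if x: "x \<in> topspace (tot M)" for x
  proof (cases "x \<in> over M A")
    case True
    then show ?thesis using family_mapD(3)[OF h, of x] x by (simp add: \<kappa>_def \<kappa>b_def over_def)
  next
    case False
    then have "prj M x \<notin> A" using x by (simp add: over_def)
    moreover have "Inr x \<in> topspace (tot g.P)" using False x by (simp add: g.topspace_tot InrI)
    ultimately show ?thesis using family_mapD(3)[OF iso_map, of "Inr x"] False
      by (simp add: \<kappa>_def \<kappa>b_def pushout_simps)
  qed
  fix t assume t: "t \<in> topspace (bas M)"
  show "\<exists>\<phi>\<in>hom C (fib M t) (fib Y1 (\<kappa>b t)). \<forall>x\<in>over M {t}. chart Y1 (\<kappa>b t) (\<kappa> x) = fmap F \<phi> (chart M t x)"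
  proof (cases "t \<in> A")
    case True
    then have "t \<in> topspace (bas (restr_family M A))" using t by simp
    then have "\<exists>\<phi>\<in>hom C (fib (restr_family M A) t) (fib Y0 (hb t)). \<forall>x\<in>over (restr_family M A) {t}.
        chart Y0 (hb t) (h x) = fmap F \<phi> (chart (restr_family M A) t x)"
      using h unfolding charted_family_map_iff[OF is_familyD(2)[OF is_family_restr[OF Mf]]] by blast
    then have "\<exists>\<phi>\<in>hom C (fib M t) (fib X (hb t)). \<forall>x\<in>over M {t}.
        chart X (hb t) (h x) = fmap F \<phi> (chart M t x)"
      by (simp only: restr_simps over_restr_point[OF True])
    then obtain \<phi> where \<phi>: "\<phi> \<in> hom C (fib M t) (fib X (hb t))"
      "\<forall>x\<in>over M {t}. chart X (hb t) (h x) = fmap F \<phi> (chart M t x)" by blast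
    have "\<kappa> x = h x" if "x \<in> over M {t}" for x using that True by (auto simp: \<kappa>_def over_def)
    then show ?thesis using \<phi> True by (intro bexI[of _ \<phi>]) (auto simp: \<kappa>b_def)
  next
    case False
    then have "Inr t \<in> topspace (bas g.P)" using t by (simp add: g.topspace_bas InrI)
    then obtain \<phi> where \<phi>: "\<phi> \<in> hom C (fib g.P (Inr t)) (fib Y1 (case_sum id kb (Inr t)))"
      "\<forall>z\<in>over g.P {Inr t}. chart Y1 (case_sum id kb (Inr t)) (case_sum id k z) = fmap F \<phi> (chart g.P (Inr t) z)"
      using iso_map unfolding charted_family_map_iff[OF g.charted] by blast
    have "chart X (kb t) (k x) = fmap F \<phi> (chart M t x)" if "x \<in> over M {t}" for x
      using \<phi>(2) that by (auto simp: g.over_Inr[OF False] pushout_simps)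
    moreover have "\<kappa> x = k x" if "x \<in> over M {t}" for x using that False by (auto simp: \<kappa>_def over_def)
    ultimately show ?thesis using \<phi>(1) False by (intro bexI[of _ \<phi>]) (auto simp: \<kappa>b_def pushout_simps)
  qed
qed

text \<open>An inverse on total spaces, fixed by choice so that \<open>\<rho>\<close> can be a
  constant of the locale. The accompanying base map is obtained anew where it is used.\<close>

definition unglue where
  "unglue = (SOME g. \<exists>gb. family_map C F Y1 g.P g gb \<and>
     homeomorphic_maps (tot g.P) (tot Y1) (case_sum id k) g \<and>
     homeomorphic_maps (bas g.P) (bas Y1) (case_sum id kb) gb)"

lemma unglue:
  obtains gb where "family_map C F Y1 g.P unglue gb"
    "homeomorphic_maps (tot g.P) (tot Y1) (case_sum id k) unglue"
    "homeomorphic_maps (bas g.P) (bas Y1) (case_sum id kb) gb"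
proof -
  have "\<exists>g gb. family_map C F Y1 g.P g gb \<and>
     homeomorphic_maps (tot g.P) (tot Y1) (case_sum id k) g \<and>
     homeomorphic_maps (bas g.P) (bas Y1) (case_sum id kb) gb"
    by (rule family_iso_homeomorphic_maps[OF iso]) blast
  from someI_ex[OF this] show thesis using that unfolding unglue_def by blast
qed

text \<open>The inverse of \<open>\<kappa>\<close> from the new part of the stage to the part of
  \<open>M\<close> off \<open>A\<close>; on the old part \<open>projr\<close> gives no meaningful
  value.\<close>

definition \<rho> where "\<rho> y = projr (unglue y)"

lemma hom_tot: "homeomorphic_maps (tot g.P) (tot Y1) (case_sum id k) unglue"
  by (rule unglue)

lemma unglue_left: "z \<in> topspace (tot g.P) \<Longrightarrow> unglue (case_sum id k z) = z"
  using hom_tot unfolding homeomorphic_maps_def by blast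

lemma unglue_right: "y \<in> over X F1 \<Longrightarrow> case_sum id k (unglue y) = y"
  using hom_tot unfolding homeomorphic_maps_def top_Y1 by blast

lemma unglue_in: "y \<in> over X F1 \<Longrightarrow> unglue y \<in> topspace (tot g.P)"
  using hom_tot unfolding homeomorphic_maps_def top_Y1[symmetric] by (auto simp: continuous_map_def)

lemma unglue_Inl: "x \<in> over X F0 \<Longrightarrow> unglue x = Inl x"
  using unglue_left[of "Inl x"] unfolding g.topspace_tot top_Y0 by auto

lemma \<rho>_\<kappa>:
  assumes "x \<in> topspace (tot M)" "x \<notin> over M A"
  shows "\<rho> (\<kappa> x) = x" "\<kappa> x \<notin> over X F0" "unglue (\<kappa> x) = Inr x"
proof -
  have "Inr x \<in> topspace (tot g.P)" using assms by (simp add: g.topspace_tot InrI)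
  then show 1: "unglue (\<kappa> x) = Inr x" using unglue_left[of "Inr x"] assms(2) by (simp add: \<kappa>_def)
  then show "\<rho> (\<kappa> x) = x" by (simp add: \<rho>_def)
  show "\<kappa> x \<notin> over X F0" using unglue_Inl[of "\<kappa> x"] 1 by auto
qed

lemma \<kappa>_\<rho>:
  assumes "y \<in> over X F1" "y \<notin> over X F0"
  shows "\<rho> y \<in> topspace (tot M)" "\<rho> y \<notin> over M A" "\<kappa> (\<rho> y) = y" "unglue y = Inr (\<rho> y)"
proof -
  have in_P: "unglue y \<in> topspace (tot Y0) <+> (topspace (tot M) - over M A)"
    using unglue_in[OF assms(1)] unfolding g.topspace_tot .
  have "unglue y \<noteq> Inl x" for x
  proof
    assume "unglue y = Inl x"
    then have "y = x" "x \<in> over X F0" using unglue_right[OF assms(1)] in_P unfolding top_Y0 by auto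
    then show False using assms(2) by simp
  qed
  then obtain x where x: "unglue y = Inr x" by (cases "unglue y") auto
  then have x': "x \<in> topspace (tot M)" "x \<notin> over M A" using in_P by auto
  have "\<rho> y = x" using x by (simp add: \<rho>_def)
  moreover have "k x = y" using unglue_right[OF assms(1)] x by simp
  ultimately show "\<rho> y \<in> topspace (tot M)" "\<rho> y \<notin> over M A" "\<kappa> (\<rho> y) = y" "unglue y = Inr (\<rho> y)"
    using x x' by (simp_all add: \<kappa>_def)
qed

text \<open>The push-out topology carried over along the given isomorphism: openness in the new
  stage may be tested on the old stage and on \<open>M\<close>.\<close>

lemma openin_Y1:
  assumes "G \<subseteq> over X F1" "openin (tot Y0) (G \<inter> over X F0)" "openin (tot M) {y \<in> topspace (tot M). \<kappa> y \<in> G}"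
  shows "openin (tot Y1) G"
proof -
  let ?T = "{z \<in> topspace (tot g.P). case_sum id k z \<in> G}"
  have "openin (tot g.P) ?T"
    unfolding pushout_simps openin_adjunction_space
  proof (intro conjI)
    show "{z \<in> topspace (adjunction_space (tot Y0) (tot M) (over M A) h). case_sum id k z \<in> G}
        \<subseteq> topspace (tot Y0) <+> (topspace (tot M) - over M A)"
      using g.topspace_tot unfolding pushout_simps by blast
    have "{x \<in> topspace (tot Y0). Inl x \<in> ?T} = G \<inter> over X F0"
      unfolding g.topspace_tot top_Y0 by auto
    then show "openin (tot Y0) {x \<in> topspace (tot Y0). Inl x \<in> {z \<in> topspace (adjunction_space (tot Y0) (tot M) (over M A) h). case_sum id k z \<in> G}}"
      using assms(2) unfolding pushout_simps by simp
    have "glue (over M A) h y \<in> topspace (tot g.P)" if "y \<in> topspace (tot M)" for y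
      using g.h_in that unfolding g.topspace_tot glue_def by auto
    then have "{y \<in> topspace (tot M). glue (over M A) h y \<in> ?T} = {y \<in> topspace (tot M). \<kappa> y \<in> G}"
      using glue_\<kappa>(1) by auto
    then show "openin (tot M) {y \<in> topspace (tot M). glue (over M A) h y \<in> {z \<in> topspace (adjunction_space (tot Y0) (tot M) (over M A) h). case_sum id k z \<in> G}}"
      using assms(3) unfolding pushout_simps by simp
  qed
  moreover have "continuous_map (tot Y1) (tot g.P) unglue" using hom_tot by (simp add: homeomorphic_maps_def)
  ultimately have "openin (tot Y1) {y \<in> topspace (tot Y1). unglue y \<in> ?T}"
    by (intro openin_continuous_map_preimage)
  moreover have "{y \<in> topspace (tot Y1). unglue y \<in> ?T} = G"
    unfolding top_Y1 using assms(1) unglue_in unglue_right by auto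
  ultimately show ?thesis by simp
qed

lemma maps_Y0: "maps Y0 = over (powerf X) F0" and maps_Y1: "maps Y1 = over (powerf X) F1"
  by (rule maps_restr[OF X])+

lemma maps_Y0_Y1: "maps Y0 \<subseteq> maps Y1"
  unfolding maps_Y0 maps_Y1 using F01 by (rule over_mono)

lemma post_\<kappa>_maps: "y \<in> maps M \<Longrightarrow> post \<kappa> y \<in> maps Y1"
  by (rule post_maps[OF Mf Y1 \<kappa>_family_map])

lemma post_\<kappa>_h: "y \<in> over (powerf M) A \<Longrightarrow> post \<kappa> y = post h y \<and> post h y \<in> maps Y0"
proof
  assume y: "y \<in> over (powerf M) A"
  then obtain b \<phi> where b: "b \<in> A" "based M b \<phi> y" using over_powerf_all[OF Mf] by blast
  then have "y v \<in> over M A" if "v \<in> pts" for v using that by (auto simp: based_def over_def)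
  then show "post \<kappa> y = post h y" unfolding post_def \<kappa>_def by (intro restrict_ext) simp
  have "y \<in> maps (restr_family M A)" using y maps_restr[OF Mf] by simp
  then show "post h y \<in> maps Y0" by (rule post_maps[OF is_family_restr[OF Mf] Y0 h])
qed

lemma post_\<kappa>_k:
  assumes y: "y \<in> maps M" "y \<notin> over (powerf M) A"
  shows "post \<kappa> y = post k y" "post \<kappa> y \<notin> maps Y0" "post \<rho> (post \<kappa> y) = y"
proof -
  obtain b \<phi> where b: "based M b \<phi> y" using maps_iff_based[OF Mf] y(1) by blast
  then have "b \<notin> A" using y(2) over_powerf_all[OF Mf] by blast
  then have v: "y v \<in> topspace (tot M)" "y v \<notin> over M A" if "v \<in> pts" for v
    using b that by (auto simp: based_def over_def)
  show "post \<kappa> y = post k y" unfolding post_def \<kappa>_def using v by (intro restrict_ext) simp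
  show "post \<kappa> y \<notin> maps Y0"
  proof
    assume "post \<kappa> y \<in> maps Y0"
    from funcset_mem[OF continuous_map_funspace[OF maps_continuous[OF Y0 this]] some_pt]
    show False using \<rho>_\<kappa>(2)[OF v[OF some_pt]] some_pt unfolding top_Y0 by simp
  qed
  show "post \<rho> (post \<kappa> y) = y"
  proof (rule extensionalityI)
    show "y \<in> extensional pts" using b by (simp add: based_def)
    show "post \<rho> (post \<kappa> y) v = y v" if "v \<in> pts" for v using \<rho>_\<kappa>(1)[OF v[OF that]] that by simp
  qed (simp add: post_def)
qed

text \<open>\<open>\<rho>\<close> is not a family map, being meaningless over \<open>F0\<close>, so
  \<open>post_maps\<close> does not apply to it. Over one base point outside \<open>F0\<close> the
  inverse family map provides a morphism \<open>\<psi>\<close>, and that is enough to lift the maps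
  lying there.\<close>

lemma fibre_inverse:
  assumes b: "b \<in> topspace (bas Y1)" "b \<notin> F0"
    and gb: "family_map C F Y1 g.P unglue gb" "homeomorphic_maps (bas g.P) (bas Y1) (case_sum id kb) gb"
  obtains t \<psi> where "gb b = Inr t" "t \<in> topspace (bas M)" "t \<notin> A" "\<psi> \<in> hom C (fib Y1 b) (fib M t)"
    "\<forall>\<phi> a. based Y1 b \<phi> a \<longrightarrow> based M t (Cmp C \<psi> \<phi>) (post \<rho> a)"
proof -
  have gbb: "case_sum id kb (gb b) = b" "gb b \<in> topspace (bas g.P)"
    using gb(2) b(1) by (auto simp: homeomorphic_maps_def continuous_map_def)
  have "gb b \<noteq> Inl x" for x using gbb b unfolding g.topspace_bas by auto
  then obtain t where t: "gb b = Inr t" by (cases "gb b") auto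
  then have t': "t \<in> topspace (bas M)" "t \<notin> A" using gbb(2) unfolding g.topspace_bas by auto
  obtain \<psi> where \<psi>: "\<psi> \<in> hom C (fib Y1 b) (fib g.P (gb b))"
    "\<forall>x\<in>over Y1 {b}. chart g.P (gb b) (unglue x) = fmap F \<psi> (chart Y1 b x)"
    using gb(1) b(1) unfolding charted_family_map_iff[OF is_familyD(2)[OF Y1]] by blast
  have "based M t (Cmp C \<psi> \<phi>) (post \<rho> a)" if a: "based Y1 b \<phi> a" for \<phi> a
  proof (rule based_post[OF a _ t'(1)])
    show "\<psi> \<in> hom C (fib Y1 b) (fib M t)" using \<psi>(1) unfolding t by (simp add: pushout_simps)
    fix x assume x: "x \<in> over Y1 {b}"
    then have x1: "x \<in> over X F1" "x \<notin> over X F0" using b(2) by (auto simp: over_def)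
    have "unglue x \<in> over g.P {Inr t}" using family_map_over[OF gb(1) x] t by simp
    then have "\<rho> x \<in> over M {t}" unfolding g.over_Inr[OF t'(2)] \<kappa>_\<rho>(4)[OF x1] by auto
    moreover have "chart M t (\<rho> x) = fmap F \<psi> (chart Y1 b x)"
      using bspec[OF \<psi>(2) x] unfolding t \<kappa>_\<rho>(4)[OF x1] pushout_simps .
    ultimately show "\<rho> x \<in> over M {t} \<and> chart M t (\<rho> x) = fmap F \<psi> (chart Y1 b x)" ..
  qed
  moreover have "\<psi> \<in> hom C (fib Y1 b) (fib M t)" using \<psi>(1) unfolding t by (simp add: pushout_simps)
  ultimately show thesis using that t t' by blast
qed

text \<open>Since a map lies over one base point, a map into the new stage that is not one into the
  old stage avoids the old part altogether and lifts to \<open>M\<close>.\<close>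

lemma maps_Y1_cases:
  assumes a: "a \<in> maps Y1" "a \<notin> maps Y0"
  shows "post \<rho> a \<in> maps M" "post \<kappa> (post \<rho> a) = a" "post \<rho> a \<notin> over (powerf M) A" "post k (post \<rho> a) = a"
proof -
  obtain b \<phi> where b: "based Y1 b \<phi> a" using maps_iff_based[OF Y1] a(1) by blast
  then have bF: "b \<in> topspace (bas Y1)" by (simp add: based_def)
  have bF0: "b \<notin> F0"
  proof
    assume "b \<in> F0"
    then have "based Y0 b \<phi> a" using b by (simp add: based_restr)
    then show False using a(2) maps_iff_based[OF Y0] by blast
  qed
  obtain gb where gb: "family_map C F Y1 g.P unglue gb" "homeomorphic_maps (bas g.P) (bas Y1) (case_sum id kb) gb"
    by (rule unglue)
  obtain t \<psi> where t: "gb b = Inr t" "t \<in> topspace (bas M)" "t \<notin> A" "\<psi> \<in> hom C (fib Y1 b) (fib M t)"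
    "\<forall>\<phi> a. based Y1 b \<phi> a \<longrightarrow> based M t (Cmp C \<psi> \<phi>) (post \<rho> a)"
    by (rule fibre_inverse[OF bF bF0 gb])
  have M': "based M t (Cmp C \<psi> \<phi>) (post \<rho> a)" using t(5) b by blast
  then show 1: "post \<rho> a \<in> maps M" using maps_iff_based[OF Mf] by blast
  show 2: "post \<rho> a \<notin> over (powerf M) A" using based_prj_powerf[OF M'] t(3) by (auto simp: over_def)
  have v: "a v \<in> over X F1" "a v \<notin> over X F0" if "v \<in> pts" for v
    using b bF0 that by (auto simp: based_def over_def)
  show 3: "post \<kappa> (post \<rho> a) = a"
  proof (rule extensionalityI)
    show "a \<in> extensional pts" using b by (simp add: based_def)
    show "post \<kappa> (post \<rho> a) v = a v" if "v \<in> pts" for v using \<kappa>_\<rho>(3)[OF v[OF that]] that by simp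
  qed (simp add: post_def)
  show "post k (post \<rho> a) = a" using post_\<kappa>_k(1)[OF 1 2] 3 by simp
qed

text \<open>The conditions \<open>U\<close> are pulled back along \<open>h\<close>, extended over
  \<open>M\<close> by \<open>extend_bundle\<close>, and pushed forward by \<open>\<kappa>\<close>. A
  map into the new stage that satisfies the result is a map into the old stage or lifts to
  \<open>M\<close>, and lies in \<open>W\<close> in either case.\<close>

lemma extend_pushout:
  fixes n :: nat
  assumes K: "0 < n" "K 0 \<in> \<K>" "K 0 \<noteq> {}" "\<forall>j<n. compactin (fobj F V) (K j)"
    and W: "openin (mapspace M) {y \<in> maps M. post \<kappa> y \<in> W}"
    and U: "\<forall>j<n. openin (tot Y0) (U j)" "carried (maps Y0) n K U \<subseteq> W"
    and L: "\<forall>j<n. compactin (tot M) (L j) \<and> L j \<subseteq> over M {t0}" "t0 \<notin> A \<or> (\<forall>j<n. L j = {})"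
    and LW: "carried (maps M) n K L \<subseteq> {y \<in> maps M. post \<kappa> y \<in> W}"
  obtains Q where "\<forall>j<n. openin (tot Y1) (Q j) \<and> Q j \<inter> over X F0 = U j \<and> \<kappa> ` L j \<subseteq> Q j"
    "carried (maps Y1) n K Q \<subseteq> W"
proof -
  let ?UM = "\<lambda>j. {y \<in> over M A. h y \<in> U j}"
  have Ksub: "K j \<subseteq> pts" if "j < n" for j using K(4) that compactin_subset_topspace by blast
  have UM: "\<forall>j<n. openin (subtopology (tot M) (over M A)) (?UM j)"
  proof (intro allI impI)
    fix j assume "j < n"
    have "topspace (subtopology (tot M) (over M A)) = over M A" using over_subset_topspace[of M A] by auto
    then show "openin (subtopology (tot M) (over M A)) (?UM j)"
      using openin_continuous_map_preimage[OF family_mapD(1)[OF h] U(1)[rule_format, OF \<open>j < n\<close>]] by simp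
  qed
  have L2: "\<forall>j<n. L j \<inter> over M A \<subseteq> ?UM j"
  proof (intro allI impI)
    fix j assume j: "j < n"
    have "L j \<inter> over M A = {}" using L j by (auto simp: over_def)
    then show "L j \<inter> over M A \<subseteq> ?UM j" by simp
  qed
  have UW: "carried (maps M) n K ?UM \<subseteq> {y \<in> maps M. post \<kappa> y \<in> W}"
  proof
    fix y assume "y \<in> carried (maps M) n K ?UM"
    then have y: "y \<in> maps M" "\<forall>j<n. y ` K j \<subseteq> ?UM j" by (auto simp: carried_def)
    obtain b \<phi> where b: "based M b \<phi> y" using maps_iff_based[OF Mf] y(1) by blast
    obtain v where v: "v \<in> K 0" using K(3) by blast
    have "y ` K 0 \<subseteq> ?UM 0" using y(2) K(1) by blast
    then have "y v \<in> over M A" using v by blast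
    moreover have "prj M (y v) = b" using based_prj[OF b] Ksub[OF K(1)] v by blast
    ultimately have "b \<in> A" by (simp add: over_def)
    then have yA: "y \<in> over (powerf M) A" using b over_powerf_all[OF Mf] by blast
    have "post h y ` K j \<subseteq> U j" if "j < n" for j
      using y(2) that post_image[OF K(4)[rule_format, OF that], of h y] by auto
    then have "post h y \<in> carried (maps Y0) n K U" using post_\<kappa>_h[OF yA] by (simp add: carried_def)
    then show "y \<in> {y \<in> maps M. post \<kappa> y \<in> W}" using post_\<kappa>_h[OF yA] U(2) y(1) by auto
  qed
  obtain R where R: "\<forall>j<n. openin (tot M) (R j) \<and> R j \<inter> over M A = ?UM j \<and> L j \<subseteq> R j"
    "carried (maps M) n K R \<subseteq> {y \<in> maps M. post \<kappa> y \<in> W}"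
    by (rule extend_bundle[OF M cw K W UM L(1) L2 UW LW])
  \<comment> \<open>Off \<open>A\<close> the map \<open>\<kappa>\<close> is injective and avoids the
    old stage. Hence \<open>Q\<close> has trace \<open>U\<close> on the old stage and preimage
    \<open>R\<close> in \<open>M\<close>.\<close>
  define Q where "Q j = U j \<union> \<kappa> ` (R j - over M A)" for j
  have Usub: "U j \<subseteq> over X F0" if "j < n" for j
    using openin_subset[OF U(1)[rule_format, OF that]] unfolding top_Y0 .
  have Rsub: "R j \<subseteq> topspace (tot M)" if "j < n" for j using R(1) that openin_subset by blast
  have QY0: "Q j \<inter> over X F0 = U j" if "j < n" for j
    using Usub[OF that] Rsub[OF that] \<rho>_\<kappa>(2) unfolding Q_def by blast
  have QM: "\<kappa> y \<in> Q j \<longleftrightarrow> y \<in> R j" if j: "j < n" and y: "y \<in> topspace (tot M)" for j y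
  proof (cases "y \<in> over M A")
    case True
    then have hy: "\<kappa> y = h y" "h y \<in> over X F0" using g.h_in[OF True] unfolding top_Y0 by (auto simp: \<kappa>_def)
    have "h y \<in> Q j \<longleftrightarrow> h y \<in> U j" using QY0[OF j] hy(2) by blast
    also have "\<dots> \<longleftrightarrow> y \<in> R j" using R(1) j True by blast
    finally show ?thesis unfolding hy(1) .
  next
    case False
    have "\<kappa> y \<notin> U j" using \<rho>_\<kappa>(2)[OF y False] Usub[OF j] by blast
    moreover have "y = y'" if "\<kappa> y = \<kappa> y'" "y' \<in> R j - over M A" for y'
      using \<rho>_\<kappa>(1)[OF y False] \<rho>_\<kappa>(1)[of y'] that Rsub[OF j] by auto
    ultimately show ?thesis using False unfolding Q_def by blast
  qed
  show thesis
  proof (rule that[of Q])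
    show "\<forall>j<n. openin (tot Y1) (Q j) \<and> Q j \<inter> over X F0 = U j \<and> \<kappa> ` L j \<subseteq> Q j"
    proof (intro allI impI conjI)
      fix j assume j: "j < n"
      show "Q j \<inter> over X F0 = U j" by (rule QY0[OF j])
      show "openin (tot Y1) (Q j)"
      proof (rule openin_Y1)
        have "\<kappa> y \<in> over X F1" if "y \<in> topspace (tot M)" for y
          using family_mapD(4)[OF \<kappa>_family_map that] unfolding top_Y1 .
        then show "Q j \<subseteq> over X F1" using Usub[OF j] Y0_sub_Y1 Rsub[OF j] unfolding Q_def by blast
        show "openin (tot Y0) (Q j \<inter> over X F0)" unfolding QY0[OF j] using U(1) j by blast
        have "{y \<in> topspace (tot M). \<kappa> y \<in> Q j} = R j" using QM[OF j] Rsub[OF j] by blast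
        then show "openin (tot M) {y \<in> topspace (tot M). \<kappa> y \<in> Q j}" using R(1) j by simp
      qed
      have "L j \<subseteq> topspace (tot M)" using L(1) j compactin_subset_topspace by blast
      then show "\<kappa> ` L j \<subseteq> Q j" using R(1) j QM[OF j] by blast
    qed
    show "carried (maps Y1) n K Q \<subseteq> W"
    proof
      fix a assume "a \<in> carried (maps Y1) n K Q"
      then have a: "a \<in> maps Y1" "\<forall>j<n. a ` K j \<subseteq> Q j" by (auto simp: carried_def)
      show "a \<in> W"
      proof (cases "a \<in> maps Y0")
        case True
        have "a ` K j \<subseteq> over X F0" if "j < n" for j
          using maps_continuous[OF Y0 True] Ksub[OF that] unfolding continuous_map_def top_Y0 by blast
        then have "a ` K j \<subseteq> U j" if "j < n" for j using QY0[OF that] a(2) that by blast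
        then have "a \<in> carried (maps Y0) n K U" using True by (simp add: carried_def)
        then show ?thesis using U(2) by blast
      next
        case False
        note lift = maps_Y1_cases[OF a(1) False]
        have "post \<rho> a ` K j \<subseteq> R j" if j: "j < n" for j
        proof
          fix y assume "y \<in> post \<rho> a ` K j"
          then obtain v where v: "v \<in> K j" "y = post \<rho> a v" by blast
          have vp: "v \<in> pts" using Ksub[OF j] v(1) by blast
          have yM: "y \<in> topspace (tot M)"
            using maps_continuous[OF Mf lift(1)] vp unfolding continuous_map_def v(2) by blast
          have "\<kappa> y = post \<kappa> (post \<rho> a) v" unfolding v(2) using vp by simp
          then have "\<kappa> y = a v" unfolding lift(2) .
          then have "\<kappa> y \<in> Q j" using a(2) j v(1) by blast
          then show "y \<in> R j" using QM[OF j yM] by simp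
        qed
        then have "post \<rho> a \<in> carried (maps M) n K R" using lift(1) by (simp add: carried_def)
        then show ?thesis using R(2) lift(2) by auto
      qed
    qed
  qed
qed

text \<open>Each point of \<open>W\<close> needs a basic neighbourhood inside \<open>W\<close>. For
  a map into the old stage, a neighbourhood there is extended over \<open>M\<close>. For any other
  map empty conditions are extended from the old stage, while the compact images of its lift to
  \<open>M\<close> are kept inside.\<close>

lemma openin_mapspace_pushout:
  assumes W: "W \<subseteq> maps Y1" and W0: "openin (mapspace Y0) (W \<inter> maps Y0)"
    and WM: "openin (mapspace M) {y \<in> maps M. post \<kappa> y \<in> W}"
  shows "openin (mapspace Y1) W"
proof (subst openin_subopen, intro ballI)
  fix a assume a: "a \<in> W"
  have nbhd: "\<exists>T. openin (mapspace Y1) T \<and> a \<in> T \<and> T \<subseteq> W"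
    if K: "\<forall>j<n. compactin (fobj F V) (K j)" and Q: "\<forall>j<n. openin (tot Y1) (Q j)" "carried (maps Y1) n K Q \<subseteq> W"
      and aQ: "\<forall>j<n. a ` K j \<subseteq> Q j" for n :: nat and K Q
  proof (intro exI[of _ "carried (maps Y1) n K Q"] conjI)
    show "openin (mapspace Y1) (carried (maps Y1) n K Q)" by (rule openin_carried[OF K Q(1)])
    show "a \<in> carried (maps Y1) n K Q" using aQ a W by (auto simp: carried_def)
  qed (rule Q(2))
  show "\<exists>T. openin (mapspace Y1) T \<and> a \<in> T \<and> T \<subseteq> W"
  proof (cases "a \<in> maps Y0")
    case True
    then have "a \<in> W \<inter> maps Y0" using a by blast
    from mapspace_neighbourhood[OF Y0 W0 this] obtain n :: nat and K U where K: "0 < n" "K 0 \<in> \<K>" "K 0 \<noteq> {}"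
      and KU: "\<forall>j<n. compactin (fobj F V) (K j) \<and> openin (tot Y0) (U j) \<and> a ` K j \<subseteq> U j"
        "carried (maps Y0) n K U \<subseteq> W \<inter> maps Y0" .
    have K4: "\<forall>j<n. compactin (fobj F V) (K j)" and U1: "\<forall>j<n. openin (tot Y0) (U j)" using KU(1) by blast+
    have U2: "carried (maps Y0) n K U \<subseteq> W" using KU(2) by blast
    \<comment> \<open>No image has to be kept in this case, so the sets \<open>L\<close> are empty
      and the base point is a dummy. Nothing is carried by empty sets because \<open>K 0\<close> is
      nonempty, which settles the condition on \<open>W\<close>.\<close>
    have L0: "\<forall>j<n. compactin (tot M) ((\<lambda>_. {}) j) \<and> (\<lambda>_. {}) j \<subseteq> over M {undefined}" by simp
    have L1: "undefined \<notin> A \<or> (\<forall>j<n. (\<lambda>_. {}) j = {})" by simp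
    have L2: "carried (maps M) n K (\<lambda>_. {}) \<subseteq> {y \<in> maps M. post \<kappa> y \<in> W}" using K(1,3) by (auto simp: carried_def)
    obtain Q where Q: "\<forall>j<n. openin (tot Y1) (Q j) \<and> Q j \<inter> over X F0 = U j \<and> \<kappa> ` (\<lambda>_. {}) j \<subseteq> Q j"
      "carried (maps Y1) n K Q \<subseteq> W"
      by (rule extend_pushout[OF K K4 WM U1 U2 L0 L1 L2])
    show ?thesis by (rule nbhd[OF K4 _ Q(2)]) (use Q(1) KU(1) in blast)+
  next
    case False
    have a1: "a \<in> maps Y1" using a W by blast
    note lift = maps_Y1_cases[OF a1 False]
    have "post \<rho> a \<in> {y \<in> maps M. post \<kappa> y \<in> W}" using lift(1,2) a by simp
    from mapspace_neighbourhood[OF Mf WM this] obtain n :: nat and K U where K: "0 < n" "K 0 \<in> \<K>" "K 0 \<noteq> {}"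
      and KU: "\<forall>j<n. compactin (fobj F V) (K j) \<and> openin (tot M) (U j) \<and> post \<rho> a ` K j \<subseteq> U j"
        "carried (maps M) n K U \<subseteq> {y \<in> maps M. post \<kappa> y \<in> W}" .
    have K4: "\<forall>j<n. compactin (fobj F V) (K j)" using KU(1) by blast
    obtain t \<phi> where t: "based M t \<phi> (post \<rho> a)" using maps_iff_based[OF Mf] lift(1) by blast
    have tA: "t \<notin> A" using lift(3) t over_powerf_all[OF Mf] by blast
    let ?L = "\<lambda>j. post \<rho> a ` K j"
    have L0: "\<forall>j<n. compactin (tot M) (?L j) \<and> ?L j \<subseteq> over M {t}"
    proof (intro allI impI conjI)
      fix j assume j: "j < n"
      show "compactin (tot M) (?L j)" using K4 j maps_continuous[OF Mf lift(1)] image_compactin by blast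
      show "?L j \<subseteq> over M {t}" using t compactin_subset_topspace[OF K4[rule_format, OF j]] by (auto simp: based_def)
    qed
    have L1: "t \<notin> A \<or> (\<forall>j<n. ?L j = {})" using tA by simp
    have "carried (maps M) n K ?L \<subseteq> carried (maps M) n K U" using KU(1) by (intro carried_mono) blast
    then have L2: "carried (maps M) n K ?L \<subseteq> {y \<in> maps M. post \<kappa> y \<in> W}" using KU(2) by (rule subset_trans)
    \<comment> \<open>With empty \<open>U\<close> the neighbourhood contains no map into the old
      stage; the condition on \<open>W\<close> there holds because \<open>K 0\<close> is
      nonempty.\<close>
    have U1: "\<forall>j<n. openin (tot Y0) ((\<lambda>_. {}) j)" by simp
    have U2: "carried (maps Y0) n K (\<lambda>_. {}) \<subseteq> W" using K(1,3) by (auto simp: carried_def)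
    obtain Q where Q: "\<forall>j<n. openin (tot Y1) (Q j) \<and> Q j \<inter> over X F0 = (\<lambda>_. {}) j \<and> \<kappa> ` ?L j \<subseteq> Q j"
      "carried (maps Y1) n K Q \<subseteq> W"
      by (rule extend_pushout[OF K K4 WM U1 U2 L0 L1 L2])
    have "a ` K j \<subseteq> Q j" if j: "j < n" for j
    proof -
      have "a ` K j = post \<kappa> (post \<rho> a) ` K j" unfolding lift(2) ..
      also have "\<dots> = \<kappa> ` ?L j" by (rule post_image[OF K4[rule_format, OF j]])
      finally show ?thesis using Q(1) j by blast
    qed
    then show ?thesis by (intro nbhd[OF K4 _ Q(2)]) (use Q(1) in blast)+
  qed
qed

end

lemma restr_restr: "F0 \<subseteq> F1 \<Longrightarrow> restr_family (restr_family X F1) F0 = restr_family X F0"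
proof -
  assume "F0 \<subseteq> F1"
  then have "F1 \<inter> F0 = F0" by blast
  moreover have "over X F0 \<subseteq> over X F1" using \<open>F0 \<subseteq> F1\<close> by (rule over_mono)
  then have "over X F1 \<inter> over X F0 = over X F0" by blast
  ultimately show ?thesis
    by (simp add: restr_family_def subtopology_subtopology over_restr[unfolded restr_family_def])
qed

section \<open>The function family of a push-out\<close>

context pushout_step
begin

abbreviation "k' \<equiv> case_sum id (post k)"

lemma powerf_h: "family_map C Fv (restr_family (powerf M) A) (powerf Y0) (post h) hb"
  unfolding restr_powerf[OF Mf] by (rule family_map_powerf[OF is_family_restr[OF Mf] Y0 h])

sublocale p: gluing C Fv "powerf Y0" "powerf M" A "post h" hb
  by (intro gluing.intro is_family_powerf Y0 Mf powerf_h)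

lemma tot_p: "topspace (tot p.P) = maps Y0 <+> (maps M - over (powerf M) A)"
  by (simp add: p.topspace_tot)

lemma bas_p: "bas p.P = bas g.P"
  by (simp add: pushout_simps)

lemma mapspace_Y0: "mapspace Y0 = subtopology (mapspace Y1) (maps Y0)"
proof -
  have "restr_family (powerf Y1) F0 = powerf Y0"
    using restr_powerf[OF Y1, of F0] restr_restr[OF F01, of X] by simp
  moreover have "maps Y0 = over (powerf Y1) F0"
    using maps_restr[OF Y1, of F0] restr_restr[OF F01, of X] by simp
  ultimately show ?thesis using restr_simps(1)[of "powerf Y1" F0] by simp
qed

lemma k'_glue:
  assumes "y \<in> maps M"
  shows "k' (glue (over (powerf M) A) (post h) y) = post \<kappa> y"
    "glue (over (powerf M) A) (post h) y \<in> topspace (tot p.P)"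
  unfolding tot_p using post_\<kappa>_h[of y] post_\<kappa>_k[OF assms] assms by (auto simp: glue_def)

text \<open>The easy half. The push-out topology lets continuity be checked on the old stage, where
  the map is the inclusion of a subspace, and on \<open>M\<close>, where it is post-composition with
  \<open>\<kappa>\<close>.\<close>

lemma powerf_pushout_map: "family_map C Fv p.P (powerf Y1) k' (case_sum id kb)"
  unfolding charted_family_map_iff[OF p.charted]
proof (intro conjI ballI)
  have in_maps: "k' z \<in> maps Y1" if z: "z \<in> topspace (tot p.P)" for z
  proof (cases z)
    case (Inl x)
    then show ?thesis using z maps_Y0_Y1 unfolding tot_p by auto
  next
    case (Inr y)
    then have "y \<in> maps M" "y \<notin> over (powerf M) A" using z unfolding tot_p by auto
    then show ?thesis using Inr post_\<kappa>_k(1)[of y] post_\<kappa>_maps[of y] by simp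
  qed
  show "continuous_map (tot p.P) (tot (powerf Y1)) k'"
    unfolding continuous_map_def
  proof (intro conjI allI impI)
    show "k' \<in> topspace (tot p.P) \<rightarrow> topspace (tot (powerf Y1))" using in_maps by simp
    fix W assume "openin (tot (powerf Y1)) W"
    then have W: "openin (mapspace Y1) W" by simp
    let ?T = "{z \<in> topspace (tot p.P). k' z \<in> W}"
    have T0: "{x \<in> topspace (mapspace Y0). Inl x \<in> ?T} = W \<inter> maps Y0" unfolding tot_p by auto
    have T1: "{y \<in> topspace (mapspace M). glue (over (powerf M) A) (post h) y \<in> ?T} = {y \<in> topspace (mapspace M). post \<kappa> y \<in> W}"
      using k'_glue by auto
    have "openin (adjunction_space (mapspace Y0) (mapspace M) (over (powerf M) A) (post h)) ?T"
      unfolding openin_adjunction_space T0 T1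
    proof (intro conjI)
      show "?T \<subseteq> topspace (mapspace Y0) <+> (topspace (mapspace M) - over (powerf M) A)"
        unfolding tot_p by auto
      show "openin (mapspace Y0) (W \<inter> maps Y0)" unfolding mapspace_Y0 by (rule openin_subtopology_Int[OF W])
      show "openin (mapspace M) {y \<in> topspace (mapspace M). post \<kappa> y \<in> W}"
        by (rule openin_continuous_map_preimage[OF continuous_post[OF Mf Y1 \<kappa>_family_map] W])
    qed
    then show "openin (tot p.P) ?T" by (simp only: pushout_simps powerf_simps)
  qed
  show "continuous_map (bas p.P) (bas (powerf Y1)) (case_sum id kb)"
    using family_mapD(2)[OF iso_map] by (simp add: pushout_simps)
  note \<kappa>p = family_map_powerf[OF Mf Y1 \<kappa>_family_map]
  show "prj (powerf Y1) (k' z) = case_sum id kb (prj p.P z)" if z: "z \<in> topspace (tot p.P)" for z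
  proof (cases z)
    case (Inl x)
    then show ?thesis by (simp add: pushout_simps)
  next
    case (Inr y)
    then have y: "y \<in> maps M" "y \<notin> over (powerf M) A" using z unfolding tot_p by auto
    then have "prj (powerf M) y \<notin> A" by (simp add: over_def)
    then show ?thesis using family_mapD(3)[OF \<kappa>p, of y] y post_\<kappa>_k(1)[OF y] Inr
      by (simp add: pushout_simps \<kappa>b_def)
  qed
  fix b assume b: "b \<in> topspace (bas p.P)"
  show "\<exists>\<phi>\<in>hom C (fib p.P b) (fib (powerf Y1) (case_sum id kb b)).
      \<forall>z\<in>over p.P {b}. chart (powerf Y1) (case_sum id kb b) (k' z) = fmap Fv \<phi> (chart p.P b z)"
  proof (cases b)
    case (Inl x)
    then have x: "x \<in> topspace (bas X)" "x \<in> F0" using b unfolding p.topspace_bas by auto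
    have obj: "fib X x \<in> Obj C" by (rule is_familyD(3)[OF X x(1)])
    have "chart (powerf Y1) x a = Cmp C (Ide C (fib X x)) (chart (powerf Y0) x a)" if a: "a \<in> over (powerf Y0) {x}" for a
    proof -
      obtain \<phi> where \<phi>: "based Y0 x \<phi> a" by (rule over_powerfE[OF Y0 a])
      then have "based Y1 x \<phi> a" using F01 by (auto simp: based_restr)
      moreover have "\<phi> \<in> hom C V (fib X x)" using \<phi> by (simp add: based_def)
      ultimately show ?thesis using based_chart[OF \<phi>] based_chart Ide_Cmp by simp
    qed
    then show ?thesis using Ide_hom[OF obj] unfolding Inl p.over_Inl
      by (intro bexI[of _ "Ide C (fib X x)"]) (auto simp: pushout_simps)
  next
    case (Inr t)
    then have t: "t \<in> topspace (bas (powerf M))" "t \<notin> A" using b unfolding p.topspace_bas by auto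
    from \<kappa>p t(1) obtain \<phi> where \<phi>: "\<phi> \<in> hom C (fib (powerf M) t) (fib (powerf Y1) (\<kappa>b t))"
      "\<forall>y\<in>over (powerf M) {t}. chart (powerf Y1) (\<kappa>b t) (post \<kappa> y) = fmap Fv \<phi> (chart (powerf M) t y)"
      unfolding charted_family_map_iff[OF is_familyD(2)[OF is_family_powerf[OF Mf]]] by blast
    have kb: "\<kappa>b t = kb t" using t(2) by (simp add: \<kappa>b_def)
    have "post \<kappa> y = post k y" if "y \<in> over (powerf M) {t}" for y
      using post_\<kappa>_k(1)[of y] that t(2) by (auto simp: over_def)
    then show ?thesis using \<phi> unfolding Inr p.over_Inr[OF t(2)] kb
      by (intro bexI[of _ \<phi>]) (auto simp: pushout_simps)
  qed
qed

text \<open>Not post-composition with \<open>unglue\<close>: a point of the push-out of function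
  spaces is a map tagged by its summand, not a map into a sum.\<close>

definition unglue_maps where "unglue_maps a = (if a \<in> maps Y0 then Inl a else Inr (post \<rho> a))"

lemma unglue_maps_in: "a \<in> maps Y1 \<Longrightarrow> unglue_maps a \<in> topspace (tot p.P)"
  unfolding tot_p unglue_maps_def using maps_Y1_cases[of a] by auto

lemma unglue_maps_\<kappa>:
  assumes "y \<in> maps M"
  shows "unglue_maps (post \<kappa> y) = glue (over (powerf M) A) (post h) y"
  unfolding unglue_maps_def glue_def using post_\<kappa>_h[of y] post_\<kappa>_k[OF assms] by auto

text \<open>Continuity here says that the function space of the new stage carries the push-out
  topology, so it comes from \<open>openin_mapspace_pushout\<close>. The other conditions are
  fibrewise: over \<open>F0\<close> the morphism is an identity, elsewhere it is the
  \<open>\<psi>\<close> of \<open>fibre_inverse\<close>.\<close>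

lemma powerf_pushout_inverse:
  assumes gb: "family_map C F Y1 g.P unglue gb" "homeomorphic_maps (bas g.P) (bas Y1) (case_sum id kb) gb"
  shows "family_map C Fv (powerf Y1) p.P unglue_maps gb"
  unfolding charted_family_map_iff[OF is_familyD(2)[OF is_family_powerf[OF Y1]]]
proof (intro conjI ballI)
  show "continuous_map (tot (powerf Y1)) (tot p.P) unglue_maps"
    unfolding continuous_map_def
  proof (intro conjI allI impI)
    show "unglue_maps \<in> topspace (tot (powerf Y1)) \<rightarrow> topspace (tot p.P)" using unglue_maps_in by simp
    fix G assume G: "openin (tot p.P) G"
    let ?W = "{a \<in> maps Y1. unglue_maps a \<in> G}"
    have "openin (mapspace Y1) ?W"
    proof (rule openin_mapspace_pushout)
      have G': "openin (mapspace Y0) {x \<in> topspace (mapspace Y0). Inl x \<in> G}"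
        "openin (mapspace M) {y \<in> topspace (mapspace M). glue (over (powerf M) A) (post h) y \<in> G}"
        using G unfolding pushout_simps powerf_simps openin_adjunction_space by blast+
      have "?W \<inter> maps Y0 = {x \<in> topspace (mapspace Y0). Inl x \<in> G}"
        using maps_Y0_Y1 by (auto simp: unglue_maps_def)
      then show "openin (mapspace Y0) (?W \<inter> maps Y0)" using G'(1) by simp
      have "{y \<in> maps M. post \<kappa> y \<in> ?W} = {y \<in> topspace (mapspace M). glue (over (powerf M) A) (post h) y \<in> G}"
        using post_\<kappa>_maps unglue_maps_\<kappa> by auto
      then show "openin (mapspace M) {y \<in> maps M. post \<kappa> y \<in> ?W}" using G'(2) by simp
    qed blast
    then show "openin (tot (powerf Y1)) {a \<in> topspace (tot (powerf Y1)). unglue_maps a \<in> G}" by simp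
  qed
  show "continuous_map (bas (powerf Y1)) (bas p.P) gb"
    using family_mapD(2)[OF gb(1)] unfolding bas_p by simp
  have gb_Inl: "gb b = Inl b" if "b \<in> topspace (bas X)" "b \<in> F0" for b
  proof -
    have "Inl b \<in> topspace (bas g.P)" using that by (simp add: g.topspace_bas InlI)
    then have "gb (case_sum id kb (Inl b)) = Inl b" using gb(2) by (simp only: homeomorphic_maps_def)
    then show ?thesis by simp
  qed
  have cases_b: "(b \<in> F0 \<and> a \<in> maps Y0 \<and> based Y0 b \<phi> a) \<or> (b \<notin> F0 \<and> a \<notin> maps Y0)" if ab: "based Y1 b \<phi> a" for a b \<phi>
  proof (cases "b \<in> F0")
    case True
    then have "based Y0 b \<phi> a" using ab by (simp add: based_restr)
    then show ?thesis using True maps_iff_based[OF Y0] by blast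
  next
    case False
    have "a \<notin> maps Y0"
    proof
      assume "a \<in> maps Y0"
      then obtain c \<psi> where "based Y0 c \<psi> a" using maps_iff_based[OF Y0] by blast
      then have "c \<in> F0" "prj (powerf Y0) a = c" using based_prj_powerf[of Y0 c \<psi> a] by (simp_all add: based_restr)
      moreover have "prj (powerf Y1) a = b" by (rule based_prj_powerf[OF ab])
      ultimately show False using False by simp
    qed
    then show ?thesis using False by simp
  qed
  show "prj p.P (unglue_maps a) = gb (prj (powerf Y1) a)" if a: "a \<in> topspace (tot (powerf Y1))" for a
  proof -
    have "a \<in> maps Y1" using a by simp
    then obtain b \<phi> where b: "based Y1 b \<phi> a" using maps_iff_based[OF Y1] by blast
    have prj: "prj (powerf Y1) a = b" by (rule based_prj_powerf[OF b])
    have bY: "b \<in> topspace (bas Y1)" using b by (simp add: based_def)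
    from cases_b[OF b] show ?thesis
    proof
      assume h: "b \<in> F0 \<and> a \<in> maps Y0 \<and> based Y0 b \<phi> a"
      then have "prj (powerf Y0) a = b" using based_prj_powerf[of Y0 b \<phi> a] by blast
      then show ?thesis using h gb_Inl[of b] bY prj by (simp add: unglue_maps_def pushout_simps)
    next
      assume h: "b \<notin> F0 \<and> a \<notin> maps Y0"
      obtain t \<psi> where t: "gb b = Inr t" "t \<in> topspace (bas M)" "t \<notin> A" "\<psi> \<in> hom C (fib Y1 b) (fib M t)"
        "\<forall>\<phi> a. based Y1 b \<phi> a \<longrightarrow> based M t (Cmp C \<psi> \<phi>) (post \<rho> a)"
        by (rule fibre_inverse[OF bY _ gb]) (use h in auto)
      have "based M t (Cmp C \<psi> \<phi>) (post \<rho> a)" using t(5) b by blast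
      then have "prj (powerf M) (post \<rho> a) = t" by (rule based_prj_powerf)
      then show ?thesis using h prj t(1) by (simp add: unglue_maps_def pushout_simps)
    qed
  qed
  fix b assume "b \<in> topspace (bas (powerf Y1))"
  then have bY: "b \<in> topspace (bas Y1)" by simp
  show "\<exists>\<phi>\<in>hom C (fib (powerf Y1) b) (fib p.P (gb b)).
      \<forall>a\<in>over (powerf Y1) {b}. chart p.P (gb b) (unglue_maps a) = fmap Fv \<phi> (chart (powerf Y1) b a)"
  proof (cases "b \<in> F0")
    case True
    then have gbb: "gb b = Inl b" using gb_Inl bY by simp
    have obj: "fib X b \<in> Obj C" using is_familyD(3)[OF X] bY by simp
    have "chart p.P (gb b) (unglue_maps a) = Cmp C (Ide C (fib X b)) (chart (powerf Y1) b a)" if a: "a \<in> over (powerf Y1) {b}" for a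
    proof -
      obtain \<phi> where \<phi>: "based Y1 b \<phi> a" by (rule over_powerfE[OF Y1 a])
      then have h: "a \<in> maps Y0" "based Y0 b \<phi> a" using cases_b True by blast+
      have "\<phi> \<in> hom C V (fib X b)" using \<phi> by (simp add: based_def)
      then show ?thesis using based_chart[OF \<phi>] based_chart[OF h(2)] h(1) gbb Ide_Cmp
        by (simp add: unglue_maps_def pushout_simps)
    qed
    then show ?thesis using Ide_hom[OF obj] gbb
      by (intro bexI[of _ "Ide C (fib X b)"]) (auto simp: pushout_simps)
  next
    case False
    obtain t \<psi> where t: "gb b = Inr t" "t \<in> topspace (bas M)" "t \<notin> A" "\<psi> \<in> hom C (fib Y1 b) (fib M t)"
      "\<forall>\<phi> a. based Y1 b \<phi> a \<longrightarrow> based M t (Cmp C \<psi> \<phi>) (post \<rho> a)"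
      by (rule fibre_inverse[OF bY False gb])
    have "chart p.P (gb b) (unglue_maps a) = Cmp C \<psi> (chart (powerf Y1) b a)" if a: "a \<in> over (powerf Y1) {b}" for a
    proof -
      obtain \<phi> where \<phi>: "based Y1 b \<phi> a" by (rule over_powerfE[OF Y1 a])
      then have h: "a \<notin> maps Y0" using cases_b False by blast
      have "based M t (Cmp C \<psi> \<phi>) (post \<rho> a)" using t(5) \<phi> by blast
      then show ?thesis using based_chart[OF \<phi>] based_chart h t(1)
        by (simp add: unglue_maps_def pushout_simps)
    qed
    then show ?thesis using t(1,4) by (intro bexI[of _ \<psi>]) (auto simp: pushout_simps)
  qed
qed

lemma powerf_pushout: "family_iso C Fv p.P (powerf Y1) k' (case_sum id kb)"
proof -
  obtain gb where gb: "family_map C F Y1 g.P unglue gb" "homeomorphic_maps (bas g.P) (bas Y1) (case_sum id kb) gb"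
    by (rule unglue)
  show ?thesis
    unfolding family_iso_def
  proof (intro conjI exI[of _ unglue_maps] exI[of _ gb] ballI)
    show "family_map C Fv p.P (powerf Y1) k' (case_sum id kb)" by (rule powerf_pushout_map)
    show "family_map C Fv (powerf Y1) p.P unglue_maps gb" by (rule powerf_pushout_inverse[OF gb])
    show "unglue_maps (k' z) = z" if z: "z \<in> topspace (tot p.P)" for z
    proof (cases z)
      case (Inl x)
      then show ?thesis using z unfolding tot_p by (auto simp: unglue_maps_def)
    next
      case (Inr y)
      then have y: "y \<in> maps M" "y \<notin> over (powerf M) A" using z unfolding tot_p by auto
      then show ?thesis using Inr post_\<kappa>_k[OF y] by (simp add: unglue_maps_def)
    qed
    show "k' (unglue_maps a) = a" if "a \<in> topspace (tot (powerf Y1))" for a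
      using that maps_Y1_cases(4)[of a] by (simp add: unglue_maps_def)
    show "gb (case_sum id kb b) = b" if "b \<in> topspace (bas p.P)" for b
      using gb(2) that unfolding bas_p homeomorphic_maps_def by blast
    show "case_sum id kb (gb c) = c" if "c \<in> topspace (bas (powerf Y1))" for c
      using gb(2) that unfolding homeomorphic_maps_def by simp
  qed
qed

end

section \<open>Function spaces of the sequential colimit\<close>

context nkc_object
begin

text \<open>A basic neighbourhood in a stage containing \<open>a\<close> is extended from stage to
  stage by \<open>extend_pushout\<close>. The unions of the extended sets are open in the colimit,
  and a map carried by them belongs to some stage because it has a single base point.\<close>

lemma openin_mapspace_colimit:
  fixes X :: "('o, 'a, 'a, 'a) family"
  assumes X: "is_family C F X" and colim: "is_sequential_colimit (tot X) (\<lambda>i. over X (S i))"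
    and mono: "\<And>i. S i \<subseteq> S (Suc i)"
    and steps: "\<And>i. \<exists>M A h hb k kb E. pushout_step C F V X M (S i) (S (Suc i)) A h hb k kb E"
    and W: "W \<subseteq> maps X" "\<And>i. openin (mapspace (restr_family X (S i))) (W \<inter> maps (restr_family X (S i)))"
  shows "openin (mapspace X) W"
proof (subst openin_subopen, intro ballI)
  fix a assume a: "a \<in> W"
  let ?Y = "\<lambda>i. restr_family X (S i)"
  have Y: "is_family C F (?Y i)" for i by (rule is_family_restr[OF X])
  have S_mono: "S i \<subseteq> S l" if "i \<le> l" for i l using mono that by (rule lift_Suc_mono_le)
  have top: "topspace (tot (?Y i)) = over X (S i)" for i using over_subset_topspace[of X] by auto
  have in_stage: "\<exists>i. x \<in> maps (?Y i)" if x: "x \<in> maps X" for x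
  proof -
    have "x some_pt \<in> topspace (tot X)"
      by (rule funcset_mem[OF continuous_map_funspace[OF maps_continuous[OF X x]] some_pt])
    moreover have "(\<Union>i. over X (S i)) = topspace (tot X)" using colim by (simp add: is_sequential_colimit_def)
    ultimately obtain i where "x some_pt \<in> over X (S i)" by blast
    then have "prj (powerf X) x \<in> S i" by (simp add: over_def)
    then have "x \<in> over (powerf X) (S i)" using x by (simp add: over_def)
    then show ?thesis using maps_restr[OF X] by blast
  qed
  obtain i0 where i0: "a \<in> maps (?Y i0)" using in_stage a W(1) by blast
  then have "a \<in> W \<inter> maps (?Y i0)" using a by blast
  from mapspace_neighbourhood[OF Y W(2) this] obtain n :: nat and K U0 where K: "0 < n" "K 0 \<in> \<K>" "K 0 \<noteq> {}"
    and KU: "\<forall>j<n. compactin (fobj F V) (K j) \<and> openin (tot (?Y i0)) (U0 j) \<and> a ` K j \<subseteq> U0 j"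
      "carried (maps (?Y i0)) n K U0 \<subseteq> W \<inter> maps (?Y i0)" .
  have K4: "\<forall>j<n. compactin (fobj F V) (K j)" using KU(1) by blast
  \<comment> \<open>Stages are counted from \<open>i0\<close>; the clause for \<open>m = 0\<close>
    anchors the sequence at \<open>U0\<close>, so that \<open>a\<close> stays inside.\<close>
  define ok where "ok m U \<longleftrightarrow> (\<forall>j<n. openin (tot (?Y (i0 + m))) (U j)) \<and>
      carried (maps (?Y (i0 + m))) n K U \<subseteq> W \<and> (m = 0 \<longrightarrow> U = U0)" for m U
  define step where "step m U U' \<longleftrightarrow> (\<forall>j<n. U' j \<inter> over X (S (i0 + m)) = U j)"
    for m :: nat and U U' :: "nat \<Rightarrow> 'a set"
  have ex_step: "\<exists>U'. ok (Suc m) U' \<and> step m U U'" if ok: "ok m U" for m U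
  proof -
    from steps[of "i0 + m"] obtain M A h hb k kb E
      where "pushout_step C F V X M (S (i0 + m)) (S (Suc (i0 + m))) A h hb k kb E" by (elim exE)
    then interpret s: pushout_step C F V X M "S (i0 + m)" "S (Suc (i0 + m))" A h hb k kb E .
    \<comment> \<open>\<open>extend_pushout\<close> asks for openness of \<open>W\<close> only after
      pulling back to \<open>M\<close>; this follows from its openness in the next stage, since all
      values of \<open>post s.\<kappa>\<close> lie there.\<close>
    have "openin (mapspace M) {y \<in> topspace (mapspace M). post s.\<kappa> y \<in> W \<inter> maps (?Y (Suc (i0 + m)))}"
      by (rule openin_continuous_map_preimage[OF continuous_post[OF s.Mf s.Y1 s.\<kappa>_family_map] W(2)])
    moreover have "{y \<in> topspace (mapspace M). post s.\<kappa> y \<in> W \<inter> maps (?Y (Suc (i0 + m)))} = {y \<in> maps M. post s.\<kappa> y \<in> W}"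
      using s.post_\<kappa>_maps by auto
    ultimately have WM: "openin (mapspace M) {y \<in> maps M. post s.\<kappa> y \<in> W}" by simp
    have U: "\<forall>j<n. openin (tot (?Y (i0 + m))) (U j)" "carried (maps (?Y (i0 + m))) n K U \<subseteq> W"
      using ok unfolding ok_def by blast+
    have L0: "\<forall>j<n. compactin (tot M) ((\<lambda>_. {}) j) \<and> (\<lambda>_. {}) j \<subseteq> over M {undefined}" by simp
    have L1: "undefined \<notin> A \<or> (\<forall>j<n. (\<lambda>_. {}) j = {})" by simp
    have L2: "carried (maps M) n K (\<lambda>_. {}) \<subseteq> {y \<in> maps M. post s.\<kappa> y \<in> W}" using K(1,3) by (auto simp: carried_def)
    obtain Q where "\<forall>j<n. openin (tot (?Y (Suc (i0 + m)))) (Q j) \<and> Q j \<inter> over X (S (i0 + m)) = U j \<and> s.\<kappa> ` (\<lambda>_. {}) j \<subseteq> Q j"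
      "carried (maps (?Y (Suc (i0 + m)))) n K Q \<subseteq> W"
      by (rule s.extend_pushout[OF K K4 WM U L0 L1 L2])
    then have "ok (Suc m) Q \<and> step m U Q" unfolding ok_def step_def by simp
    then show ?thesis by blast
  qed
  have "ok 0 U0" using KU unfolding ok_def by auto
  then have "\<exists>f. \<forall>m. ok m (f m) \<and> step m (f m) (f (Suc m))"
    using ex_step by (intro dependent_nat_choice) blast+
  then obtain f where f: "\<And>m. ok m (f m)" "\<And>m. step m (f m) (f (Suc m))" by blast
  have f0: "f 0 = U0" using f(1)[of 0] unfolding ok_def by blast
  have f_sub: "f m j \<subseteq> over X (S (i0 + m))" if "j < n" for m j
  proof -
    have "openin (tot (?Y (i0 + m))) (f m j)" using f(1)[of m] that unfolding ok_def by blast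
    from openin_subset[OF this] show ?thesis unfolding top .
  qed
  have f_later: "f l j \<inter> over X (S (i0 + m)) = f m j" if j: "j < n" and ml: "m \<le> l" for m l j
    using ml
  proof (induction rule: dec_induct)
    case base
    then show ?case using f_sub[OF j] by blast
  next
    case (step l)
    have "f (Suc l) j \<inter> over X (S (i0 + l)) = f l j" using f(2)[of l] j unfolding step_def by blast
    moreover have "over X (S (i0 + m)) \<subseteq> over X (S (i0 + l))" using S_mono[of "i0 + m" "i0 + l"] step(1) by (intro over_mono) simp
    ultimately show ?case using step.IH by blast
  qed
  define R where "R j = (\<Union>m. f m j)" for j
  have R_stage: "R j \<inter> over X (S (i0 + m)) = f m j" if j: "j < n" for j m
  proof -
    have "f l j \<inter> over X (S (i0 + m)) \<subseteq> f m j" for l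
    proof (cases "m \<le> l")
      case True
      then show ?thesis using f_later[OF j True] by blast
    next
      case False
      then show ?thesis using f_later[OF j, of l m] by auto
    qed
    then show ?thesis using f_sub[OF j] unfolding R_def by blast
  qed
  have R_open: "openin (tot X) (R j)" if j: "j < n" for j
  proof -
    have "R j \<subseteq> topspace (tot X)" using f_sub[OF j] over_subset_topspace[of X] unfolding R_def by blast
    moreover have "openin (subtopology (tot X) (over X (S i))) (R j \<inter> over X (S i))" for i
    proof -
      \<comment> \<open>Truncated subtraction: for \<open>i < i0\<close> this is \<open>0\<close>,
        and stage \<open>i0\<close>, which contains stage \<open>i\<close>, is used.\<close>
      let ?m = "i - i0"
      have "over X (S i) \<subseteq> over X (S (i0 + ?m))" using S_mono[of i "i0 + ?m"] by (intro over_mono) simp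
      then have eq: "R j \<inter> over X (S i) = f ?m j \<inter> over X (S i)"
        and int: "over X (S (i0 + ?m)) \<inter> over X (S i) = over X (S i)"
        using R_stage[OF j, of ?m] by blast+
      have "openin (tot (?Y (i0 + ?m))) (f ?m j)" using f(1)[of ?m] j unfolding ok_def by blast
      then obtain T where T: "openin (tot X) T" "f ?m j = T \<inter> over X (S (i0 + ?m))"
        by (auto simp: openin_subtopology)
      have "R j \<inter> over X (S i) = T \<inter> over X (S i)" unfolding eq T(2) using int by blast
      then show ?thesis using openin_subtopology_Int[OF T(1)] by simp
    qed
    ultimately show ?thesis using colim unfolding is_sequential_colimit_def by blast
  qed
  show "\<exists>T. openin (mapspace X) T \<and> a \<in> T \<and> T \<subseteq> W"
  proof (intro exI[of _ "carried (maps X) n K R"] conjI)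
    show "openin (mapspace X) (carried (maps X) n K R)" using K4 R_open by (intro openin_carried) blast+
    have "U0 j \<subseteq> R j" for j unfolding R_def using f0 by blast
    then show "a \<in> carried (maps X) n K R" using KU(1) a W(1) unfolding carried_def by blast
    show "carried (maps X) n K R \<subseteq> W"
    proof
      fix x assume "x \<in> carried (maps X) n K R"
      then have x: "x \<in> maps X" "\<forall>j<n. x ` K j \<subseteq> R j" by (auto simp: carried_def)
      obtain i where "x \<in> maps (?Y i)" using in_stage[OF x(1)] by blast
      then have "x \<in> over (powerf X) (S i)" using maps_restr[OF X] by blast
      moreover have "S i \<subseteq> S (i0 + i)" by (rule S_mono) simp
      ultimately have xi: "x \<in> maps (?Y (i0 + i))" using maps_restr[OF X] over_mono[of "S i" "S (i0 + i)" "powerf X"] by blast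
      have "x ` K j \<subseteq> f i j" if j: "j < n" for j
      proof -
        have "x ` K j \<subseteq> over X (S (i0 + i))"
          using funcset_mem[OF continuous_map_funspace[OF maps_continuous[OF Y xi]]]
            compactin_subset_topspace[OF K4[rule_format, OF j]] unfolding top by blast
        then show ?thesis using R_stage[OF j, of i] x(2) j by blast
      qed
      then have "x \<in> carried (maps (?Y (i0 + i))) n K (f i)" using xi by (simp add: carried_def)
      then show "x \<in> W" using f(1)[of i] unfolding ok_def by blast
    qed
  qed
qed

end

theorem theorem6p12:
  fixes C :: "('o, 'm) category"
    and F :: "('o, 'm, 'a) top_functor"
    and S :: "('a, 'a) stratification"
    and X :: "('o, 'a, 'a, 'a) family"
    and V :: 'o
  assumes "NKC C F"
    and "stratified_fibre_bundle TYPE('a) C F S X"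
    and "V \<in> Obj C"
    and "topspace (fobj F V) \<noteq> {}"
  shows "stratified_fibre_bundle TYPE('a \<Rightarrow> 'a) C (hom_functor C F V) S (function_family C F V X)"
proof -
  interpret nkc_object C F V
    using assms by unfold_locales (auto simp: NKC_def)
  have S: "stratified_space S" and X: "is_family C F X" and bX: "bas X = sspace S"
    and B0: "is_bundle C F (restr_family X (filt S 0))"
    and colim: "is_sequential_colimit (tot X) (\<lambda>i. over X (filt S i))"
    using assms(2) by (simp_all add: stratified_fibre_bundle_def)
  have gl: "\<exists>(M :: ('o, 'a, 'a, 'a) family) h k.
        is_bundle C F M \<and> bas M = cwM S i \<and>
        family_map C F (restr_family M (cwA S i)) (restr_family X (filt S (i - 1))) h (att S i) \<and>
        family_iso C F
          (pushout_family (restr_family X (filt S (i - 1))) M (cwA S i) h (att S i))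
          (restr_family X (filt S i)) (case_sum id k) (case_sum id (charm S i))" if "i \<ge> 1" for i
    using assms(2) that by (simp add: stratified_fibre_bundle_def)
  have mono: "filt S i \<subseteq> filt S (Suc i)" for i
    using S by (simp add: stratified_space_def is_sequential_colimit_def)
  have pair: "CW_pair (cwM S i) (cwA S i)" if "i \<ge> 1" for i
    using S that by (simp add: stratified_space_def)
  have step: "\<exists>(M :: ('o, 'a, 'a, 'a) family) h k E. bas M = cwM S i \<and>
      pushout_step C F V X M (filt S (i - 1)) (filt S i) (cwA S i) h (att S i) k (charm S i) E" if i: "i \<ge> 1" for i
  proof -
    from gl[OF i] obtain M :: "('o, 'a, 'a, 'a) family" and h k where M: "is_bundle C F M" "bas M = cwM S i"
        "family_map C F (restr_family M (cwA S i)) (restr_family X (filt S (i - 1))) h (att S i)"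
        "family_iso C F
          (pushout_family (restr_family X (filt S (i - 1))) M (cwA S i) h (att S i))
          (restr_family X (filt S i)) (case_sum id k) (case_sum id (charm S i))"
      by (elim exE conjE)
    obtain E where E: "relative_CW (cwM S i) (cwA S i) E" by (rule CW_pair_relative_CW[OF pair[OF i]])
    have "filt S (i - 1) \<subseteq> filt S i" using mono[of "i - 1"] i by simp
    then have "pushout_step C F V X M (filt S (i - 1)) (filt S i) (cwA S i) h (att S i) k (charm S i) E"
      using X M E by unfold_locales simp_all
    then show ?thesis using M(2) by blast
  qed
  show ?thesis
    unfolding stratified_fibre_bundle_def
  proof (intro conjI allI impI)
    show "structure_category C Fv" by (rule structure_category_Fv)
    show "stratified_space S" by (rule S)
    show "is_family C Fv (powerf X)" by (rule is_family_powerf[OF X])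
    show "bas (powerf X) = sspace S" using bX by simp
    show "is_bundle C Fv (restr_family (powerf X) (filt S 0))"
      unfolding restr_powerf[OF X] by (rule is_bundle_powerf[OF B0])
    fix i :: nat assume "1 \<le> i"
    from step[OF this] obtain M :: "('o, 'a, 'a, 'a) family" and h k E where bM: "bas M = cwM S i" and
      st: "pushout_step C F V X M (filt S (i - 1)) (filt S i) (cwA S i) h (att S i) k (charm S i) E"
      by (elim exE conjE)
    interpret s: pushout_step C F V X M "filt S (i - 1)" "filt S i" "cwA S i" h "att S i" k "charm S i" E
      by (rule st)
    show "\<exists>(M :: ('o, 'm, 'a \<Rightarrow> 'a, 'a) family) h k.
        is_bundle C Fv M \<and> bas M = cwM S i \<and>
        family_map C Fv (restr_family M (cwA S i)) (restr_family (powerf X) (filt S (i - 1))) h (att S i) \<and>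
        family_iso C Fv
          (pushout_family (restr_family (powerf X) (filt S (i - 1))) M (cwA S i) h (att S i))
          (restr_family (powerf X) (filt S i)) (case_sum id k) (case_sum id (charm S i))"
      unfolding restr_powerf[OF X]
    \<comment> \<open>The data on base spaces are unchanged. The bundle over \<open>M_i\<close> is
      replaced by its function family, and the two structure maps on total spaces by
      post-composition with them.\<close>
    proof (rule exI[of _ "powerf M"], rule exI[of _ "post h"], rule exI[of _ "post k"], intro conjI)
      show "is_bundle C Fv (powerf M)" by (rule is_bundle_powerf[OF s.M])
      show "bas (powerf M) = cwM S i" using bM by simp
      show "family_map C Fv (restr_family (powerf M) (cwA S i)) (powerf s.Y0) (post h) (att S i)" by (rule s.powerf_h)
    qed (rule s.powerf_pushout)
  next
    show "is_sequential_colimit (tot (powerf X)) (\<lambda>i. over (powerf X) (filt S i))"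
      unfolding is_sequential_colimit_def
    proof (intro conjI allI impI)
      show "over (powerf X) (filt S i) \<subseteq> over (powerf X) (filt S (Suc i))" for i by (rule over_mono[OF mono])
      have cover: "\<exists>i. b \<in> filt S i" if "b \<in> topspace (bas X)" for b
        using S that unfolding bX stratified_space_def is_sequential_colimit_def by blast
      show "(\<Union>i. over (powerf X) (filt S i)) = topspace (tot (powerf X))"
        using cover is_familyD(5)[OF is_family_powerf[OF X]] by (fastforce simp: over_def)
      fix U assume U: "U \<subseteq> topspace (tot (powerf X))"
      have steps: "\<exists>M A h hb k kb E. pushout_step C F V X M (filt S i) (filt S (Suc i)) A h hb k kb E" for i
      proof -
        have "1 \<le> Suc i" by simp
        from step[OF this] obtain M :: "('o, 'a, 'a, 'a) family" and h k E
          where "pushout_step C F V X M (filt S (Suc i - 1)) (filt S (Suc i)) (cwA S (Suc i)) h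
            (att S (Suc i)) k (charm S (Suc i)) E"
          by (elim exE conjE)
        then show ?thesis unfolding diff_Suc_1 by (intro exI)
      qed
      have sub: "subtopology (mapspace X) (over (powerf X) (filt S i)) = mapspace (restr_family X (filt S i))" for i
        using arg_cong[OF restr_powerf[OF X, of "filt S i"], of tot] by simp
      show "openin (tot (powerf X)) U \<longleftrightarrow>
          (\<forall>i. openin (subtopology (tot (powerf X)) (over (powerf X) (filt S i))) (U \<inter> over (powerf X) (filt S i)))"
      proof
        assume "openin (tot (powerf X)) U"
        then show "\<forall>i. openin (subtopology (tot (powerf X)) (over (powerf X) (filt S i))) (U \<inter> over (powerf X) (filt S i))"
          by (intro allI openin_subtopology_Int)
      next
        assume "\<forall>i. openin (subtopology (tot (powerf X)) (over (powerf X) (filt S i))) (U \<inter> over (powerf X) (filt S i))"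
        then have "openin (mapspace (restr_family X (filt S i))) (U \<inter> maps (restr_family X (filt S i)))" for i
          unfolding maps_restr[OF X] by (simp add: sub)
        then have "openin (mapspace X) U"
          using U by (intro openin_mapspace_colimit[OF X colim mono steps]) simp_all
        then show "openin (tot (powerf X)) U" by simp
      qed
    qed
  qed
qed

end
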